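(* Let $\kappa\in\{1,-1\}$ and let $\Phi_t$ be the flow on $X$ of $i\partial_tq=-\frac12\partial_x^2q+\kappa|q|^2q$. Let $q_0\in X$ and let $q_{0,n}\to q_0$ in $X$. Then $$\sup_{|t|\le T}\|\Phi_t(q_{0,n})-\Phi_t(q_0)\|_5\to0\qquad\text{for every }T<\infty.$$ In particular this applies to the finite block regularizations $q_{0,n}=\sum_{|k|\le n}\Box_kq_0$, which belong to $C_b^\infty(\mathbb R)$ (and converge to $q_0$ in $X$). If $q_0$ is moreover Bohr almost periodic, there are trigonometric polynomials converging to $q_0$ in $X$, and the conclusion applies to any such approximating sequence.
   Context: Choose a real, even $\chi\in C_c^\infty((-1,1))$ with $\sum_{k\in\mathbb Z}\chi(\xi-k)=1$. With $\widehat f(\xi)=\int e^{-ix\xi}f(x)\,dx$, put $\Box_kf=\mathcal F^{-1}(\chi(\xi-k)\widehat f(\xi))$, $\langle k\rangle=(1+k^2)^{1/2}$. For $s\ge0$, $X_s=\{f\in\mathcal S'(\mathbb R):\|f\|_s:=\sum_{k}\langle k\rangle^s\|\Box_kf\|_\infty<\infty\}$, and $X=X_5$ (complex-valued). $C_b^\infty(\mathbb R)$ denotes smooth functions with all derivatives bounded. A trigonometric polynomial is a finite sum $\sum_jc_je^{i\lambda_jx}$, $\lambda_j\in\mathbb R$. Flow: for every $q_0\in X$ there is a global classical solution $q\in C(\mathbb R;X)\cap C^1(\mathbb R;X_3)$ of the equation with $q(0)=q_0$, unique among classical solutions $v$ with $v,v_x$ bounded on every strip $[-T,T]\times\mathbb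 R$, $T<\infty$; $\Phi_t(q_0)=q(t)$. *)

theory Defs
  imports "HOL-Analysis.Analysis"
begin

subsection \<open>Smooth, Schwartz and almost periodic functions on the line\<close>

definition nth_vderiv :: "nat \<Rightarrow> (real \<Rightarrow> 'a::real_normed_vector) \<Rightarrow> real \<Rightarrow> 'a" where
  "nth_vderiv k f = ((\<lambda>g x. vector_derivative g (at x)) ^^ k) f"

definition smooth :: "(real \<Rightarrow> 'a::real_normed_vector) \<Rightarrow> bool" where
  "smooth f \<longleftrightarrow> (\<forall>k x. nth_vderiv k f differentiable (at x))"

definition Cb_infinity :: "(real \<Rightarrow> complex) set" where
  "Cb_infinity = {f. smooth f \<and> (\<forall>k. bounded (range (nth_vderiv k f)))}"

definition schwartz :: "(real \<Rightarrow> complex) set" where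
  "schwartz = {f. smooth f \<and> (\<forall>j k. bounded (range (\<lambda>x. \<bar>x\<bar> ^ j *\<^sub>R nth_vderiv k f x)))}"

definition schwartz_seminorm :: "nat \<Rightarrow> nat \<Rightarrow> (real \<Rightarrow> complex) \<Rightarrow> real" where
  "schwartz_seminorm j k f = (SUP x. \<bar>x\<bar> ^ j * norm (nth_vderiv k f x))"

definition trig_polynomial :: "(real \<Rightarrow> complex) \<Rightarrow> bool" where
  "trig_polynomial p \<longleftrightarrow> (\<exists>N::nat. \<exists>c :: nat \<Rightarrow> complex. \<exists>\<omega> :: nat \<Rightarrow> real.
     p = (\<lambda>x. \<Sum>j<N. c j * exp (\<i> * of_real (\<omega> j * x))))"

text \<open>Bohr's definition: the \<open>\<epsilon>\<close>-almost periods are relatively dense for every \<open>\<epsilon>\<close>.\<close>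

definition bohr_almost_periodic :: "(real \<Rightarrow> complex) \<Rightarrow> bool" where
  "bohr_almost_periodic f \<longleftrightarrow> continuous_on UNIV f \<and>
     (\<forall>\<epsilon>>0. \<exists>L>0. \<forall>a. \<exists>\<tau>\<in>{a..a + L}. \<forall>x. norm (f (x + \<tau>) - f x) \<le> \<epsilon>)"


subsection \<open>Tempered distributions\<close>

text \<open>
  A tempered distribution is a functional on the Schwartz functions. It is extended by zero to all
  functions, so that equality of distributions is equality in HOL.
\<close>

type_synonym distribution = "(real \<Rightarrow> complex) \<Rightarrow> complex"

definition tempered :: "distribution set" where
  "tempered = {S.
     (\<forall>\<phi>\<in>schwartz. \<forall>\<psi>\<in>schwartz. S (\<lambda>x. \<phi> x + \<psi> x) = S \<phi> + S \<psi>) \<and>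
     (\<forall>\<phi>\<in>schwartz. \<forall>c. S (\<lambda>x. c * \<phi> x) = c * S \<phi>) \<and>
     (\<exists>C N. \<forall>\<phi>\<in>schwartz. norm (S \<phi>) \<le> C * (\<Sum>j\<le>N. \<Sum>k\<le>N. schwartz_seminorm j k \<phi>)) \<and>
     (\<forall>\<phi>. \<phi> \<notin> schwartz \<longrightarrow> S \<phi> = 0)}"

text \<open>The distribution given by a function, and the operations on distributions by duality.\<close>

definition reg_dist :: "(real \<Rightarrow> complex) \<Rightarrow> distribution" where
  "reg_dist f = (\<lambda>\<phi>. if \<phi> \<in> schwartz then (LINT x|lborel. f x * \<phi> x) else 0)"

definition fourier :: "(real \<Rightarrow> complex) \<Rightarrow> real \<Rightarrow> complex" where
  "fourier f \<xi> = (LINT x|lborel. exp (- (\<i> * of_real (x * \<xi>))) * f x)"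

definition inv_fourier :: "(real \<Rightarrow> complex) \<Rightarrow> real \<Rightarrow> complex" where
  "inv_fourier g x = (LINT \<xi>|lborel. exp (\<i> * of_real (x * \<xi>)) * g \<xi>) / of_real (2 * pi)"

definition dist_fourier :: "distribution \<Rightarrow> distribution" where
  "dist_fourier S = (\<lambda>\<phi>. if \<phi> \<in> schwartz then S (fourier \<phi>) else 0)"

definition dist_inv_fourier :: "distribution \<Rightarrow> distribution" where
  "dist_inv_fourier S = (\<lambda>\<phi>. if \<phi> \<in> schwartz then S (inv_fourier \<phi>) else 0)"

definition dist_mult :: "(real \<Rightarrow> complex) \<Rightarrow> distribution \<Rightarrow> distribution" where
  "dist_mult m S = (\<lambda>\<phi>. if \<phi> \<in> schwartz then S (\<lambda>x. m x * \<phi> x) else 0)"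

text \<open>
  The \<open>L\<^sup>\<infinity>\<close> norm of a distribution; it is infinite unless the distribution is given by a bounded
  measurable function. Since representatives may be changed on null sets, the infimum of the
  suprema is the essential supremum.
\<close>

definition Linf_norm :: "distribution \<Rightarrow> ennreal" where
  "Linf_norm S = (INF f\<in>{f \<in> borel_measurable borel. reg_dist f = S}. SUP x. ennreal (norm (f x)))"


subsection \<open>Frequency-uniform decomposition and the spaces \<open>X\<^sub>s\<close>\<close>

definition freq_window :: "(real \<Rightarrow> real) \<Rightarrow> bool" where
  "freq_window \<eta> \<longleftrightarrow> smooth \<eta> \<and> closure {\<xi>. \<eta> \<xi> \<noteq> 0} \<subseteq> {-1<..<1} \<and>
     (\<forall>\<xi>. \<eta> (- \<xi>) = \<eta> \<xi>) \<and> (\<forall>\<xi>. ((\<lambda>k::int. \<eta> (\<xi> - of_int k)) has_sum 1) UNIV)"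

definition freq_block :: "(real \<Rightarrow> real) \<Rightarrow> int \<Rightarrow> distribution \<Rightarrow> distribution" where
  "freq_block \<eta> k S =
     dist_inv_fourier (dist_mult (\<lambda>\<xi>. of_real (\<eta> (\<xi> - of_int k))) (dist_fourier S))"

definition japanese_bracket :: "int \<Rightarrow> real" where
  "japanese_bracket k = sqrt (1 + (of_int k)\<^sup>2)"

definition X_norm :: "(real \<Rightarrow> real) \<Rightarrow> real \<Rightarrow> distribution \<Rightarrow> ennreal" where
  "X_norm \<eta> s S =
     (\<Sum>\<^sub>\<infinity>k\<in>(UNIV :: int set). ennreal (japanese_bracket k powr s) * Linf_norm (freq_block \<eta> k S))"

definition X_space :: "(real \<Rightarrow> real) \<Rightarrow> real \<Rightarrow> distribution set" where
  "X_space \<eta> s = {S \<in> tempered. X_norm \<eta> s S < \<infinity>}"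

definition X_converges ::
    "(real \<Rightarrow> real) \<Rightarrow> real \<Rightarrow> (nat \<Rightarrow> distribution) \<Rightarrow> distribution \<Rightarrow> bool" where
  "X_converges \<eta> s F S \<longleftrightarrow> (\<forall>n. F n \<in> X_space \<eta> s) \<and> S \<in> X_space \<eta> s \<and>
     (\<lambda>n. X_norm \<eta> s (F n - S)) \<longlonglongrightarrow> 0"

definition block_regularization :: "(real \<Rightarrow> real) \<Rightarrow> nat \<Rightarrow> distribution \<Rightarrow> distribution" where
  "block_regularization \<eta> n S = (\<lambda>\<phi>. \<Sum>k\<in>{- int n..int n}. freq_block \<eta> k S \<phi>)"

definition X_continuous :: "(real \<Rightarrow> real) \<Rightarrow> real \<Rightarrow> (real \<Rightarrow> distribution) \<Rightarrow> bool" where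
  "X_continuous \<eta> s Q \<longleftrightarrow> (\<forall>t. Q t \<in> X_space \<eta> s) \<and>
     (\<forall>t. ((\<lambda>r. X_norm \<eta> s (Q r - Q t)) \<longlongrightarrow> 0) (at t))"

definition X_C1 :: "(real \<Rightarrow> real) \<Rightarrow> real \<Rightarrow> (real \<Rightarrow> distribution) \<Rightarrow> bool" where
  "X_C1 \<eta> s Q \<longleftrightarrow> (\<forall>t. Q t \<in> X_space \<eta> s) \<and>
     (\<exists>Q'. X_continuous \<eta> s Q' \<and>
       (\<forall>t. ((\<lambda>h. X_norm \<eta> s (\<lambda>\<phi>. (Q (t + h) \<phi> - Q t \<phi>) / of_real h - Q' t \<phi>)) \<longlongrightarrow> 0) (at 0)))"


subsection \<open>The cubic nonlinear Schroedinger flow\<close>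

text \<open>Functions of time and space are curried, with the time first.\<close>

definition classical_solution :: "real \<Rightarrow> (real \<Rightarrow> real \<Rightarrow> complex) \<Rightarrow> bool" where
  "classical_solution \<kappa> u \<longleftrightarrow> (\<exists>ut ux uxx.
     continuous_on UNIV (\<lambda>(t, x). u t x) \<and> continuous_on UNIV (\<lambda>(t, x). ut t x) \<and>
     continuous_on UNIV (\<lambda>(t, x). ux t x) \<and> continuous_on UNIV (\<lambda>(t, x). uxx t x) \<and>
     (\<forall>t x. ((\<lambda>r. u r x) has_vector_derivative ut t x) (at t) \<and>
            (u t has_vector_derivative ux t x) (at x) \<and>
            (ux t has_vector_derivative uxx t x) (at x) \<and>
            \<i> * ut t x = - (1 / 2) * uxx t x + of_real (\<kappa> * (norm (u t x))\<^sup>2) * u t x))"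

definition bounded_on_strips :: "(real \<Rightarrow> real \<Rightarrow> complex) \<Rightarrow> bool" where
  "bounded_on_strips v \<longleftrightarrow> (\<forall>T. \<exists>M. \<forall>t\<in>{-T..T}. \<forall>x. norm (v t x) \<le> M)"

text \<open>
  \<open>nls_flow \<eta> \<kappa> \<Phi>\<close> says that \<open>\<Phi>\<close> is the flow: every datum in \<open>X\<^sub>5\<close> launches the global classical
  solution \<open>t \<mapsto> \<Phi> t q\<^sub>0\<close>, and every classical solution with the same datum that is bounded on
  strips together with its space derivative coincides with it. Values of \<open>\<Phi>\<close> off \<open>X\<^sub>5\<close> are
  irrelevant.
\<close>

definition nls_flow ::
    "(real \<Rightarrow> real) \<Rightarrow> real \<Rightarrow> (real \<Rightarrow> distribution \<Rightarrow> distribution) \<Rightarrow> bool" where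
  "nls_flow \<eta> \<kappa> \<Phi> \<longleftrightarrow> (\<forall>q\<^sub>0\<in>X_space \<eta> 5.
     (\<exists>u. classical_solution \<kappa> u \<and> (\<forall>t. \<Phi> t q\<^sub>0 = reg_dist (u t))) \<and>
     \<Phi> 0 q\<^sub>0 = q\<^sub>0 \<and>
     X_continuous \<eta> 5 (\<lambda>t. \<Phi> t q\<^sub>0) \<and> X_C1 \<eta> 3 (\<lambda>t. \<Phi> t q\<^sub>0) \<and>
     (\<forall>v. classical_solution \<kappa> v \<and> bounded_on_strips v \<and>
          bounded_on_strips (\<lambda>t x. vector_derivative (v t) (at x)) \<and> reg_dist (v 0) = q\<^sub>0 \<longrightarrow>
          (\<forall>t. reg_dist (v t) = \<Phi> t q\<^sub>0)))"

definition flow_converges ::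
    "(real \<Rightarrow> real) \<Rightarrow> (real \<Rightarrow> distribution \<Rightarrow> distribution) \<Rightarrow> (nat \<Rightarrow> distribution) \<Rightarrow>
     distribution \<Rightarrow> bool" where
  "flow_converges \<eta> \<Phi> F q\<^sub>0 \<longleftrightarrow>
     (\<forall>T. (\<lambda>n. SUP t\<in>{t. \<bar>t\<bar> \<le> T}. X_norm \<eta> 5 (\<Phi> t (F n) - \<Phi> t q\<^sub>0)) \<longlonglongrightarrow> 0)"

end

theory Submission
  imports Defs "HOL-Probability.Characteristic_Functions" "HOL-Probability.Sinc_Integral"
begin

text \<open>
  Every element of \<open>X\<^sub>s\<close> is given by a bounded continuous function, the uniformly convergent sum of its
  frequency blocks, so the norm of the difference of two solutions can be followed block by block. In the
  frame moving with speed \<open>k\<close>, and after removing a phase, the free evolution of the block at frequency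
  \<open>k\<close> is generated by the multiplier \<open>(\<xi> - k)\<^sup>2\<close>, which is bounded on that block uniformly in \<open>k\<close>. Since \<open>X\<^sub>5\<close>
  is an algebra, the weighted sum of the block norms obeys a Gronwall inequality; no Duhamel formula is
  needed. Block sums converge because the tails of the norm tend to zero. For almost periodic data only
  finitely many blocks matter up to a small error, and on these uniform approximation by trigonometric
  polynomials suffices. Bohr's approximation theorem follows from Fourier analysis on finite cyclic groups
  and compactness: the number of relevant frequencies, their size and their coefficients stay bounded.
\<close>

section \<open>Smooth and Schwartz functions\<close>

text \<open>The free evolution is not bounded in the sup norm, so a loss-free estimate has to be
  found on each block separately. The frame comes from completing the square,
  \<open>\<xi>^2 = (\<xi> - k)^2 + 2 * k * \<xi> - k^2\<close>: the linear part acts as a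
  translation and the constant part as a phase, and both preserve the supremum of a block. The
  linear evolution therefore costs at most the rate \<open>square_ker / 2\<close>. A second obstacle
  is that the Lipschitz constant of the cubic term depends on both solutions, while only the
  limiting one is bounded in advance, by some \<open>M\<close>. The bound for the other one comes
  from a continuity argument: as long as the difference stays below 1, it is at most
  \<open>M + 1\<close>, and the initial distance \<open>d\<close> is taken so small that
  \<open>d * exp (L * s)\<close> remains below 1 up to time \<open>T\<close>. A third obstacle is
  that the flow is given only through its defining properties, so boundedness of the derivatives in
  space and time has to be recovered before any integral may be differentiated.\<close>

lemma nth_vderiv_0 [simp]: "nth_vderiv 0 f = f"
  by (simp add: nth_vderiv_def)

lemma nth_vderiv_Suc: "nth_vderiv (Suc k) f = (\<lambda>x. vector_derivative (nth_vderiv k f) (at x))"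
  by (simp add: nth_vderiv_def)

lemma nth_vderiv_add_index: "nth_vderiv (j + k) f = nth_vderiv j (nth_vderiv k f)"
  by (simp add: nth_vderiv_def funpow_add)

lemma nth_vderiv_Suc': "nth_vderiv (Suc k) f = nth_vderiv k (nth_vderiv (Suc 0) f)"
  using nth_vderiv_add_index[of k "Suc 0" f] by simp

section \<open>Towers of derivatives\<close>

lemma smooth_has_vderiv:
  "smooth f \<Longrightarrow> (nth_vderiv k f has_vector_derivative nth_vderiv (Suc k) f x) (at x)"
  unfolding smooth_def nth_vderiv_Suc by (simp add: vector_derivative_works)

text \<open>Together with \<open>smoothI\<close> this is the standard way to smoothness below: one
  exhibits the whole tower \<open>D\<close> of candidates, and a single first-order computation
  yields both smoothness and the formula for every derivative.\<close>

lemma nth_vderiv_unique: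
  assumes "\<And>k x. (D k has_vector_derivative D (Suc k) x) (at x)"
  shows "nth_vderiv k (D 0) = D k"
  by (induction k) (use assms in \<open>auto simp: nth_vderiv_Suc vector_derivative_at\<close>)

lemma smoothI:
  assumes "\<And>k x. (D k has_vector_derivative D (Suc k) x) (at x)"
  shows "smooth (D 0)"
  unfolding smooth_def nth_vderiv_unique[of D, OF assms]
  using assms by (auto intro: differentiableI_vector)

lemma nth_vderiv_Suc0_eq:
  assumes "\<And>x. (f has_vector_derivative f' x) (at x)"
  shows "nth_vderiv (Suc 0) f = f'"
  using assms by (auto simp: nth_vderiv_Suc vector_derivative_at)

text \<open>The recursion peels off the first derivative, so the product rule is iterated by plain
  induction without a binomial formula. The class \<open>B\<close> is a parameter because the same
  closure lemmas serve rapidly decaying, polynomially growing, bounded and arbitrary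
  functions.\<close>

primrec cn_in :: "(real \<Rightarrow> 'a::real_normed_vector) set \<Rightarrow> nat \<Rightarrow> (real \<Rightarrow> 'a) \<Rightarrow> bool" where
  "cn_in B 0 f \<longleftrightarrow> f \<in> B"
| "cn_in B (Suc n) f \<longleftrightarrow> f \<in> B \<and> (\<exists>f'. (\<forall>x. (f has_vector_derivative f' x) (at x)) \<and> cn_in B n f')"

lemma cn_in_Suc_iff:
  "cn_in B (Suc n) f \<longleftrightarrow> f \<in> B \<and> (\<forall>x. f differentiable (at x)) \<and> cn_in B n (nth_vderiv (Suc 0) f)"
proof
  assume L: "cn_in B (Suc n) f"
  then obtain f' where f': "\<And>x. (f has_vector_derivative f' x) (at x)" "cn_in B n f'" by auto
  then have "nth_vderiv (Suc 0) f = f'" by (intro nth_vderiv_Suc0_eq)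
  then show "f \<in> B \<and> (\<forall>x. f differentiable (at x)) \<and> cn_in B n (nth_vderiv (Suc 0) f)"
    using f' L by (auto intro: differentiableI_vector)
next
  assume "f \<in> B \<and> (\<forall>x. f differentiable (at x)) \<and> cn_in B n (nth_vderiv (Suc 0) f)"
  then show "cn_in B (Suc n) f"
    by (auto simp: nth_vderiv_Suc vector_derivative_works intro!: exI[of _ "nth_vderiv (Suc 0) f"])
qed

lemma cn_in_iff:
  "cn_in B n f \<longleftrightarrow> (\<forall>k\<le>n. nth_vderiv k f \<in> B) \<and> (\<forall>k<n. \<forall>x. nth_vderiv k f differentiable (at x))"
proof (induction n arbitrary: f)
  case (Suc n)
  have "(\<forall>k\<le>Suc n. nth_vderiv k f \<in> B) \<longleftrightarrow> f \<in> B \<and> (\<forall>k\<le>n. nth_vderiv (Suc k) f \<in> B)"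
    using All_less_Suc2[of "Suc n" "\<lambda>k. nth_vderiv k f \<in> B"] by (simp add: less_Suc_eq_le)
  moreover have "(\<forall>k<Suc n. \<forall>x. nth_vderiv k f differentiable (at x)) \<longleftrightarrow>
      (\<forall>x. f differentiable (at x)) \<and> (\<forall>k<n. \<forall>x. nth_vderiv (Suc k) f differentiable (at x))"
    using All_less_Suc2[of n "\<lambda>k. \<forall>x. nth_vderiv k f differentiable (at x)"] by simp
  ultimately show ?case
    unfolding cn_in_Suc_iff Suc.IH nth_vderiv_Suc'[symmetric] by blast
qed auto

lemma all_cn_in_iff: "(\<forall>n. cn_in B n f) \<longleftrightarrow> smooth f \<and> (\<forall>k. nth_vderiv k f \<in> B)"
  unfolding cn_in_iff smooth_def by (meson le_refl lessI)

lemma cn_in_mono: "cn_in B n f \<Longrightarrow> B \<subseteq> C \<Longrightarrow> cn_in C n f"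
  unfolding cn_in_iff by blast

lemma cn_in_Suc: "cn_in B (Suc n) f \<Longrightarrow> cn_in B n f"
  unfolding cn_in_iff by auto

lemma cn_in_add:
  assumes "\<And>f g. f \<in> B \<Longrightarrow> g \<in> B \<Longrightarrow> (\<lambda>x. f x + g x) \<in> B"
  shows "cn_in B n f \<Longrightarrow> cn_in B n g \<Longrightarrow> cn_in B n (\<lambda>x. f x + g x)"
proof (induction n arbitrary: f g)
  case (Suc n)
  from Suc.prems obtain f' g' where
    "\<And>x. (f has_vector_derivative f' x) (at x)" "cn_in B n f'"
    "\<And>x. (g has_vector_derivative g' x) (at x)" "cn_in B n g'" by auto
  then show ?case using Suc assms
    by (auto intro!: exI[of _ "\<lambda>x. f' x + g' x"] has_vector_derivative_add)
qed (use assms in auto)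

lemma cn_in_mult:
  fixes f g :: "real \<Rightarrow> 'a::real_normed_algebra"
  assumes "\<And>f g. f \<in> C \<Longrightarrow> g \<in> C \<Longrightarrow> (\<lambda>x. f x + g x) \<in> C"
    and "\<And>f g. f \<in> A \<Longrightarrow> g \<in> B \<Longrightarrow> (\<lambda>x. f x * g x) \<in> C"
  shows "cn_in A n f \<Longrightarrow> cn_in B n g \<Longrightarrow> cn_in C n (\<lambda>x. f x * g x)"
proof (induction n arbitrary: f g)
  case (Suc n)
  from Suc.prems obtain f' g' where fg:
    "\<And>x. (f has_vector_derivative f' x) (at x)" "cn_in A n f'"
    "\<And>x. (g has_vector_derivative g' x) (at x)" "cn_in B n g'" by auto
  have "cn_in C n (\<lambda>x. f x * g' x + f' x * g x)"
    using fg Suc.prems[THEN cn_in_Suc] Suc.IH by (intro cn_in_add assms(1)) auto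
  then show ?case using Suc.prems assms fg
    by (auto intro!: exI[of _ "\<lambda>x. f x * g' x + f' x * g x"] has_vector_derivative_mult)
qed (use assms in auto)

definition rapid :: "(real \<Rightarrow> complex) set" where
  "rapid = {f. \<forall>j. bounded (range (\<lambda>x. \<bar>x\<bar> ^ j *\<^sub>R f x))}"

definition poly_growth :: "(real \<Rightarrow> complex) set" where
  "poly_growth = {f. \<exists>C d. \<forall>x. norm (f x) \<le> C * (1 + \<bar>x\<bar> ^ d)}"

lemma rapid_add: "f \<in> rapid \<Longrightarrow> g \<in> rapid \<Longrightarrow> (\<lambda>x. f x + g x) \<in> rapid"
  unfolding rapid_def by (auto simp: scaleR_right_distrib intro!: bounded_plus_comp)

lemma rapidE:
  assumes "f \<in> rapid" obtains C where "\<And>x. \<bar>x\<bar> ^ j * norm (f x) \<le> C" "C \<ge> 0"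
proof -
  from assms have "bounded (range (\<lambda>x. \<bar>x\<bar> ^ j *\<^sub>R f x))" by (auto simp: rapid_def)
  then obtain C where "\<And>x. norm (\<bar>x\<bar> ^ j *\<^sub>R f x) \<le> C" by (auto simp: bounded_iff)
  then have "\<And>x. \<bar>x\<bar> ^ j * norm (f x) \<le> max C 0" by (simp add: max.coboundedI1)
  then show thesis using that[of "max C 0"] by auto
qed

lemma rapidI: "(\<And>j. \<exists>C. \<forall>x. \<bar>x\<bar> ^ j * norm (f x) \<le> C) \<Longrightarrow> f \<in> rapid"
  unfolding rapid_def by (auto simp: bounded_iff)

text \<open>Growth of order \<open>d\<close> consumes \<open>d\<close> powers of
  \<open>\<bar>x\<bar>\<close>, and decay of order \<open>j + d\<close> pays for them.\<close>

lemma rapid_mult: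
  assumes "f \<in> poly_growth" "g \<in> rapid" shows "(\<lambda>x. f x * g x) \<in> rapid"
proof (rule rapidI)
  fix j
  from assms(1) obtain C d where f: "\<And>x. norm (f x) \<le> C * (1 + \<bar>x\<bar> ^ d)"
    by (auto simp: poly_growth_def)
  from rapidE[OF assms(2), of j] obtain A where A: "\<And>x. \<bar>x\<bar> ^ j * norm (g x) \<le> A" "A \<ge> 0" by auto
  from rapidE[OF assms(2), of "j + d"] obtain B where
    B: "\<And>x. \<bar>x\<bar> ^ (j + d) * norm (g x) \<le> B" "B \<ge> 0" by auto
  have "\<bar>x\<bar> ^ j * norm (f x * g x) \<le> \<bar>C\<bar> * (A + B)" for x
  proof -
    have "\<bar>x\<bar> ^ j * norm (f x * g x) = norm (f x) * (\<bar>x\<bar> ^ j * norm (g x))"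
      by (simp add: norm_mult)
    also have "\<dots> \<le> (\<bar>C\<bar> * (1 + \<bar>x\<bar> ^ d)) * (\<bar>x\<bar> ^ j * norm (g x))"
      by (intro mult_right_mono order.trans[OF f]) auto
    also have "\<dots> = \<bar>C\<bar> * (\<bar>x\<bar> ^ j * norm (g x) + \<bar>x\<bar> ^ (j + d) * norm (g x))"
      by (simp add: algebra_simps power_add)
    also have "\<dots> \<le> \<bar>C\<bar> * (A + B)" by (intro mult_left_mono add_mono A B) auto
    finally show ?thesis .
  qed
  then show "\<exists>C. \<forall>x. \<bar>x\<bar> ^ j * norm (f x * g x) \<le> C" by blast
qed

section \<open>Closure properties of the Schwartz space\<close>

lemma schwartz_iff: "f \<in> schwartz \<longleftrightarrow> (\<forall>n. cn_in rapid n f)"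
  unfolding all_cn_in_iff schwartz_def rapid_def by blast

lemma Cb_infinity_iff: "f \<in> Cb_infinity \<longleftrightarrow> (\<forall>n. cn_in {f. bounded (range f)} n f)"
  unfolding all_cn_in_iff by (auto simp: Cb_infinity_def)

lemma smooth_iff: "smooth f \<longleftrightarrow> (\<forall>n. cn_in UNIV n f)"
  unfolding all_cn_in_iff by auto

lemma bounded_poly_growth: "bounded (range f) \<Longrightarrow> f \<in> poly_growth"
proof -
  assume "bounded (range f)"
  then obtain C where "\<And>x. norm (f x) \<le> C" by (auto simp: bounded_iff)
  then have "\<forall>x. norm (f x) \<le> C / 2 * (1 + \<bar>x\<bar> ^ 0)" by simp
  then show ?thesis unfolding poly_growth_def by blast
qed

lemma schwartz_rapid: "f \<in> schwartz \<Longrightarrow> f \<in> rapid"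
  using schwartz_iff[of f] cn_in.simps(1) by blast

lemma schwartz_smooth: "f \<in> schwartz \<Longrightarrow> smooth f" by (simp add: schwartz_def)

lemma schwartz_bounded: "f \<in> schwartz \<Longrightarrow> bounded (range f)"
  using rapidE[OF schwartz_rapid, of f 0] by (auto simp: bounded_iff)

lemma schwartz_add: "f \<in> schwartz \<Longrightarrow> g \<in> schwartz \<Longrightarrow> (\<lambda>x. f x + g x) \<in> schwartz"
  by (simp add: schwartz_iff cn_in_add rapid_add)

lemma schwartz_zero: "(\<lambda>x. 0) \<in> schwartz"
  using smoothI[of "\<lambda>k x. 0::complex"] nth_vderiv_unique[of "\<lambda>k x. 0::complex"]
  by (auto simp: schwartz_def)

lemma schwartz_sum: "(\<And>i. i \<in> I \<Longrightarrow> f i \<in> schwartz) \<Longrightarrow> (\<lambda>x. \<Sum>i\<in>I. f i x) \<in> schwartz"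
  by (induction I rule: infinite_finite_induct) (auto simp: schwartz_zero intro: schwartz_add)

lemma schwartz_mult_poly_growth:
  assumes "\<And>n. cn_in poly_growth n m" "f \<in> schwartz"
  shows "(\<lambda>x. m x * f x) \<in> schwartz"
  using assms unfolding schwartz_iff by (blast intro: cn_in_mult rapid_add rapid_mult)

lemma schwartz_mult_Cb:
  assumes "m \<in> Cb_infinity" "f \<in> schwartz"
  shows "(\<lambda>x. m x * f x) \<in> schwartz"
proof (intro schwartz_mult_poly_growth assms)
  show "cn_in poly_growth n m" for n
    by (rule cn_in_mono[of "{f. bounded (range f)}"])
       (use assms bounded_poly_growth in \<open>auto simp: Cb_infinity_iff\<close>)
qed

lemma schwartz_nth_vderiv: "f \<in> schwartz \<Longrightarrow> nth_vderiv k f \<in> schwartz"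
  unfolding schwartz_def smooth_def by (auto simp flip: nth_vderiv_add_index)

lemma schwartz_Cb: "f \<in> schwartz \<Longrightarrow> f \<in> Cb_infinity"
  unfolding Cb_infinity_def using schwartz_bounded[OF schwartz_nth_vderiv] schwartz_smooth by blast

lemma schwartz_mult: "f \<in> schwartz \<Longrightarrow> g \<in> schwartz \<Longrightarrow> (\<lambda>x. f x * g x) \<in> schwartz"
  by (intro schwartz_mult_Cb schwartz_Cb)

lemma Cb_const: "(\<lambda>x. c) \<in> Cb_infinity"
proof -
  have *: "((\<lambda>x. if k = 0 then c else 0) has_vector_derivative (if Suc k = 0 then c else 0)) (at x)"
    for k and x :: real by simp
  show ?thesis
    using smoothI[of "\<lambda>k x. if k = 0 then c else 0", OF *]
      nth_vderiv_unique[of "\<lambda>k x. if k = 0 then c else 0", OF *]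
    by (simp add: Cb_infinity_def)
qed

lemma schwartz_cmult: "f \<in> schwartz \<Longrightarrow> (\<lambda>x. c * f x) \<in> schwartz"
  by (intro schwartz_mult_Cb Cb_const)

lemma schwartz_diff: "f \<in> schwartz \<Longrightarrow> g \<in> schwartz \<Longrightarrow> (\<lambda>x. f x - g x) \<in> schwartz"
  using schwartz_add[of f "\<lambda>x. -1 * g x"] schwartz_cmult[of g "-1"] by simp

lemma schwartz_ident_mult:
  assumes "f \<in> schwartz" shows "(\<lambda>x. complex_of_real x * f x) \<in> schwartz"
proof (rule schwartz_mult_poly_growth[OF _ assms])
  fix n
  have 0: "cn_in poly_growth n (\<lambda>x. 0)" for n
    by (rule cn_in_mono[of "{f. bounded (range f)}"])
       (use schwartz_Cb[OF schwartz_zero] bounded_poly_growth in \<open>auto simp: Cb_infinity_iff\<close>)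
  have 1: "cn_in poly_growth n (\<lambda>x. 1)" for n
    using 0 by (cases n) (auto intro!: bounded_poly_growth exI[of _ "\<lambda>x. 0"])
  have "complex_of_real \<in> poly_growth"
    unfolding poly_growth_def by (auto intro!: exI[of _ 1] exI[of _ 1])
  then show "cn_in poly_growth n complex_of_real"
    using 1 by (cases n) (auto intro!: exI[of _ "\<lambda>x. 1"] derivative_eq_intros simp: has_vector_derivative_def scaleR_conv_of_real)
qed

lemma schwartz_power_mult:
  assumes "f \<in> schwartz" shows "(\<lambda>x. (c * complex_of_real x) ^ k * f x) \<in> schwartz"
proof (induction k)
  case (Suc k)
  from schwartz_cmult[OF schwartz_ident_mult[OF Suc], of c] show ?case by (simp add: algebra_simps)
qed (use assms in simp)

section \<open>Locality, compact support and elementary smooth functions\<close>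

lemma smooth_continuous: "smooth f \<Longrightarrow> continuous_on A (nth_vderiv k f)"
  unfolding smooth_def by (meson continuous_at_imp_continuous_on differentiable_imp_continuous_within)

lemma nth_vderiv_zero_open:
  assumes "smooth f" "open U" "\<And>x. x \<in> U \<Longrightarrow> f x = 0" "x \<in> U"
  shows "nth_vderiv k f x = 0"
  using assms(4)
proof (induction k arbitrary: x)
  case (Suc k)
  then have "((\<lambda>x. 0) has_vector_derivative nth_vderiv (Suc k) f x) (at x)"
    using assms(2)
    by (intro has_vector_derivative_transform_within_open[OF smooth_has_vderiv[OF assms(1)], where S=U]) auto
  then show ?case
    using vector_derivative_unique_at[OF _ has_vector_derivative_const] by blast
qed (use assms in auto)

text \<open>Differentiation is local, so every derivative vanishes beyond \<open>R\<close>; on the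
  remaining interval compactness gives the bounds.\<close>

lemma smooth_compact_schwartz:
  assumes "smooth f" "\<And>x. \<bar>x\<bar> > R \<Longrightarrow> f x = 0"
  shows "f \<in> schwartz"
proof -
  let ?B = "{g :: real \<Rightarrow> complex. \<forall>x. \<bar>x\<bar> > R \<longrightarrow> g x = 0}"
  have *: "nth_vderiv k f x = 0" if "\<bar>x\<bar> > R" for k x
  proof (rule nth_vderiv_zero_open[OF assms(1), of "{x. \<bar>x\<bar> > R}"])
    show "open {x::real. \<bar>x\<bar> > R}" by (intro open_Collect_less continuous_intros)
  qed (use that assms in auto)
  have "bounded (range (\<lambda>x. \<bar>x\<bar> ^ j *\<^sub>R nth_vderiv k f x))" for j k
  proof -
    have "compact ((\<lambda>x. \<bar>x\<bar> ^ j *\<^sub>R nth_vderiv k f x) ` {-\<bar>R\<bar>..\<bar>R\<bar>})"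
      by (intro compact_continuous_image continuous_intros smooth_continuous assms) auto
    then have b: "bounded (insert 0 ((\<lambda>x. \<bar>x\<bar> ^ j *\<^sub>R nth_vderiv k f x) ` {-\<bar>R\<bar>..\<bar>R\<bar>}))"
      by (simp add: compact_imp_bounded)
    show ?thesis
    proof (rule bounded_subset[OF b], safe)
      fix x assume "\<bar>x\<bar> ^ j *\<^sub>R nth_vderiv k f x \<notin> (\<lambda>x. \<bar>x\<bar> ^ j *\<^sub>R nth_vderiv k f x) ` {-\<bar>R\<bar>..\<bar>R\<bar>}"
      then have "x \<notin> {-\<bar>R\<bar>..\<bar>R\<bar>}" by blast
      then have "\<bar>x\<bar> > R" by auto
      then show "\<bar>x\<bar> ^ j *\<^sub>R nth_vderiv k f x = 0" using * by simp
    qed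
  qed
  then show ?thesis using assms by (auto simp: schwartz_def)
qed

lemma smooth_affine:
  assumes "smooth f"
  shows "smooth (\<lambda>x. f (a * x + b))"
    and "nth_vderiv k (\<lambda>x. f (a * x + b)) = (\<lambda>x. a ^ k *\<^sub>R nth_vderiv k f (a * x + b))"
proof -
  let ?D = "\<lambda>k x. a ^ k *\<^sub>R nth_vderiv k f (a * x + b)"
  have D: "(?D k has_vector_derivative ?D (Suc k) x) (at x)" for k x
  proof -
    have "((\<lambda>x. a * x + b) has_vector_derivative a) (at x)"
      by (auto intro!: derivative_eq_intros simp flip: has_real_derivative_iff_has_vector_derivative)
    from vector_diff_chain_at[OF this smooth_has_vderiv[OF assms, of k]]
    have "((\<lambda>x. nth_vderiv k f (a * x + b)) has_vector_derivative a *\<^sub>R nth_vderiv (Suc k) f (a * x + b)) (at x)"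
      by (simp add: o_def)
    from bounded_linear.has_vector_derivative[OF bounded_linear_scaleR_right this, of "a ^ k"]
    show ?thesis by (simp add: mult.commute)
  qed
  from smoothI[of ?D, OF D] show "smooth (\<lambda>x. f (a * x + b))" by simp
  from nth_vderiv_unique[of ?D, OF D] show "nth_vderiv k (\<lambda>x. f (a * x + b)) = ?D k" by simp
qed

lemma smooth_of_real:
  assumes "smooth f"
  shows "smooth (\<lambda>x. complex_of_real (f x))"
    and "nth_vderiv k (\<lambda>x. complex_of_real (f x)) = (\<lambda>x. complex_of_real (nth_vderiv k f x))"
proof -
  let ?D = "\<lambda>k x. complex_of_real (nth_vderiv k f x)"
  have D: "(?D k has_vector_derivative ?D (Suc k) x) (at x)" for k x
    by (intro bounded_linear.has_vector_derivative[OF bounded_linear_of_real] smooth_has_vderiv assms)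
  from smoothI[of ?D, OF D] show "smooth (\<lambda>x. complex_of_real (f x))" by simp
  from nth_vderiv_unique[of ?D, OF D] show "nth_vderiv k (\<lambda>x. complex_of_real (f x)) = ?D k" by simp
qed

lemma smooth_add:
  assumes "smooth f" "smooth g"
  shows "smooth (\<lambda>x. f x + g x)"
    and "nth_vderiv k (\<lambda>x. f x + g x) = (\<lambda>x. nth_vderiv k f x + nth_vderiv k g x)"
proof -
  let ?D = "\<lambda>k x. nth_vderiv k f x + nth_vderiv k g x"
  have D: "(?D k has_vector_derivative ?D (Suc k) x) (at x)" for k x
    by (intro has_vector_derivative_add smooth_has_vderiv assms)
  from smoothI[of ?D, OF D] show "smooth (\<lambda>x. f x + g x)" by simp
  from nth_vderiv_unique[of ?D, OF D] show "nth_vderiv k (\<lambda>x. f x + g x) = ?D k" by simp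
qed

lemma smooth_const: "smooth (\<lambda>x. c)"
  and nth_vderiv_const: "nth_vderiv k (\<lambda>x. c) = (\<lambda>x. if k = 0 then c else 0)"
proof -
  have *: "((\<lambda>x. if k = 0 then c else 0) has_vector_derivative (if Suc k = 0 then c else 0)) (at x)"
    for k and x :: real by simp
  show "smooth (\<lambda>x. c)" "nth_vderiv k (\<lambda>x. c) = (\<lambda>x. if k = 0 then c else 0)"
    using smoothI[of "\<lambda>k x. if k = 0 then c else 0", OF *]
      nth_vderiv_unique[of "\<lambda>k x. if k = 0 then c else 0", OF *]
    by simp_all
qed

lemma smooth_sum:
  assumes "\<And>i. i \<in> I \<Longrightarrow> smooth (f i)"
  shows "smooth (\<lambda>x. \<Sum>i\<in>I. f i x) \<and> (\<forall>k. nth_vderiv k (\<lambda>x. \<Sum>i\<in>I. f i x) = (\<lambda>x. \<Sum>i\<in>I. nth_vderiv k (f i) x))"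
  using assms
proof (induction I rule: infinite_finite_induct)
  case (insert i I)
  then show ?case using smooth_add[of "f i" "\<lambda>x. \<Sum>i\<in>I. f i x"] by simp
qed (auto simp: smooth_const nth_vderiv_const)

lemma smooth_mult:
  fixes f g :: "real \<Rightarrow> 'a::real_normed_algebra"
  shows "smooth f \<Longrightarrow> smooth g \<Longrightarrow> smooth (\<lambda>x. f x * g x)"
  unfolding smooth_iff by (blast intro: cn_in_mult)

text \<open>The common majorant of the dominated convergence arguments with Schwartz functions and
  kernels. Unlike the functions that it dominates, it behaves well under small shifts, see
  \<open>decay_shift\<close>.\<close>

lemma decay_integrable: "integrable lborel (\<lambda>x::real. C / (1 + x\<^sup>2))"
  using integrable_mult_right[OF integrable_inverse_1_plus_square[unfolded set_integrable_def], of C]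
  by (simp add: einterval_def divide_inverse mult.commute)

lemma schwartz_decay:
  assumes "f \<in> schwartz" obtains C where "C > 0" "\<And>x. norm (f x) \<le> C / (1 + x\<^sup>2)"
proof -
  obtain A where A: "\<And>x. norm (f x) \<le> A" "A \<ge> 0" using rapidE[OF schwartz_rapid[OF assms], of 0] by auto
  obtain B where B: "\<And>x. x\<^sup>2 * norm (f x) \<le> B" "B \<ge> 0"
    using rapidE[OF schwartz_rapid[OF assms], of 2] by auto
  have "norm (f x) \<le> (A + B + 1) / (1 + x\<^sup>2)" for x
  proof -
    have "norm (f x) * (1 + x\<^sup>2) \<le> A + B + 1" using A(1)[of x] B(1)[of x] by (simp add: algebra_simps)
    then show ?thesis by (simp add: pos_le_divide_eq add_pos_nonneg)
  qed
  then show thesis using that[of "A + B + 1"] A B by auto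
qed

lemma schwartz_continuous: "f \<in> schwartz \<Longrightarrow> continuous_on A f"
  using smooth_continuous[OF schwartz_smooth, of f A 0] by simp

lemma schwartz_borel [measurable_dest]: "f \<in> schwartz \<Longrightarrow> f \<in> borel_measurable borel"
  by (intro borel_measurable_continuous_onI schwartz_continuous)

lemma schwartz_integrable: "f \<in> schwartz \<Longrightarrow> integrable lborel f"
proof -
  assume f: "f \<in> schwartz"
  then obtain C where "\<And>x. norm (f x) \<le> C / (1 + x\<^sup>2)" using schwartz_decay by blast
  then show ?thesis
    using schwartz_borel[OF f]
    by (intro Bochner_Integration.integrable_bound[OF decay_integrable, of _ C])
       (auto intro!: AE_I2 order.trans[OF _ abs_ge_self] simp del: abs_divide)
qed

section \<open>The Fourier transform on Schwartz functions\<close>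

text \<open>Limits of quotients can be tested along sequences, which is the form in which dominated
  convergence applies.\<close>

lemma has_vector_derivative_iff_quotient:
  fixes f :: "real \<Rightarrow> 'a::real_normed_vector"
  shows "(f has_vector_derivative D) (at x) \<longleftrightarrow> ((\<lambda>y. (f y - f x) /\<^sub>R (y - x)) \<longlongrightarrow> D) (at x)"
proof -
  have "(f has_vector_derivative D) (at x) \<longleftrightarrow>
      ((\<lambda>y. norm ((f y - f x) - (y - x) *\<^sub>R D) / norm (y - x)) \<longlongrightarrow> 0) (at x)"
    by (simp add: has_vector_derivative_def has_derivative_iff_norm bounded_linear_scaleR_left)
  also have "\<dots> \<longleftrightarrow> ((\<lambda>y. norm ((f y - f x) /\<^sub>R (y - x) - D)) \<longlongrightarrow> 0) (at x)"
  proof (rule filterlim_cong[OF refl refl])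
    have "norm ((f y - f x) - (y - x) *\<^sub>R D) / norm (y - x) = norm ((f y - f x) /\<^sub>R (y - x) - D)"
      if "y \<noteq> x" for y
    proof -
      have "(f y - f x) /\<^sub>R (y - x) - D = ((f y - f x) - (y - x) *\<^sub>R D) /\<^sub>R (y - x)"
        using that by (simp add: scaleR_right_diff_distrib)
      then show ?thesis by (simp add: divide_inverse mult.commute)
    qed
    then show "\<forall>\<^sub>F y in at x. norm ((f y - f x) - (y - x) *\<^sub>R D) / norm (y - x) = norm ((f y - f x) /\<^sub>R (y - x) - D)"
      by (auto simp: eventually_at_filter)
  qed
  also have "\<dots> \<longleftrightarrow> ((\<lambda>y. (f y - f x) /\<^sub>R (y - x)) \<longlongrightarrow> D) (at x)"
    by (simp add: tendsto_norm_zero_iff LIM_zero_iff)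
  finally show ?thesis .
qed

text \<open>By the mean value inequality the bound \<open>w\<close> for the derivative also
  dominates every difference quotient, so the limit passes under the integral.\<close>

lemma has_vector_derivative_integral:
  fixes f :: "real \<Rightarrow> real \<Rightarrow> complex"
  assumes e: "e > 0"
    and int: "\<And>t. t \<in> ball t0 e \<Longrightarrow> integrable lborel (f t)"
    and der: "\<And>t y. t \<in> ball t0 e \<Longrightarrow> ((\<lambda>t. f t y) has_vector_derivative f' t y) (at t)"
    and bound: "\<And>t y. t \<in> ball t0 e \<Longrightarrow> norm (f' t y) \<le> w y"
    and w: "integrable lborel w"
    and meas: "f' t0 \<in> borel_measurable borel"
  shows "((\<lambda>t. LINT y|lborel. f t y) has_vector_derivative (LINT y|lborel. f' t0 y)) (at t0)"
  unfolding has_vector_derivative_iff_quotient tendsto_at_iff_sequentially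
proof (intro allI impI)
  fix X assume X0: "\<forall>i. X i \<in> UNIV - {t0}" and X: "X \<longlonglongrightarrow> t0"
  have t0: "t0 \<in> ball t0 e" using e by simp
  have lip: "norm ((f t y - f t0 y) /\<^sub>R (t - t0)) \<le> w y" if "t \<in> ball t0 e" "t \<noteq> t0" for t y
  proof -
    have w0: "0 \<le> w y" using bound[OF t0, of y] norm_ge_zero order.trans by blast
    have "norm (f t y - f t0 y) \<le> w y * norm (t - t0)"
    proof (rule differentiable_bound[of "ball t0 e" "\<lambda>t. f t y" "\<lambda>t h. h *\<^sub>R f' t y"])
      fix s assume s: "s \<in> ball t0 e"
      show "((\<lambda>t. f t y) has_derivative (\<lambda>h. h *\<^sub>R f' s y)) (at s within ball t0 e)"
        using der[OF s, of y] by (simp add: has_vector_derivative_def has_derivative_at_withinI)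
      show "onorm (\<lambda>h. h *\<^sub>R f' s y) \<le> w y"
        using bound[OF s, of y] w0 by (intro onorm_bound) (auto simp: mult.commute[of "w y"] intro: mult_left_mono)
    qed (use that t0 in auto)
    then have "norm (f t y - f t0 y) / \<bar>t - t0\<bar> \<le> w y" using that by (simp add: divide_le_eq)
    then show ?thesis by (simp add: divide_inverse mult.commute)
  qed
  from X e have "\<forall>\<^sub>F i in sequentially. X i \<in> ball t0 e"
    by (auto simp: tendsto_iff dist_commute)
  then obtain N where N: "\<And>i. i \<ge> N \<Longrightarrow> X i \<in> ball t0 e" by (auto simp: eventually_sequentially)
  \<comment> \<open>The first \<open>N\<close> terms are dropped because the quotients are
    controlled only inside the ball.\<close>
  have "(\<lambda>i. LINT y|lborel. (f (X (i + N)) y - f t0 y) /\<^sub>R (X (i + N) - t0)) \<longlonglongrightarrow> (LINT y|lborel. f' t0 y)"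
  proof (rule integral_dominated_convergence[where w=w])
    show "AE y in lborel. norm ((f (X (i + N)) y - f t0 y) /\<^sub>R (X (i + N) - t0)) \<le> w y" for i
      using lip[of "X (i + N)"] N[of "i + N"] X0 by auto
    show "AE y in lborel. (\<lambda>i. (f (X (i + N)) y - f t0 y) /\<^sub>R (X (i + N) - t0)) \<longlonglongrightarrow> f' t0 y"
    proof (intro AE_I2)
      fix y
      have "(\<lambda>i. (f (X i) y - f t0 y) /\<^sub>R (X i - t0)) \<longlonglongrightarrow> f' t0 y"
        using der[OF t0, of y] X0 X
        unfolding has_vector_derivative_iff_quotient tendsto_at_iff_sequentially by (auto simp: o_def)
      then show "(\<lambda>i. (f (X (i + N)) y - f t0 y) /\<^sub>R (X (i + N) - t0)) \<longlonglongrightarrow> f' t0 y"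
        by (rule LIMSEQ_ignore_initial_segment)
    qed
    show "(\<lambda>y. (f (X (i + N)) y - f t0 y) /\<^sub>R (X (i + N) - t0)) \<in> borel_measurable lborel" for i
      using int[OF N[of "i + N"], THEN borel_measurable_integrable] int[OF t0, THEN borel_measurable_integrable] by auto
  qed (use w meas in auto)
  also have "(\<lambda>i. LINT y|lborel. (f (X (i + N)) y - f t0 y) /\<^sub>R (X (i + N) - t0)) =
     (\<lambda>i. ((LINT y|lborel. f (X (i + N)) y) - (LINT y|lborel. f t0 y)) /\<^sub>R (X (i + N) - t0))"
    using int N t0 by (auto simp: fun_eq_iff)
  finally show "((\<lambda>t. ((LINT y|lborel. f t y) - (LINT y|lborel. f t0 y)) /\<^sub>R (t - t0)) \<circ> X) \<longlonglongrightarrow> (LINT y|lborel. f' t0 y)"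
    unfolding o_def by (rule LIMSEQ_offset)
qed

text \<open>The inner majorant \<open>b\<close> may depend on the outer variable as long as its
  integrals stay below one constant. This is the shape of a convolution, where the inner kernel is
  translated by the outer variable.\<close>

lemma fubini_lborel:
  fixes f :: "real \<Rightarrow> real \<Rightarrow> complex"
  assumes meas: "(\<lambda>(x, y). f x y) \<in> borel_measurable (lborel \<Otimes>\<^sub>M lborel)"
    and bound: "\<And>x y. norm (f x y) \<le> a x * b x y"
    and a: "integrable lborel a" "\<And>x. 0 \<le> a x"
    and b: "\<And>x. integrable lborel (b x)" "\<And>x. (LINT y|lborel. b x y) \<le> B"
  shows "(LINT y|lborel. LINT x|lborel. f x y) = (LINT x|lborel. LINT y|lborel. f x y)"
proof (rule lborel_pair.Fubini_integral, rule lborel_pair.Fubini_integrable)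
  have fx: "f x \<in> borel_measurable lborel" for x
    using measurable_compose[OF measurable_Pair1' meas, of x] by simp
  have int: "integrable lborel (f x)" for x
    by (rule Bochner_Integration.integrable_bound[OF integrable_mult_right[OF b(1), of "a x" x]])
       (use fx bound[of x] in \<open>auto intro!: AE_I2 order.trans[OF _ abs_ge_self] simp del: abs_mult\<close>)
  show "case_prod f \<in> borel_measurable (lborel \<Otimes>\<^sub>M lborel)" by (rule meas)
  show "AE x in lborel. integrable lborel (\<lambda>y. case (x, y) of (x, y) \<Rightarrow> f x y)"
    using int by simp
  have "integrable lborel (\<lambda>x. LINT y|lborel. norm (f x y))"
  proof (rule Bochner_Integration.integrable_bound[OF integrable_mult_left[OF a(1), of B]])
    have "(\<lambda>(x, y). norm (f x y)) \<in> borel_measurable (lborel \<Otimes>\<^sub>M lborel)"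
      using measurable_compose[OF meas borel_measurable_norm] by (simp add: case_prod_beta o_def)
    then show "(\<lambda>x. LINT y|lborel. norm (f x y)) \<in> borel_measurable lborel"
      by (rule lborel.borel_measurable_lebesgue_integral)
    have "norm (LINT y|lborel. norm (f x y)) \<le> norm (a x * B)" for x
    proof -
      have "(LINT y|lborel. norm (f x y)) \<le> (LINT y|lborel. a x * b x y)"
        by (intro integral_mono bound integrable_mult_right b integrable_norm int)
      also have "\<dots> \<le> a x * B" using a(2) b(2) by (auto intro: mult_left_mono)
      finally show ?thesis by (simp add: integral_nonneg_AE del: abs_mult)
    qed
    then show "AE x in lborel. norm (LINT y|lborel. norm (f x y)) \<le> norm (a x * B)" by simp
  qed
  then show "integrable lborel (\<lambda>x. LINT y|lborel. norm (case (x, y) of (x, y) \<Rightarrow> f x y))" by simp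
qed

lemma integrable_mult_bounded:
  fixes f g :: "real \<Rightarrow> complex"
  assumes "integrable lborel f" "g \<in> borel_measurable borel" "\<And>x. norm (g x) \<le> M"
  shows "integrable lborel (\<lambda>x. f x * g x)"
proof (rule Bochner_Integration.integrable_bound[OF integrable_mult_left[OF integrable_norm[OF assms(1)], of M]])
  show "AE x in lborel. norm (f x * g x) \<le> norm (norm (f x) * M)"
    using assms(3) by (intro AE_I2) (auto simp: norm_mult intro!: mult_left_mono order.trans[OF _ abs_ge_self])
qed (use assms in auto)

lemma translate_integrable:
  fixes f :: "real \<Rightarrow> 'a::{banach, second_countable_topology}"
  assumes "integrable lborel f"
  shows "integrable lborel (\<lambda>y. f (y + t))" "integrable lborel (\<lambda>y. f (t - y))" "integrable lborel (\<lambda>y. f (y - t))"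
  using lborel_integrable_real_affine[OF assms, of 1 t] lborel_integrable_real_affine[OF assms, of "-1" t]
    lborel_integrable_real_affine[OF assms, of 1 "-t"] by (simp_all add: add.commute)

lemma translate_integral:
  fixes f :: "real \<Rightarrow> 'a::{banach, second_countable_topology}"
  shows "(LINT y|lborel. f (y + t)) = (LINT y|lborel. f y)"
    "(LINT y|lborel. f (t - y)) = (LINT y|lborel. f y)"
    "(LINT y|lborel. f (y - t)) = (LINT y|lborel. f y)"
  using lborel_integral_real_affine[of 1 f t] lborel_integral_real_affine[of "-1" f t]
    lborel_integral_real_affine[of 1 f "-t"] by (simp_all add: add.commute)

text \<open>From \<open>x^2 \<le> 2 * (x + t)^2 + 2 * t^2\<close>. One majorant then serves all
  parameters near a given one, as differentiation under the integral requires; for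
  \<open>R = 1\<close> the factor is 4.\<close>

lemma decay_shift:
  fixes x t :: real
  assumes "0 \<le> C" "\<bar>t\<bar> \<le> R"
  shows "C / (1 + (x + t)\<^sup>2) \<le> (2 * (1 + R\<^sup>2) * C) / (1 + x\<^sup>2)"
proof -
  have t: "t\<^sup>2 \<le> R\<^sup>2" using power_mono[of "\<bar>t\<bar>" R 2] assms by simp
  have "x\<^sup>2 \<le> 2 * (x + t)\<^sup>2 + 2 * t\<^sup>2"
    using zero_le_power2[of "x + 2 * t"] by (simp add: power2_eq_square algebra_simps)
  then have "1 + x\<^sup>2 \<le> 1 + 2 * (x + t)\<^sup>2 + 2 * R\<^sup>2" using t by simp
  also have "\<dots> \<le> (2 * (1 + R\<^sup>2)) * (1 + (x + t)\<^sup>2)"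
    by (simp add: algebra_simps add_nonneg_nonneg)
  finally have "C * (1 + x\<^sup>2) \<le> C * (2 * (1 + R\<^sup>2) * (1 + (x + t)\<^sup>2))"
    using assms(1) by (rule mult_left_mono)
  then show ?thesis
    by (simp add: divide_le_eq le_divide_eq add_pos_nonneg algebra_simps)
qed

text \<open>The sign \<open>\<sigma>\<close> treats the transform (\<open>-1\<close>) and its
  inverse (\<open>1\<close>, up to \<open>2 * pi\<close>) at once, so smoothness, decay and
  inversion are proved a single time.\<close>

definition osc_int :: "real \<Rightarrow> (real \<Rightarrow> complex) \<Rightarrow> real \<Rightarrow> complex" where
  "osc_int \<sigma> g \<xi> = (LINT x|lborel. cis (\<sigma> * x * \<xi>) * g x)"

lemma fourier_osc: "fourier f = osc_int (-1) f"
  by (rule ext) (simp add: fourier_def osc_int_def cis_conv_exp)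

lemma inv_fourier_osc: "inv_fourier g = (\<lambda>x. osc_int 1 g x / of_real (2 * pi))"
  by (rule ext) (simp add: inv_fourier_def osc_int_def cis_conv_exp mult.commute)

section \<open>Oscillatory integrals of Schwartz functions\<close>

lemma borel_measurable_cis [measurable (raw)]:
  "f \<in> borel_measurable M \<Longrightarrow> (\<lambda>x. cis (f x)) \<in> borel_measurable M"
  by (rule measurable_compose[OF _ borel_measurable_continuous_onI[OF continuous_on_cis[OF continuous_on_id]]])

lemma cis_mult_integrable:
  assumes "integrable lborel g"
  shows "integrable lborel (\<lambda>x. cis (\<sigma> * x * \<xi>) * g x)"
  using integrable_mult_bounded[OF assms, of "\<lambda>x. cis (\<sigma> * x * \<xi>)" 1] by (simp add: mult.commute)

lemma osc_int_bound: "norm (osc_int \<sigma> g \<xi>) \<le> (LINT x|lborel. norm (g x))"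
  unfolding osc_int_def by (rule order.trans[OF integral_norm_bound]) (simp add: norm_mult)

lemma cis_deriv:
  assumes "(f has_real_derivative f') (at x)"
  shows "((\<lambda>x. cis (f x)) has_vector_derivative (\<i> * of_real f' * cis (f x))) (at x)"
proof -
  have "((\<lambda>x. \<i> * complex_of_real (f x)) has_vector_derivative \<i> * of_real f') (at x)"
    using assms by (intro has_vector_derivative_mult_right has_vector_derivative_of_real)
  then have "((\<lambda>x. exp (\<i> * complex_of_real (f x))) has_vector_derivative (\<i> * of_real f') * exp (\<i> * complex_of_real (f x))) (at x)"
    using field_vector_diff_chain_at[of "\<lambda>x. \<i> * complex_of_real (f x)" _ x exp] DERIV_exp by (fastforce simp: o_def)
  then show ?thesis by (simp add: cis_conv_exp)
qed

lemma osc_int_deriv: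
  assumes "g \<in> schwartz"
  shows "(osc_int \<sigma> g has_vector_derivative osc_int \<sigma> (\<lambda>x. (\<i> * of_real \<sigma> * of_real x) * g x) \<xi>) (at \<xi>)"
proof -
  have xg: "(\<lambda>x. (\<i> * of_real \<sigma> * of_real x) * g x) \<in> schwartz"
    using schwartz_cmult[OF schwartz_ident_mult[OF assms], of "\<i> * of_real \<sigma>"] by (simp add: mult_ac)
  note [measurable] = schwartz_borel[OF assms] schwartz_borel[OF xg]
  have "((\<lambda>\<xi>. LINT x|lborel. cis (\<sigma> * x * \<xi>) * g x) has_vector_derivative
      (LINT x|lborel. cis (\<sigma> * x * \<xi>) * ((\<i> * of_real \<sigma> * of_real x) * g x))) (at \<xi>)"
  proof (rule has_vector_derivative_integral[where e=1 and w="\<lambda>x. norm ((\<i> * of_real \<sigma> * of_real x) * g x)"])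
    show "integrable lborel (\<lambda>x. cis (\<sigma> * x * t) * g x)" for t
      by (intro cis_mult_integrable schwartz_integrable assms)
    show "integrable lborel (\<lambda>x. norm ((\<i> * of_real \<sigma> * of_real x) * g x))"
      by (intro integrable_norm schwartz_integrable xg)
    have "((\<lambda>t. cis (\<sigma> * y * t)) has_vector_derivative (\<i> * of_real (\<sigma> * y)) * cis (\<sigma> * y * t)) (at t)" for t y
      by (rule cis_deriv) (auto intro!: derivative_eq_intros)
    from bounded_linear.has_vector_derivative[OF bounded_linear_mult_left this]
    have *: "((\<lambda>t. cis (\<sigma> * y * t) * g y) has_vector_derivative \<i> * of_real (\<sigma> * y) * cis (\<sigma> * y * t) * g y) (at t)" for t y .
    show "((\<lambda>t. cis (\<sigma> * y * t) * g y) has_vector_derivative cis (\<sigma> * y * t) * ((\<i> * of_real \<sigma> * of_real y) * g y)) (at t)" for t y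
    proof -
      have "cis (\<sigma> * y * t) * ((\<i> * of_real \<sigma> * of_real y) * g y) = \<i> * of_real (\<sigma> * y) * cis (\<sigma> * y * t) * g y"
        by simp
      with * show ?thesis by metis
    qed
  qed (auto simp: norm_mult)
  then show ?thesis by (simp add: osc_int_def[abs_def])
qed

lemma osc_int_nth_vderiv:
  assumes "g \<in> schwartz"
  shows "smooth (osc_int \<sigma> g)"
    and "nth_vderiv k (osc_int \<sigma> g) = osc_int \<sigma> (\<lambda>x. (\<i> * of_real \<sigma> * of_real x) ^ k * g x)"
proof -
  let ?D = "\<lambda>k. osc_int \<sigma> (\<lambda>x. (\<i> * of_real \<sigma> * of_real x) ^ k * g x)"
  have D: "(?D k has_vector_derivative ?D (Suc k) x) (at x)" for k x
    using osc_int_deriv[OF schwartz_power_mult[OF assms, of "\<i> * of_real \<sigma>" k], of \<sigma> x] by (simp add: mult_ac)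
  from smoothI[of ?D, OF D] show "smooth (osc_int \<sigma> g)" by simp
  from nth_vderiv_unique[of ?D, OF D] show "nth_vderiv k (osc_int \<sigma> g) = ?D k" by simp
qed

text \<open>The integral of \<open>g (y + t)\<close> does not depend on \<open>t\<close> by
  translation invariance; differentiating this constant at \<open>t = 0\<close> under the integral
  gives the claim without any boundary terms.\<close>

lemma integral_schwartz_deriv:
  assumes "g \<in> schwartz" shows "(LINT x|lborel. nth_vderiv (Suc 0) g x) = 0"
proof -
  have g': "nth_vderiv (Suc 0) g \<in> schwartz" by (rule schwartz_nth_vderiv[OF assms])
  note [measurable] = schwartz_borel[OF g']
  obtain C where C: "C > 0" "\<And>x. norm (nth_vderiv (Suc 0) g x) \<le> C / (1 + x\<^sup>2)"
    using schwartz_decay[OF g'] by blast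
  have "((\<lambda>t. LINT y|lborel. g (y + t)) has_vector_derivative (LINT y|lborel. nth_vderiv (Suc 0) g (y + 0))) (at 0)"
  proof (rule has_vector_derivative_integral[where e=1 and w="\<lambda>x. 4 * C / (1 + x\<^sup>2)"])
    show "integrable lborel (\<lambda>x. g (x + t))" for t
      by (intro translate_integrable schwartz_integrable assms)
    show "((\<lambda>t. g (y + t)) has_vector_derivative nth_vderiv (Suc 0) g (y + t)) (at t)" for t y
    proof -
      have "((\<lambda>t. y + t) has_vector_derivative 1) (at t)"
        by (auto intro!: derivative_eq_intros simp flip: has_real_derivative_iff_has_vector_derivative)
      from vector_diff_chain_at[OF this, of g] smooth_has_vderiv[OF schwartz_smooth[OF assms], of 0 "y + t"]
      show ?thesis by (simp add: o_def)
    qed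
    show "norm (nth_vderiv (Suc 0) g (y + t)) \<le> 4 * C / (1 + y\<^sup>2)" if "t \<in> ball 0 1" for t y
      using order.trans[OF C(2) decay_shift[of C t 1 y]] C(1) that by (simp add: dist_norm)
  qed (use decay_integrable[of "4 * C"] in auto)
  moreover have "(\<lambda>t. LINT y|lborel. g (y + t)) = (\<lambda>t. LINT y|lborel. g y)"
    by (simp add: translate_integral)
  ultimately show ?thesis
    using vector_derivative_unique_at[OF _ has_vector_derivative_const] by fastforce
qed

lemma smooth_cis: "(\<lambda>x. cis (a * x)) \<in> Cb_infinity"
proof -
  let ?D = "\<lambda>k x. (\<i> * of_real a) ^ k * cis (a * x)"
  have D: "(?D k has_vector_derivative ?D (Suc k) x) (at x)" for k x
  proof -
    have "((\<lambda>x. cis (a * x)) has_vector_derivative (\<i> * of_real a * cis (a * x))) (at x)"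
      by (rule cis_deriv) (auto intro!: derivative_eq_intros)
    from has_vector_derivative_mult_right[OF this, of "(\<i> * of_real a) ^ k"] show ?thesis by (simp add: mult_ac)
  qed
  show ?thesis
    using smoothI[of ?D, OF D] nth_vderiv_unique[of ?D, OF D]
    by (auto simp: Cb_infinity_def norm_mult norm_power intro!: boundedI[of _ "\<bar>a\<bar> ^ k" for k])
qed

text \<open>Integration by parts, obtained by applying \<open>integral_schwartz_deriv\<close> to the
  product of \<open>g\<close> with the exponential.\<close>

lemma osc_int_of_deriv:
  assumes "g \<in> schwartz"
  shows "osc_int \<sigma> (nth_vderiv (Suc 0) g) \<xi> = - (\<i> * of_real \<sigma> * of_real \<xi>) * osc_int \<sigma> g \<xi>"
proof -
  let ?c = "\<lambda>x. cis (\<sigma> * x * \<xi>)"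
  have g': "nth_vderiv (Suc 0) g \<in> schwartz" by (rule schwartz_nth_vderiv[OF assms])
  have "(\<lambda>x. cis ((\<sigma> * \<xi>) * x) * g x) \<in> schwartz" by (intro schwartz_mult_Cb smooth_cis assms)
  then have cg: "(\<lambda>x. ?c x * g x) \<in> schwartz" by (simp add: mult_ac)
  have "((\<lambda>x. ?c x * g x) has_vector_derivative
       ?c x * nth_vderiv (Suc 0) g x + (\<i> * of_real (\<sigma> * \<xi>) * ?c x) * g x) (at x)" for x
    using smooth_has_vderiv[OF schwartz_smooth[OF assms], of 0 x]
    by (intro has_vector_derivative_mult cis_deriv) (auto intro!: derivative_eq_intros)
  then have "nth_vderiv (Suc 0) (\<lambda>x. ?c x * g x) =
      (\<lambda>x. ?c x * nth_vderiv (Suc 0) g x + (\<i> * of_real (\<sigma> * \<xi>)) * (?c x * g x))"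
    by (intro nth_vderiv_Suc0_eq) (simp add: mult_ac)
  with integral_schwartz_deriv[OF cg]
  have "0 = (LINT x|lborel. ?c x * nth_vderiv (Suc 0) g x + (\<i> * of_real (\<sigma> * \<xi>)) * (?c x * g x))" by simp
  also have "\<dots> = osc_int \<sigma> (nth_vderiv (Suc 0) g) \<xi> + (\<i> * of_real (\<sigma> * \<xi>)) * osc_int \<sigma> g \<xi>"
    unfolding osc_int_def
    using cis_mult_integrable[OF schwartz_integrable[OF g'], of \<sigma> \<xi>]
      cis_mult_integrable[OF schwartz_integrable[OF assms], of \<sigma> \<xi>] by simp
  finally show ?thesis by (simp add: eq_neg_iff_add_eq_0 mult.assoc)
qed

lemma osc_int_of_nth_deriv:
  assumes "g \<in> schwartz"
  shows "osc_int \<sigma> (nth_vderiv k g) \<xi> = (- (\<i> * of_real \<sigma> * of_real \<xi>)) ^ k * osc_int \<sigma> g \<xi>"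
proof (induction k)
  case (Suc k)
  have "nth_vderiv (Suc k) g = nth_vderiv (Suc 0) (nth_vderiv k g)"
    using nth_vderiv_add_index[of "Suc 0" k g] by simp
  then show ?case using osc_int_of_deriv[OF schwartz_nth_vderiv[OF assms, of k]] Suc by simp
qed simp

text \<open>Powers of \<open>\<xi>\<close> become derivatives of the integrand. The right side is
  left as an integral because dominated convergence is later applied to it when seminorms of a
  sequence have to tend to zero.\<close>

lemma osc_int_seminorm_bound:
  assumes "g \<in> schwartz" "\<bar>\<sigma>\<bar> = 1"
  shows "\<bar>\<xi>\<bar> ^ j * norm (nth_vderiv k (osc_int \<sigma> g) \<xi>) \<le>
    (LINT x|lborel. norm (nth_vderiv j (\<lambda>x. (\<i> * of_real \<sigma> * of_real x) ^ k * g x) x))"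
proof -
  let ?h = "\<lambda>x. (\<i> * of_real \<sigma> * of_real x) ^ k * g x"
  have h: "?h \<in> schwartz" using schwartz_power_mult[OF assms(1)] by simp
  have "\<bar>\<xi>\<bar> ^ j * norm (nth_vderiv k (osc_int \<sigma> g) \<xi>) = norm (osc_int \<sigma> (nth_vderiv j ?h) \<xi>)"
    unfolding osc_int_of_nth_deriv[OF h] osc_int_nth_vderiv[OF assms(1)]
    using assms(2) by (simp add: norm_mult norm_power)
  also have "\<dots> \<le> (LINT x|lborel. norm (nth_vderiv j ?h x))" by (rule osc_int_bound)
  finally show ?thesis .
qed

lemma osc_int_schwartz:
  assumes "g \<in> schwartz" "\<bar>\<sigma>\<bar> = 1" shows "osc_int \<sigma> g \<in> schwartz"
  unfolding schwartz_def
  using osc_int_nth_vderiv(1)[OF assms(1)] osc_int_seminorm_bound[OF assms]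
  by (auto intro!: boundedI)

lemma fourier_schwartz: "g \<in> schwartz \<Longrightarrow> fourier g \<in> schwartz"
  unfolding fourier_osc by (rule osc_int_schwartz) auto

lemma inv_fourier_schwartz: "g \<in> schwartz \<Longrightarrow> inv_fourier g \<in> schwartz"
  using schwartz_cmult[OF osc_int_schwartz[of g 1], of "1 / of_real (2 * pi)"]
  unfolding inv_fourier_osc by simp

section \<open>Fourier inversion\<close>

lemma gaussian_integral:
  "integrable lborel (\<lambda>z::real. exp (- z\<^sup>2 / 2))"
  "(LINT z|lborel. complex_of_real (exp (- z\<^sup>2 / 2))) = of_real (sqrt (2 * pi))"
  "(LINT z|lborel. cis (a * z) * of_real (exp (- z\<^sup>2 / 2))) = of_real (sqrt (2 * pi) * exp (- a\<^sup>2 / 2))"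
proof -
  have *: "exp (- z\<^sup>2 / 2) = sqrt (2 * pi) * std_normal_density z" for z
    by (simp add: std_normal_density_def)
  show "integrable lborel (\<lambda>z::real. exp (- z\<^sup>2 / 2))"
    unfolding * by (intro integrable_mult_right integrable_normal_density) simp
  have "complex_of_real (exp (- a\<^sup>2 / 2)) = (LINT z|lborel. std_normal_density z *\<^sub>R cis (a * z))" for a
    using fun_cong[OF char_std_normal_distribution, of a] unfolding char_def
    by (subst (asm) integral_density) (auto simp: cis_conv_exp)
  then have 3: "(LINT z|lborel. cis (a * z) * of_real (exp (- z\<^sup>2 / 2))) = of_real (sqrt (2 * pi) * exp (- a\<^sup>2 / 2))" for a
    unfolding * scaleR_conv_of_real of_real_mult
    by (simp only: mult_ac integral_mult_right_zero[symmetric])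
  show "(LINT z|lborel. cis (a * z) * of_real (exp (- z\<^sup>2 / 2))) = of_real (sqrt (2 * pi) * exp (- a\<^sup>2 / 2))" by (rule 3)
  show "(LINT z|lborel. complex_of_real (exp (- z\<^sup>2 / 2))) = of_real (sqrt (2 * pi))" using 3[of 0] by simp
qed

text \<open>The iterated integral does not converge absolutely. Damping the outer one by a wide
  Gaussian of width \<open>Suc n\<close> makes the exchange legal and turns the inner integral into
  a Gaussian of width \<open>1 / Suc n\<close> around \<open>x\<close>. Both sides then converge by
  dominated convergence.\<close>

lemma osc_int_inversion:
  assumes g: "g \<in> schwartz" and \<sigma>: "\<bar>\<sigma>\<bar> = 1"
  shows "osc_int \<sigma> (osc_int (-\<sigma>) g) x = of_real (2 * pi) * g x"
proof -
  let ?G = "\<lambda>n \<xi>. complex_of_real (exp (- (\<xi> / real (Suc n))\<^sup>2 / 2))"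
  let ?h = "osc_int (-\<sigma>) g"
  have h: "?h \<in> schwartz" using osc_int_schwartz[OF g, of "-\<sigma>"] \<sigma> by simp
  note [measurable] = schwartz_borel[OF g] schwartz_borel[OF h]
  obtain M where M: "\<And>x. norm (g x) \<le> M" using schwartz_bounded[OF g] by (auto simp: bounded_iff)
  have Gint: "integrable lborel (\<lambda>\<xi>. exp (- (\<xi> / real (Suc n))\<^sup>2 / 2))" for n
    using lborel_integrable_real_affine[OF gaussian_integral(1), of "1 / real (Suc n)" 0] by simp
  have G1: "norm (?G n \<xi>) \<le> 1" for n \<xi> by simp
  have lim1: "(\<lambda>n. LINT \<xi>|lborel. cis (\<sigma> * \<xi> * x) * (?G n \<xi> * ?h \<xi>)) \<longlonglongrightarrow> osc_int \<sigma> ?h x"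
    unfolding osc_int_def[of \<sigma> ?h]
  proof (rule integral_dominated_convergence[where w="\<lambda>\<xi>. norm (?h \<xi>)"])
    show "AE \<xi> in lborel. (\<lambda>n. cis (\<sigma> * \<xi> * x) * (?G n \<xi> * ?h \<xi>)) \<longlonglongrightarrow> cis (\<sigma> * \<xi> * x) * ?h \<xi>"
    proof (intro AE_I2)
      fix \<xi> :: real
      have "(\<lambda>n. \<xi> / real (Suc n)) \<longlonglongrightarrow> 0"
        using LIMSEQ_Suc[OF lim_const_over_n[of \<xi>]] by simp
      then have "(\<lambda>n. cis (\<sigma> * \<xi> * x) * (?G n \<xi> * ?h \<xi>)) \<longlonglongrightarrow> cis (\<sigma> * \<xi> * x) * (of_real (exp (- 0\<^sup>2 / 2)) * ?h \<xi>)"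
        by (intro tendsto_intros) auto
      then show "(\<lambda>n. cis (\<sigma> * \<xi> * x) * (?G n \<xi> * ?h \<xi>)) \<longlonglongrightarrow> cis (\<sigma> * \<xi> * x) * ?h \<xi>" by simp
    qed
    show "AE \<xi> in lborel. norm (cis (\<sigma> * \<xi> * x) * (?G n \<xi> * ?h \<xi>)) \<le> norm (?h \<xi>)" for n
      using G1[of n] by (intro AE_I2) (simp add: norm_mult mult_left_le_one_le)
  qed (auto intro!: integrable_norm schwartz_integrable h)
  have eq: "(LINT \<xi>|lborel. cis (\<sigma> * \<xi> * x) * (?G n \<xi> * ?h \<xi>)) =
      of_real (sqrt (2 * pi)) * (LINT z|lborel. g (x + z / real (Suc n)) * of_real (exp (- z\<^sup>2 / 2)))" for n
  proof -
    define r where "r = real (Suc n)"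
    have r: "r > 0" by (simp add: r_def)
    have "(LINT \<xi>|lborel. cis (\<sigma> * \<xi> * x) * (?G n \<xi> * ?h \<xi>)) =
        (LINT \<xi>|lborel. LINT y|lborel. ?G n \<xi> * (cis (\<sigma> * (x - y) * \<xi>) * g y))"
    proof (intro Bochner_Integration.integral_cong refl)
      fix \<xi>
      have "cis (\<sigma> * (x - y) * \<xi>) = cis (\<sigma> * \<xi> * x) * cis (- \<sigma> * y * \<xi>)" for y
        unfolding cis_mult by (rule arg_cong[where f=cis]) (simp add: algebra_simps)
      then have "?G n \<xi> * (cis (\<sigma> * (x - y) * \<xi>) * g y) = (cis (\<sigma> * \<xi> * x) * ?G n \<xi>) * (cis (- \<sigma> * y * \<xi>) * g y)" for y
        by (simp only: mult_ac)
      then show "cis (\<sigma> * \<xi> * x) * (?G n \<xi> * ?h \<xi>) = (LINT y|lborel. ?G n \<xi> * (cis (\<sigma> * (x - y) * \<xi>) * g y))"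
        unfolding osc_int_def by (simp only: integral_mult_right_zero mult.assoc)
    qed
    also have "\<dots> = (LINT y|lborel. LINT \<xi>|lborel. ?G n \<xi> * (cis (\<sigma> * (x - y) * \<xi>) * g y))"
      by (rule fubini_lborel[symmetric, where a="\<lambda>\<xi>. norm (?G n \<xi>)" and b="\<lambda>\<xi> y. norm (g y)" and B="LINT y|lborel. norm (g y)"])
         (use Gint[of n] in \<open>auto simp: norm_mult intro!: integrable_norm schwartz_integrable g\<close>)
    also have "\<dots> = (LINT y|lborel. g y * of_real (r * sqrt (2 * pi) * exp (- (r * (x - y))\<^sup>2 / 2)))"
    proof (intro Bochner_Integration.integral_cong refl)
      fix y
      have "(LINT \<xi>|lborel. ?G n \<xi> * (cis (\<sigma> * (x - y) * \<xi>) * g y)) =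
          g y * (LINT \<xi>|lborel. cis (\<sigma> * (x - y) * \<xi>) * ?G n \<xi>)"
        by (simp add: mult_ac flip: integral_mult_right_zero)
      also have "(LINT \<xi>|lborel. cis (\<sigma> * (x - y) * \<xi>) * ?G n \<xi>) =
          r *\<^sub>R (LINT z|lborel. cis ((\<sigma> * (x - y) * r) * z) * of_real (exp (- z\<^sup>2 / 2)))"
        using r by (subst lborel_integral_real_affine[of r _ 0]) (auto simp: r_def mult_ac)
      also have "(\<sigma> * (x - y) * r)\<^sup>2 = (r * (x - y))\<^sup>2"
        using \<sigma> by (simp add: power_mult_distrib abs_square_eq_1)
      then have "r *\<^sub>R (LINT z|lborel. cis ((\<sigma> * (x - y) * r) * z) * of_real (exp (- z\<^sup>2 / 2))) =
          of_real (r * sqrt (2 * pi) * exp (- (r * (x - y))\<^sup>2 / 2))"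
        unfolding gaussian_integral(3) by (simp add: scaleR_conv_of_real)
      finally show "(LINT \<xi>|lborel. ?G n \<xi> * (cis (\<sigma> * (x - y) * \<xi>) * g y)) =
          g y * of_real (r * sqrt (2 * pi) * exp (- (r * (x - y))\<^sup>2 / 2))" .
    qed
    \<comment> \<open>The substitution \<open>y = x + z / r\<close> fixes the Gaussian and moves its
      concentration into the argument of \<open>g\<close>.\<close>
    also have "\<dots> = (1 / r) *\<^sub>R (LINT z|lborel. g (x + (1 / r) * z) * of_real (r * sqrt (2 * pi) * exp (- (r * (x - (x + (1 / r) * z)))\<^sup>2 / 2)))"
      using r by (subst lborel_integral_real_affine[of "1 / r" _ x]) auto
    also have "\<dots> = (1 / r) *\<^sub>R (LINT z|lborel. of_real (r * sqrt (2 * pi)) * (g (x + z / r) * of_real (exp (- z\<^sup>2 / 2))))"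
      using r by (intro arg_cong[where f="\<lambda>u. (1 / r) *\<^sub>R u"] Bochner_Integration.integral_cong refl) (simp add: mult_ac)
    also have "\<dots> = of_real (sqrt (2 * pi)) * (LINT z|lborel. g (x + z / r) * of_real (exp (- z\<^sup>2 / 2)))"
      using r unfolding integral_mult_right_zero by (simp add: scaleR_conv_of_real)
    finally show ?thesis by (simp only: r_def)
  qed
  have lim2: "(\<lambda>n. LINT z|lborel. g (x + z / real (Suc n)) * of_real (exp (- z\<^sup>2 / 2))) \<longlonglongrightarrow>
      (LINT z|lborel. g x * of_real (exp (- z\<^sup>2 / 2)))"
  proof (rule integral_dominated_convergence[where w="\<lambda>z. M * exp (- z\<^sup>2 / 2)"])
    show "AE z in lborel. (\<lambda>n. g (x + z / real (Suc n)) * of_real (exp (- z\<^sup>2 / 2))) \<longlonglongrightarrow> g x * of_real (exp (- z\<^sup>2 / 2))"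
    proof (intro AE_I2)
      fix z :: real
      have "(\<lambda>n. z / real (Suc n)) \<longlonglongrightarrow> 0"
        using LIMSEQ_Suc[OF lim_const_over_n[of z]] by simp
      then have "(\<lambda>n. x + z / real (Suc n)) \<longlonglongrightarrow> x" using tendsto_add[OF tendsto_const[of x]] by force
      then have "(\<lambda>n. g (x + z / real (Suc n))) \<longlonglongrightarrow> g x"
        using schwartz_continuous[OF g, of UNIV] by (auto simp: continuous_on_eq_continuous_at intro: isCont_tendsto_compose)
      then show "(\<lambda>n. g (x + z / real (Suc n)) * of_real (exp (- z\<^sup>2 / 2))) \<longlonglongrightarrow> g x * of_real (exp (- z\<^sup>2 / 2))"
        by (intro tendsto_intros)
    qed
    show "AE z in lborel. norm (g (x + z / real (Suc n)) * of_real (exp (- z\<^sup>2 / 2))) \<le> M * exp (- z\<^sup>2 / 2)" for n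
      using M by (intro AE_I2) (simp add: norm_mult)
  qed (use gaussian_integral(1) in \<open>auto intro!: integrable_mult_right\<close>)
  have "(\<lambda>n. LINT \<xi>|lborel. cis (\<sigma> * \<xi> * x) * (?G n \<xi> * ?h \<xi>)) \<longlonglongrightarrow>
      of_real (sqrt (2 * pi)) * (LINT z|lborel. g x * of_real (exp (- z\<^sup>2 / 2)))"
    unfolding eq by (intro tendsto_mult tendsto_const lim2)
  with lim1 have "osc_int \<sigma> ?h x = of_real (sqrt (2 * pi)) * (LINT z|lborel. g x * of_real (exp (- z\<^sup>2 / 2)))"
    by (rule LIMSEQ_unique)
  \<comment> \<open>One root stems from transforming the damping factor, the other is the mass of
    the Gaussian; together they give \<open>2 * pi\<close>.\<close>
  also have "\<dots> = of_real (sqrt (2 * pi) * sqrt (2 * pi)) * g x"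
    unfolding integral_mult_right_zero gaussian_integral(2) of_real_mult by (simp only: mult_ac)
  also have "sqrt (2 * pi) * sqrt (2 * pi) = 2 * pi" by simp
  finally show ?thesis .
qed

lemma fourier_inv_fourier: "g \<in> schwartz \<Longrightarrow> fourier (inv_fourier g) = g"
proof (rule ext)
  fix x assume g: "g \<in> schwartz"
  have "fourier (inv_fourier g) x = osc_int (-1) (osc_int 1 g) x / of_real (2 * pi)"
    unfolding fourier_osc inv_fourier_osc osc_int_def[of "-1"] by simp
  then show "fourier (inv_fourier g) x = g x" using osc_int_inversion[OF g, of "-1" x] by simp
qed

section \<open>Fourier multipliers on bounded functions\<close>

definition bdm :: "(real \<Rightarrow> complex) set" where
  "bdm = {f \<in> borel_measurable borel. bounded (range f)}"

text \<open>The multiplier with symbol \<open>m\<close>, written as convolution with its kernel, so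
  that it acts on bounded functions that have no Fourier integral.\<close>

definition fmult :: "(real \<Rightarrow> complex) \<Rightarrow> (real \<Rightarrow> complex) \<Rightarrow> real \<Rightarrow> complex" where
  "fmult m f x = (LINT y|lborel. inv_fourier m (x - y) * f y)"

definition ker_norm :: "(real \<Rightarrow> complex) \<Rightarrow> real" where
  "ker_norm m = (LINT x|lborel. norm (inv_fourier m x))"

lemma bdm_borel [measurable_dest]: "f \<in> bdm \<Longrightarrow> f \<in> borel_measurable borel"
  by (simp add: bdm_def)

section \<open>Bounded functions and the calculus of convolution operators\<close>

lemma bdmI: "f \<in> borel_measurable borel \<Longrightarrow> (\<And>x. norm (f x) \<le> M) \<Longrightarrow> f \<in> bdm"
  by (auto simp: bdm_def intro!: boundedI)

lemma bdmE: assumes "f \<in> bdm" obtains M where "\<And>x. norm (f x) \<le> M" "M \<ge> 0"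
proof -
  from assms obtain M where M: "\<And>x. norm (f x) \<le> M" by (auto simp: bdm_def bounded_iff)
  then show thesis using that[of M] order.trans[OF norm_ge_zero M] by blast
qed

lemma bdm_add: assumes "f \<in> bdm" "g \<in> bdm" shows "(\<lambda>x. f x + g x) \<in> bdm"
  using assms by (auto simp: bdm_def intro!: bounded_plus_comp)

lemma bdm_diff: assumes "f \<in> bdm" "g \<in> bdm" shows "(\<lambda>x. f x - g x) \<in> bdm"
  using assms by (auto simp: bdm_def intro!: bounded_minus_comp)

lemma bdm_mult: assumes "f \<in> bdm" "g \<in> bdm" shows "(\<lambda>x. f x * g x) \<in> bdm"
proof -
  obtain M where M: "\<And>x. norm (f x) \<le> M" "M \<ge> 0" using bdmE[OF assms(1)] by blast
  obtain N where N: "\<And>x. norm (g x) \<le> N" "N \<ge> 0" using bdmE[OF assms(2)] by blast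
  show ?thesis
    by (rule bdmI[of _ "M * N"]) (use assms M N in \<open>auto simp: norm_mult intro!: mult_mono\<close>)
qed

lemma bdm_const: "(\<lambda>x. c) \<in> bdm" by (rule bdmI[of _ "norm c"]) auto

lemma bdm_cis: "(\<lambda>x. cis (a * x)) \<in> bdm" by (rule bdmI[of _ 1]) auto

lemma bdm_cnj: "f \<in> bdm \<Longrightarrow> (\<lambda>x. cnj (f x)) \<in> bdm"
proof -
  assume f: "f \<in> bdm"
  have "cnj \<in> borel_measurable borel" by (intro borel_measurable_continuous_onI continuous_intros)
  from measurable_compose[OF bdm_borel[OF f] this] f show ?thesis
    by (auto simp: bdm_def bounded_iff)
qed

lemma bdm_sum: "(\<And>i. i \<in> I \<Longrightarrow> f i \<in> bdm) \<Longrightarrow> (\<lambda>x. \<Sum>i\<in>I. f i x) \<in> bdm"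
  by (induction I rule: infinite_finite_induct) (auto intro: bdm_add bdm_const)

lemma bdm_continuous: "continuous_on UNIV f \<Longrightarrow> bounded (range f) \<Longrightarrow> f \<in> bdm"
  by (simp add: bdm_def borel_measurable_continuous_onI)

lemma ker_integrable: "m \<in> schwartz \<Longrightarrow> integrable lborel (inv_fourier m)"
  by (intro schwartz_integrable inv_fourier_schwartz)

lemma ker_norm_nonneg: "ker_norm m \<ge> 0"
  by (simp add: ker_norm_def)

lemma ker_borel: "m \<in> schwartz \<Longrightarrow> inv_fourier m \<in> borel_measurable borel"
  by (intro schwartz_borel inv_fourier_schwartz)

lemma fmult_integrable:
  assumes "m \<in> schwartz" "f \<in> bdm"
  shows "integrable lborel (\<lambda>y. inv_fourier m (x - y) * f y)"
proof -
  obtain M where "\<And>x. norm (f x) \<le> M" using bdmE[OF assms(2)] by blast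
  with assms show ?thesis
    by (intro integrable_mult_bounded translate_integrable ker_integrable) auto
qed

lemma fmult_alt: "fmult m f x = (LINT y|lborel. inv_fourier m y * f (x - y))"
  unfolding fmult_def using translate_integral(2)[of "\<lambda>y. inv_fourier m y * f (x - y)" x] by simp

lemma fmult_bound:
  assumes "m \<in> schwartz" "f \<in> bdm" "\<And>x. norm (f x) \<le> M"
  shows "norm (fmult m f x) \<le> ker_norm m * M"
proof -
  have "norm (fmult m f x) \<le> (LINT y|lborel. norm (inv_fourier m (x - y) * f y))"
    unfolding fmult_def by (rule integral_norm_bound)
  also have "\<dots> \<le> (LINT y|lborel. norm (inv_fourier m (x - y)) * M)"
    using assms(3)
    by (intro integral_mono integrable_norm integrable_mult_left fmult_integrable translate_integrable(2) ker_integrable assms)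
       (auto simp: norm_mult intro!: mult_left_mono)
  also have "\<dots> = ker_norm m * M"
    using translate_integral(2)[of "\<lambda>y. norm (inv_fourier m y)" x] by (simp add: ker_norm_def)
  finally show ?thesis .
qed

lemma fmult_add_right:
  "m \<in> schwartz \<Longrightarrow> f \<in> bdm \<Longrightarrow> g \<in> bdm \<Longrightarrow> fmult m (\<lambda>x. f x + g x) x = fmult m f x + fmult m g x"
  by (simp add: fmult_def distrib_left fmult_integrable)

lemma fmult_diff_right:
  "m \<in> schwartz \<Longrightarrow> f \<in> bdm \<Longrightarrow> g \<in> bdm \<Longrightarrow> fmult m (\<lambda>x. f x - g x) x = fmult m f x - fmult m g x"
  by (simp add: fmult_def right_diff_distrib fmult_integrable)

lemma fmult_cmult_right: "fmult m (\<lambda>x. c * f x) x = c * fmult m f x"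
  by (simp add: fmult_def mult.left_commute)

lemma fmult_sum_right:
  assumes "m \<in> schwartz" "\<And>i. i \<in> I \<Longrightarrow> f i \<in> bdm"
  shows "fmult m (\<lambda>x. \<Sum>i\<in>I. f i x) x = (\<Sum>i\<in>I. fmult m (f i) x)"
  using assms by (simp add: fmult_def sum_distrib_left fmult_integrable)

lemma ker_add: "m \<in> schwartz \<Longrightarrow> n \<in> schwartz \<Longrightarrow>
    inv_fourier (\<lambda>\<xi>. m \<xi> + n \<xi>) x = inv_fourier m x + inv_fourier n x"
  using cis_mult_integrable[OF schwartz_integrable, of m 1 x] cis_mult_integrable[OF schwartz_integrable, of n 1 x]
  by (simp add: inv_fourier_osc osc_int_def distrib_left add_divide_distrib)

lemma ker_cmult: "inv_fourier (\<lambda>\<xi>. c * m \<xi>) x = c * inv_fourier m x"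
  by (simp add: inv_fourier_osc osc_int_def mult.left_commute)

lemma fmult_add_left:
  assumes "m \<in> schwartz" "n \<in> schwartz" "f \<in> bdm"
  shows "fmult (\<lambda>\<xi>. m \<xi> + n \<xi>) f x = fmult m f x + fmult n f x"
  using assms by (simp add: fmult_def ker_add distrib_right fmult_integrable)

lemma fmult_cmult_left: "fmult (\<lambda>\<xi>. c * m \<xi>) f x = c * fmult m f x"
  by (simp add: fmult_def ker_cmult mult.assoc)

lemma fmult_zero_left: "fmult (\<lambda>\<xi>. 0) f x = 0"
  using fmult_cmult_left[of 0] by simp

lemma fmult_sum_left:
  assumes "\<And>i. i \<in> I \<Longrightarrow> m i \<in> schwartz" "f \<in> bdm"
  shows "fmult (\<lambda>\<xi>. \<Sum>i\<in>I. m i \<xi>) f x = (\<Sum>i\<in>I. fmult (m i) f x)"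
  using assms(1)
proof (induction I rule: infinite_finite_induct)
  case (insert i I)
  then show ?case using fmult_add_left[of "m i" "\<lambda>\<xi>. \<Sum>i\<in>I. m i \<xi>" f x] schwartz_sum[of I m] assms by auto
qed (auto simp: fmult_zero_left)

lemma ker_deriv:
  assumes "m \<in> schwartz"
  shows "(inv_fourier m has_vector_derivative inv_fourier (\<lambda>\<xi>. (\<i> * of_real \<xi>) * m \<xi>) x) (at x)"
  using has_vector_derivative_divide[OF osc_int_deriv[OF assms, of 1 x], of "of_real (2 * pi)"]
  by (simp add: inv_fourier_osc)

lemma ixi_schwartz: "m \<in> schwartz \<Longrightarrow> (\<lambda>\<xi>. (\<i> * of_real \<xi>) * m \<xi>) \<in> schwartz"
  using schwartz_power_mult[of m \<i> 1] by simp

text \<open>The derivative falls on the kernel, so no regularity of \<open>f\<close> enters; this is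
  why all blocks of bounded functions are smooth.\<close>

lemma fmult_deriv:
  assumes m: "m \<in> schwartz" and f: "f \<in> bdm"
  shows "(fmult m f has_vector_derivative fmult (\<lambda>\<xi>. (\<i> * of_real \<xi>) * m \<xi>) f x) (at x)"
proof -
  let ?m' = "\<lambda>\<xi>. (\<i> * of_real \<xi>) * m \<xi>"
  note m' = ixi_schwartz[OF m]
  obtain M where M: "\<And>x. norm (f x) \<le> M" "M \<ge> 0" using bdmE[OF f] by blast
  obtain C where C: "C > 0" "\<And>x. norm (inv_fourier ?m' x) \<le> C / (1 + x\<^sup>2)"
    using schwartz_decay[OF inv_fourier_schwartz[OF m']] by blast
  note [measurable] = bdm_borel[OF f] ker_borel[OF m']
  have "((\<lambda>x. LINT y|lborel. inv_fourier m (x - y) * f y) has_vector_derivative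
      (LINT y|lborel. inv_fourier ?m' (x - y) * f y)) (at x)"
  proof (rule has_vector_derivative_integral[where e=1 and w="\<lambda>y. (4 * C / (1 + (x - y)\<^sup>2)) * M"])
    show "integrable lborel (\<lambda>y. inv_fourier m (t - y) * f y)" for t by (rule fmult_integrable[OF m f])
    show "((\<lambda>t. inv_fourier m (t - y) * f y) has_vector_derivative inv_fourier ?m' (t - y) * f y) (at t)" for t y
    proof -
      have "((\<lambda>t. t - y) has_vector_derivative 1) (at t)"
        by (auto intro!: derivative_eq_intros simp flip: has_real_derivative_iff_has_vector_derivative)
      from vector_diff_chain_at[OF this, of "inv_fourier m"] ker_deriv[OF m, of "t - y"]
      have "((\<lambda>t. inv_fourier m (t - y)) has_vector_derivative inv_fourier ?m' (t - y)) (at t)"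
        by (simp add: o_def)
      from bounded_linear.has_vector_derivative[OF bounded_linear_mult_left this] show ?thesis .
    qed
    show "norm (inv_fourier ?m' (t - y) * f y) \<le> (4 * C / (1 + (x - y)\<^sup>2)) * M" if "t \<in> ball x 1" for t y
    proof -
      have "C / (1 + ((x - y) + (t - x))\<^sup>2) \<le> 4 * C / (1 + (x - y)\<^sup>2)"
        using decay_shift[of C "t - x" 1 "x - y"] C(1) that by (simp add: dist_norm abs_minus_commute)
      then have "norm (inv_fourier ?m' (t - y)) \<le> 4 * C / (1 + (x - y)\<^sup>2)"
        using C(2)[of "t - y"] by simp
      then show ?thesis unfolding norm_mult using M C(1) by (intro mult_mono) (auto intro!: divide_nonneg_nonneg)
    qed
    show "integrable lborel (\<lambda>y. (4 * C / (1 + (x - y)\<^sup>2)) * M)"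
      by (intro integrable_mult_left translate_integrable(2)[OF decay_integrable[of "4 * C"]])
  qed auto
  then show ?thesis by (simp add: fmult_def[abs_def])
qed

lemma fmult_nth_vderiv:
  assumes "m \<in> schwartz" "f \<in> bdm"
  shows "smooth (fmult m f)" "nth_vderiv k (fmult m f) = fmult (\<lambda>\<xi>. (\<i> * of_real \<xi>) ^ k * m \<xi>) f"
proof -
  let ?D = "\<lambda>k. fmult (\<lambda>\<xi>. (\<i> * of_real \<xi>) ^ k * m \<xi>) f"
  have D: "(?D k has_vector_derivative ?D (Suc k) x) (at x)" for k x
    using fmult_deriv[OF schwartz_power_mult[OF assms(1), of \<i> k] assms(2), of x] by (simp add: mult.assoc)
  from smoothI[of ?D, OF D] show "smooth (fmult m f)" by simp
  from nth_vderiv_unique[of ?D, OF D] show "nth_vderiv k (fmult m f) = ?D k" by simp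
qed

lemma fmult_bounded: "m \<in> schwartz \<Longrightarrow> f \<in> bdm \<Longrightarrow> bounded (range (fmult m f))"
proof -
  assume m: "m \<in> schwartz" and f: "f \<in> bdm"
  obtain M where "\<And>x. norm (f x) \<le> M" using bdmE[OF f] by blast
  from fmult_bound[OF m f this] show ?thesis by (auto intro!: boundedI)
qed

lemma fmult_Cb: "m \<in> schwartz \<Longrightarrow> f \<in> bdm \<Longrightarrow> fmult m f \<in> Cb_infinity"
  unfolding Cb_infinity_def
  by (simp add: fmult_nth_vderiv fmult_bounded schwartz_power_mult)

lemma fmult_continuous: "m \<in> schwartz \<Longrightarrow> f \<in> bdm \<Longrightarrow> continuous_on A (fmult m f)"
  using smooth_continuous[OF fmult_nth_vderiv(1), of m f A 0] by simp

lemma fmult_bdm: "m \<in> schwartz \<Longrightarrow> f \<in> bdm \<Longrightarrow> fmult m f \<in> bdm"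
  by (auto intro!: bdm_continuous[of "fmult m f"] fmult_continuous fmult_bounded)

lemma fourier_ker:
  assumes "m \<in> schwartz"
  shows "(LINT y|lborel. inv_fourier m y * cis (- (y * \<xi>))) = m \<xi>"
  using fun_cong[OF fourier_inv_fourier[OF assms], of \<xi>]
  by (simp add: fourier_osc osc_int_def mult.commute)

text \<open>Writing the second kernel as an oscillatory integral and exchanging leaves the transform
  of the first kernel inside, which is \<open>m\<close> by \<open>fourier_ker\<close>.\<close>

lemma ker_convolution:
  assumes m: "m \<in> schwartz" and n: "n \<in> schwartz"
  shows "(LINT y|lborel. inv_fourier m y * inv_fourier n (x - y)) = inv_fourier (\<lambda>\<xi>. m \<xi> * n \<xi>) x"
proof -
  note [measurable] = schwartz_borel[OF n] ker_borel[OF m]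
  have "(LINT y|lborel. inv_fourier m y * inv_fourier n (x - y)) =
      (LINT y|lborel. LINT \<xi>|lborel. inv_fourier m y * (cis ((x - y) * \<xi>) * n \<xi>)) / of_real (2 * pi)"
    by (simp add: inv_fourier_osc[of n] osc_int_def) (simp add: mult_ac)
  also have "(LINT y|lborel. LINT \<xi>|lborel. inv_fourier m y * (cis ((x - y) * \<xi>) * n \<xi>)) =
      (LINT \<xi>|lborel. LINT y|lborel. inv_fourier m y * (cis ((x - y) * \<xi>) * n \<xi>))"
    by (rule fubini_lborel[symmetric, where a="\<lambda>y. norm (inv_fourier m y)" and b="\<lambda>y \<xi>. norm (n \<xi>)" and B="LINT y|lborel. norm (n y)"])
       (auto simp: norm_mult intro!: integrable_norm schwartz_integrable n ker_integrable m)
  also have "\<dots> = (LINT \<xi>|lborel. cis (1 * \<xi> * x) * (m \<xi> * n \<xi>))"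
  proof (intro Bochner_Integration.integral_cong refl)
    fix \<xi>
    have "cis ((x - y) * \<xi>) = cis (1 * \<xi> * x) * cis (- (y * \<xi>))" for y
      unfolding cis_mult by (rule arg_cong[where f=cis]) (simp add: algebra_simps)
    then have "inv_fourier m y * (cis ((x - y) * \<xi>) * n \<xi>) =
       (cis (1 * \<xi> * x) * n \<xi>) * (inv_fourier m y * cis (- (y * \<xi>)))" for y
      by (simp only: mult_ac)
    note eq = this
    show "(LINT y|lborel. inv_fourier m y * (cis ((x - y) * \<xi>) * n \<xi>)) = cis (1 * \<xi> * x) * (m \<xi> * n \<xi>)"
      unfolding eq integral_mult_right_zero fourier_ker[OF m] by (simp only: mult_ac)
  qed
  finally show ?thesis by (simp add: inv_fourier_osc osc_int_def)
qed

lemma fmult_fmult: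
  assumes m: "m \<in> schwartz" and n: "n \<in> schwartz" and f: "f \<in> bdm"
  shows "fmult m (fmult n f) = fmult (\<lambda>\<xi>. m \<xi> * n \<xi>) f"
proof (rule ext)
  fix x
  note [measurable] = bdm_borel[OF f] ker_borel[OF m] ker_borel[OF n]
  obtain M where M: "\<And>x. norm (f x) \<le> M" "M \<ge> 0" using bdmE[OF f] by blast
  have "fmult m (fmult n f) x =
      (LINT y|lborel. LINT z|lborel. inv_fourier m (x - y) * (inv_fourier n (y - z) * f z))"
    unfolding fmult_def by simp
  also have "\<dots> = (LINT z|lborel. LINT y|lborel. inv_fourier m (x - y) * (inv_fourier n (y - z) * f z))"
  proof (rule fubini_lborel[symmetric, where a="\<lambda>y. norm (inv_fourier m (x - y))"
        and b="\<lambda>y z. norm (inv_fourier n (y - z)) * M" and B="ker_norm n * M"])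
    show "integrable lborel (\<lambda>y. norm (inv_fourier m (x - y)))"
      by (intro integrable_norm translate_integrable(2) ker_integrable m)
    show "integrable lborel (\<lambda>z. norm (inv_fourier n (y - z)) * M)" for y
      by (intro integrable_mult_left integrable_norm translate_integrable(2) ker_integrable n)
    show "(LINT z|lborel. norm (inv_fourier n (y - z)) * M) \<le> ker_norm n * M" for y
      using translate_integral(2)[of "\<lambda>y. norm (inv_fourier n y)" y] by (simp add: ker_norm_def)
  qed (use M in \<open>auto simp: norm_mult intro!: mult_left_mono\<close>)
  also have "\<dots> = (LINT z|lborel. inv_fourier (\<lambda>\<xi>. m \<xi> * n \<xi>) (x - z) * f z)"
  proof (intro Bochner_Integration.integral_cong refl)
    fix z
    have "(LINT y|lborel. inv_fourier m (x - y) * (inv_fourier n (y - z) * f z)) =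
        (LINT y|lborel. inv_fourier m (x - y) * inv_fourier n (y - z)) * f z"
      by (simp flip: mult.assoc)
    also have "(LINT y|lborel. inv_fourier m (x - y) * inv_fourier n (y - z)) =
        (LINT y|lborel. inv_fourier m y * inv_fourier n ((x - z) - y))"
      using translate_integral(2)[of "\<lambda>y. inv_fourier m y * inv_fourier n ((x - z) - y)" x]
      by (simp add: algebra_simps)
    finally show "(LINT y|lborel. inv_fourier m (x - y) * (inv_fourier n (y - z) * f z)) =
        inv_fourier (\<lambda>\<xi>. m \<xi> * n \<xi>) (x - z) * f z" by (simp add: ker_convolution m n)
  qed
  finally show "fmult m (fmult n f) x = fmult (\<lambda>\<xi>. m \<xi> * n \<xi>) f x" by (simp add: fmult_def)
qed

section \<open>Symbols under modulation, conjugation and differentiation\<close>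

lemma ker_shift: "inv_fourier (\<lambda>\<xi>. m (\<xi> + \<zeta>)) x = cis (- (\<zeta> * x)) * inv_fourier m x"
proof -
  have "(LINT \<xi>|lborel. cis (1 * \<xi> * x) * m (\<xi> + \<zeta>)) =
     (LINT \<xi>|lborel. cis (- (\<zeta> * x)) * (cis (1 * (\<xi> + \<zeta>) * x) * m (\<xi> + \<zeta>)))"
  proof (intro Bochner_Integration.integral_cong refl)
    fix \<xi>
    have "cis (1 * \<xi> * x) = cis (- (\<zeta> * x)) * cis (1 * (\<xi> + \<zeta>) * x)"
      unfolding cis_mult by (rule arg_cong[where f=cis]) (simp add: algebra_simps)
    then show "cis (1 * \<xi> * x) * m (\<xi> + \<zeta>) = cis (- (\<zeta> * x)) * (cis (1 * (\<xi> + \<zeta>) * x) * m (\<xi> + \<zeta>))"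
      by (simp only: mult_ac)
  qed
  also have "\<dots> = cis (- (\<zeta> * x)) * (LINT \<xi>|lborel. cis (1 * \<xi> * x) * m \<xi>)"
    using translate_integral(1)[of "\<lambda>\<xi>. cis (1 * \<xi> * x) * m \<xi>" \<zeta>] by (simp del: mult_1)
  finally show ?thesis by (simp add: inv_fourier_osc osc_int_def del: mult_1)
qed

text \<open>Shifting the symbol only modulates the kernel. Every bound below that is uniform in the
  frequency index has its origin here.\<close>

lemma ker_norm_shift: "ker_norm (\<lambda>\<xi>. m (\<xi> + \<zeta>)) = ker_norm m"
  by (simp add: ker_norm_def ker_shift norm_mult)

lemma fmult_modulate:
  "fmult m (\<lambda>y. cis (\<zeta> * y) * f y) x = cis (\<zeta> * x) * fmult (\<lambda>\<xi>. m (\<xi> + \<zeta>)) f x"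
proof -
  have "cis (\<zeta> * y) = cis (\<zeta> * x) * cis (- (\<zeta> * (x - y)))" for y
    unfolding cis_mult by (rule arg_cong[where f=cis]) (simp add: algebra_simps)
  then have "inv_fourier m (x - y) * (cis (\<zeta> * y) * f y) =
      cis (\<zeta> * x) * (inv_fourier (\<lambda>\<xi>. m (\<xi> + \<zeta>)) (x - y) * f y)" for y
    unfolding ker_shift by (metis mult.assoc mult.commute)
  note eq = this
  show ?thesis unfolding fmult_def eq by simp
qed

lemma fmult_cis:
  assumes "m \<in> schwartz"
  shows "fmult m (\<lambda>y. cis (\<zeta> * y)) x = m \<zeta> * cis (\<zeta> * x)"
proof -
  have "cis (\<zeta> * (x - y)) = cis (\<zeta> * x) * cis (- (y * \<zeta>))" for y
    unfolding cis_mult by (rule arg_cong[where f=cis]) (simp add: algebra_simps)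
  then have "inv_fourier m y * cis (\<zeta> * (x - y)) = cis (\<zeta> * x) * (inv_fourier m y * cis (- (y * \<zeta>)))" for y
    by (simp only: mult_ac)
  then show ?thesis unfolding fmult_alt by (simp only: fourier_ker[OF assms] integral_mult_right_zero mult.commute)
qed

lemma fmult_cnj: "fmult m (\<lambda>y. cnj (f y)) x = cnj (fmult (\<lambda>\<xi>. cnj (m (- \<xi>))) f x)"
proof -
  have "cnj (inv_fourier (\<lambda>\<xi>. cnj (m (- \<xi>))) x) = inv_fourier m x" for x
  proof -
    have "cnj (LINT \<xi>|lborel. cis (\<xi> * x) * cnj (m (- \<xi>))) = (LINT \<xi>|lborel. cis (- \<xi> * x) * m (- \<xi>))"
      by (subst Bochner_Integration.integral_cnj[symmetric]) (simp add: cis_cnj)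
    also have "\<dots> = (LINT \<xi>|lborel. cis (\<xi> * x) * m \<xi>)"
      using translate_integral(2)[of "\<lambda>\<xi>. cis (\<xi> * x) * m \<xi>" 0] by simp
    finally show ?thesis by (simp add: inv_fourier_osc osc_int_def)
  qed
  then have "inv_fourier m (x - y) * cnj (f y) = cnj (inv_fourier (\<lambda>\<xi>. cnj (m (- \<xi>))) (x - y) * f y)" for y
    by (metis complex_cnj_mult)
  then show ?thesis unfolding fmult_def by (simp only: Bochner_Integration.integral_cnj)
qed

text \<open>A convolution can be differentiated through either factor; comparing the two results
  replaces an integration by parts on the whole line. In this way derivatives of a solution become
  symbols.\<close>

lemma fmult_of_deriv:
  assumes m: "m \<in> schwartz" and f: "f \<in> bdm" and f': "f' \<in> bdm"
    and der: "\<And>x. (f has_vector_derivative f' x) (at x)"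
  shows "fmult m f' x = fmult (\<lambda>\<xi>. (\<i> * of_real \<xi>) * m \<xi>) f x"
proof -
  obtain M where M: "\<And>x. norm (f' x) \<le> M" "M \<ge> 0" using bdmE[OF f'] by blast
  obtain L where L: "\<And>x. norm (f x) \<le> L" "L \<ge> 0" using bdmE[OF f] by blast
  note [measurable] = bdm_borel[OF f] bdm_borel[OF f'] ker_borel[OF m]
  have "((\<lambda>x. LINT y|lborel. inv_fourier m y * f (x - y)) has_vector_derivative
      (LINT y|lborel. inv_fourier m y * f' (x - y))) (at x)"
  proof (rule has_vector_derivative_integral[where e=1 and w="\<lambda>y. norm (inv_fourier m y) * M"])
    show "integrable lborel (\<lambda>y. inv_fourier m y * f (t - y))" for t
      by (rule integrable_mult_bounded[OF ker_integrable[OF m], of _ L]) (use L in auto)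
    show "((\<lambda>t. inv_fourier m y * f (t - y)) has_vector_derivative inv_fourier m y * f' (t - y)) (at t)" for t y
    proof -
      have "((\<lambda>t. t - y) has_vector_derivative 1) (at t)"
        by (auto intro!: derivative_eq_intros simp flip: has_real_derivative_iff_has_vector_derivative)
      from vector_diff_chain_at[OF this, of f] der[of "t - y"]
      have "((\<lambda>t. f (t - y)) has_vector_derivative f' (t - y)) (at t)" by (simp add: o_def)
      then show ?thesis by (rule has_vector_derivative_mult_right)
    qed
    show "norm (inv_fourier m y * f' (t - y)) \<le> norm (inv_fourier m y) * M" for t y
      using M by (auto simp: norm_mult intro!: mult_left_mono)
    show "integrable lborel (\<lambda>y. norm (inv_fourier m y) * M)"
      by (intro integrable_mult_left integrable_norm ker_integrable m)
  qed auto
  then have "(fmult m f has_vector_derivative fmult m f' x) (at x)" by (simp add: fmult_alt[abs_def])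
  then show ?thesis using fmult_deriv[OF m f, of x] by (rule vector_derivative_unique_at)
qed

text \<open>
  Superposing \<open>fmult b g\<close> from exponentials \<open>cis (\<zeta> * z)\<close> with \<open>b \<zeta> \<noteq> 0\<close> reduces the claim to
  \<open>fmult_modulate\<close>.
\<close>

lemma fmult_product_disjoint:
  assumes m: "m \<in> schwartz" and a: "a \<in> schwartz" and b: "b \<in> schwartz"
    and shift: "\<And>\<zeta>. (\<lambda>\<xi>. m (\<xi> + \<zeta>)) \<in> schwartz"
    and f: "f \<in> bdm" and g: "g \<in> bdm"
    and disj: "\<And>\<xi> \<zeta>. a \<xi> \<noteq> 0 \<Longrightarrow> b \<zeta> \<noteq> 0 \<Longrightarrow> m (\<xi> + \<zeta>) = 0"
  shows "fmult m (\<lambda>x. fmult a f x * fmult b g x) x = 0"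
proof -
  let ?F = "fmult a f"
  have F: "?F \<in> bdm" by (rule fmult_bdm[OF a f])
  note [measurable] = bdm_borel[OF F] bdm_borel[OF g] ker_borel[OF m] ker_borel[OF b] schwartz_borel[OF b]
  obtain M where M: "\<And>x. norm (?F x) \<le> M" "M \<ge> 0" using bdmE[OF F] by blast
  obtain N where N: "\<And>x. norm (g x) \<le> N" "N \<ge> 0" using bdmE[OF g] by blast
  \<comment> \<open>Multiplication by an exponential of frequency \<open>\<zeta>\<close> shifts the
    frequencies of \<open>fmult a f\<close> by \<open>\<zeta>\<close>, so the combined symbol is
    \<open>m (\<xi> + \<zeta>) * a \<xi>\<close>, which vanishes identically by
    \<open>disj\<close>.\<close>
  have exp0: "b \<zeta> * fmult m (\<lambda>z. cis (\<zeta> * z) * ?F z) x = 0" for \<zeta>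
  proof (cases "b \<zeta> = 0")
    case False
    have "fmult (\<lambda>\<xi>. m (\<xi> + \<zeta>)) ?F x = fmult (\<lambda>\<xi>. m (\<xi> + \<zeta>) * a \<xi>) f x"
      by (simp add: fmult_fmult[OF shift a f])
    also have "(\<lambda>\<xi>. m (\<xi> + \<zeta>) * a \<xi>) = (\<lambda>\<xi>. 0)" using disj[OF _ False] by fastforce
    finally show ?thesis by (simp add: fmult_modulate fmult_zero_left)
  qed simp
  have inner: "(LINT z|lborel. inv_fourier m (x - z) * ?F z * inv_fourier b (z - y)) = 0" for y
  proof -
    have "(LINT z|lborel. inv_fourier m (x - z) * ?F z * inv_fourier b (z - y)) =
       (LINT z|lborel. LINT \<zeta>|lborel. inv_fourier m (x - z) * ?F z * (cis ((z - y) * \<zeta>) * b \<zeta>)) / of_real (2 * pi)"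
      by (simp add: inv_fourier_osc[of b] osc_int_def) (simp add: mult_ac)
    also have "(LINT z|lborel. LINT \<zeta>|lborel. inv_fourier m (x - z) * ?F z * (cis ((z - y) * \<zeta>) * b \<zeta>)) =
       (LINT \<zeta>|lborel. LINT z|lborel. inv_fourier m (x - z) * ?F z * (cis ((z - y) * \<zeta>) * b \<zeta>))"
    proof (rule fubini_lborel[symmetric, where a="\<lambda>z. norm (inv_fourier m (x - z)) * M"
          and b="\<lambda>z \<zeta>. norm (b \<zeta>)" and B="LINT \<zeta>|lborel. norm (b \<zeta>)"])
      show "integrable lborel (\<lambda>z. norm (inv_fourier m (x - z)) * M)"
        by (intro integrable_mult_left integrable_norm translate_integrable(2) ker_integrable m)
      show "integrable lborel (\<lambda>\<zeta>. norm (b \<zeta>))" by (intro integrable_norm schwartz_integrable b)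
    qed (use M in \<open>auto simp: norm_mult intro!: mult_left_mono mult_right_mono\<close>)
    also have "\<dots> = 0"
    proof -
      have "cis ((z - y) * \<zeta>) = cis (- (y * \<zeta>)) * cis (\<zeta> * z)" for z \<zeta>
        unfolding cis_mult by (rule arg_cong[where f=cis]) (simp add: algebra_simps)
      then have "inv_fourier m (x - z) * ?F z * (cis ((z - y) * \<zeta>) * b \<zeta>) =
         (cis (- (y * \<zeta>)) * b \<zeta>) * (inv_fourier m (x - z) * (cis (\<zeta> * z) * ?F z))" for z \<zeta>
        by (simp only: mult_ac)
      note eq = this
      have "(LINT z|lborel. inv_fourier m (x - z) * ?F z * (cis ((z - y) * \<zeta>) * b \<zeta>)) = 0" for \<zeta>
        unfolding eq integral_mult_right_zero using exp0[of \<zeta>] by (simp add: fmult_def)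
      then show ?thesis by simp
    qed
    finally show ?thesis by simp
  qed
  have "fmult m (\<lambda>x. ?F x * fmult b g x) x =
      (LINT z|lborel. LINT y|lborel. inv_fourier m (x - z) * ?F z * inv_fourier b (z - y) * g y)"
    unfolding fmult_def[of m] fmult_def[of b] by (simp add: mult.assoc)
  also have "\<dots> = (LINT y|lborel. LINT z|lborel. inv_fourier m (x - z) * ?F z * inv_fourier b (z - y) * g y)"
  proof (rule fubini_lborel[symmetric, where a="\<lambda>z. norm (inv_fourier m (x - z)) * M"
        and b="\<lambda>z y. norm (inv_fourier b (z - y)) * N" and B="ker_norm b * N"])
    show "integrable lborel (\<lambda>z. norm (inv_fourier m (x - z)) * M)"
      by (intro integrable_mult_left integrable_norm translate_integrable(2) ker_integrable m)
    show "integrable lborel (\<lambda>y. norm (inv_fourier b (z - y)) * N)" for z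
      by (intro integrable_mult_left integrable_norm translate_integrable(2) ker_integrable b)
    show "(LINT y|lborel. norm (inv_fourier b (z - y)) * N) \<le> ker_norm b * N" for z
      using translate_integral(2)[of "\<lambda>y. norm (inv_fourier b y)" z] by (simp add: ker_norm_def)
    show "norm (inv_fourier m (x - z) * ?F z * inv_fourier b (z - y) * g y) \<le>
        norm (inv_fourier m (x - z)) * M * (norm (inv_fourier b (z - y)) * N)" for z y
      unfolding norm_mult mult.assoc using M N by (intro mult_left_mono mult_mono) auto
  qed (use M in auto)
  also have "\<dots> = 0" using inner by simp
  finally show ?thesis .
qed

text \<open>The left side is what duality makes of a multiplier on the distribution of
  \<open>f\<close>, the right side pairs the function \<open>fmult m f\<close>. The transformed test
  function is \<open>\<phi>\<close> integrated against the kernel, and Fubini moves the kernel over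
  to \<open>f\<close>.\<close>

lemma fourier_mult_pairing:
  assumes m: "m \<in> schwartz" and \<phi>: "\<phi> \<in> schwartz" and f: "f \<in> bdm"
  shows "(LINT x|lborel. f x * fourier (\<lambda>\<xi>. m \<xi> * inv_fourier \<phi> \<xi>) x) = (LINT x|lborel. fmult m f x * \<phi> x)"
proof -
  note [measurable] = bdm_borel[OF f] ker_borel[OF m] schwartz_borel[OF \<phi>] schwartz_borel[OF m]
  obtain M where M: "\<And>x. norm (f x) \<le> M" "M \<ge> 0" using bdmE[OF f] by blast
  have F: "fourier (\<lambda>\<xi>. m \<xi> * inv_fourier \<phi> \<xi>) x = (LINT y|lborel. inv_fourier m (y - x) * \<phi> y)" for x
  proof -
    have "fourier (\<lambda>\<xi>. m \<xi> * inv_fourier \<phi> \<xi>) x =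
       (LINT \<xi>|lborel. LINT y|lborel. cis (-1 * \<xi> * x) * m \<xi> * (cis (1 * y * \<xi>) * \<phi> y)) / of_real (2 * pi)"
      unfolding fourier_osc inv_fourier_osc osc_int_def by (simp add: mult.assoc)
    also have "(LINT \<xi>|lborel. LINT y|lborel. cis (-1 * \<xi> * x) * m \<xi> * (cis (1 * y * \<xi>) * \<phi> y)) =
       (LINT y|lborel. LINT \<xi>|lborel. cis (-1 * \<xi> * x) * m \<xi> * (cis (1 * y * \<xi>) * \<phi> y))"
      by (rule fubini_lborel[symmetric, where a="\<lambda>\<xi>. norm (m \<xi>)" and b="\<lambda>\<xi> y. norm (\<phi> y)" and B="LINT y|lborel. norm (\<phi> y)"])
         (auto simp: norm_mult intro!: integrable_norm schwartz_integrable m \<phi>)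
    also have "\<dots> = (LINT y|lborel. (inv_fourier m (y - x) * of_real (2 * pi)) * \<phi> y)"
    proof (intro Bochner_Integration.integral_cong refl)
      fix y
      have c: "cis (-1 * \<xi> * x) * cis (1 * y * \<xi>) = cis (1 * \<xi> * (y - x))" for \<xi>
        unfolding cis_mult by (rule arg_cong[where f=cis]) (simp add: algebra_simps)
      have eq: "cis (-1 * \<xi> * x) * m \<xi> * (cis (1 * y * \<xi>) * \<phi> y) = (cis (1 * \<xi> * (y - x)) * m \<xi>) * \<phi> y" for \<xi>
        unfolding c[symmetric] by (simp only: mult_ac)
      show "(LINT \<xi>|lborel. cis (-1 * \<xi> * x) * m \<xi> * (cis (1 * y * \<xi>) * \<phi> y)) = (inv_fourier m (y - x) * of_real (2 * pi)) * \<phi> y"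
        unfolding eq by (simp add: inv_fourier_osc osc_int_def)
    qed
    also have "\<dots> = (LINT y|lborel. inv_fourier m (y - x) * \<phi> y) * of_real (2 * pi)"
      unfolding integral_mult_left_zero[symmetric] by (simp only: mult_ac)
    finally show ?thesis by simp
  qed
  have "(LINT x|lborel. f x * fourier (\<lambda>\<xi>. m \<xi> * inv_fourier \<phi> \<xi>) x) =
      (LINT x|lborel. LINT y|lborel. f x * (inv_fourier m (y - x) * \<phi> y))"
    unfolding F by simp
  also have "\<dots> = (LINT y|lborel. LINT x|lborel. f x * (inv_fourier m (y - x) * \<phi> y))"
  proof (rule fubini_lborel[where a="\<lambda>y. norm (\<phi> y)"
        and b="\<lambda>y x. norm (inv_fourier m (y - x)) * M" and B="ker_norm m * M"])
    show "integrable lborel (\<lambda>y. norm (\<phi> y))" by (intro integrable_norm schwartz_integrable \<phi>)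
    show "integrable lborel (\<lambda>x. norm (inv_fourier m (y - x)) * M)" for y
      by (intro integrable_mult_left integrable_norm translate_integrable(2) ker_integrable m)
    show "(LINT x|lborel. norm (inv_fourier m (y - x)) * M) \<le> ker_norm m * M" for y
      using translate_integral(2)[of "\<lambda>y. norm (inv_fourier m y)" y] by (simp add: ker_norm_def)
    show "norm (f x * (inv_fourier m (y - x) * \<phi> y)) \<le> norm (\<phi> y) * (norm (inv_fourier m (y - x)) * M)" for x y
    proof -
      have "norm (f x * (inv_fourier m (y - x) * \<phi> y)) = norm (\<phi> y) * (norm (inv_fourier m (y - x)) * norm (f x))"
        by (simp add: norm_mult)
      then show ?thesis using M by (auto intro!: mult_left_mono)
    qed
  qed auto
  also have "\<dots> = (LINT y|lborel. fmult m f y * \<phi> y)"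
    unfolding fmult_def by (intro Bochner_Integration.integral_cong refl) (simp add: mult_ac flip: integral_mult_left_zero)
  finally show ?thesis .
qed

section \<open>Frequency blocks of tempered distributions\<close>

definition supn :: "(real \<Rightarrow> complex) \<Rightarrow> ennreal" where
  "supn f = (SUP x. ennreal (norm (f x)))"

section \<open>Suprema and unordered sums in the extended reals\<close>

lemma supn_upper: "ennreal (norm (f x)) \<le> supn f"
  unfolding supn_def by (rule SUP_upper) simp

lemma supn_least: "(\<And>x. norm (f x) \<le> M) \<Longrightarrow> supn f \<le> ennreal M"
  unfolding supn_def by (rule SUP_least) (simp add: ennreal_leI)

lemma supn_le: "(\<And>x. ennreal (norm (f x)) \<le> M) \<Longrightarrow> supn f \<le> M"
  unfolding supn_def by (rule SUP_least) simp

lemma supn_finite: "f \<in> bdm \<Longrightarrow> supn f < \<infinity>"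
  by (erule bdmE) (metis supn_least ennreal_less_top infinity_ennreal_def le_less_trans)

lemma norm_le_supn: "f \<in> bdm \<Longrightarrow> norm (f x) \<le> enn2real (supn f)"
  using supn_upper[of f x] supn_finite[of f] enn2real_mono[of "ennreal (norm (f x))" "supn f"] by simp

lemma supn_zero [simp]: "supn (\<lambda>x. 0) = 0"
  by (simp add: supn_def)

lemma supn_eq_ennreal: "f \<in> bdm \<Longrightarrow> supn f = ennreal (enn2real (supn f))"
  using supn_finite[of f] by (simp add: ennreal_enn2real)

lemma supn_add: "supn (\<lambda>x. f x + g x) \<le> supn f + supn g"
proof (rule supn_le)
  fix x
  have "ennreal (norm (f x + g x)) \<le> ennreal (norm (f x) + norm (g x))"
    by (intro ennreal_leI norm_triangle_ineq)
  also have "\<dots> = ennreal (norm (f x)) + ennreal (norm (g x))" by simp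
  also have "\<dots> \<le> supn f + supn g" by (intro add_mono supn_upper)
  finally show "ennreal (norm (f x + g x)) \<le> supn f + supn g" .
qed

lemma supn_mult: "supn (\<lambda>x. f x * g x) \<le> supn f * supn g"
proof (rule supn_le)
  fix x
  have "ennreal (norm (f x * g x)) = ennreal (norm (f x)) * ennreal (norm (g x))"
    by (simp add: norm_mult ennreal_mult)
  also have "\<dots> \<le> supn f * supn g" by (intro mult_mono supn_upper) auto
  finally show "ennreal (norm (f x * g x)) \<le> supn f * supn g" .
qed

lemma supn_cong_norm: "(\<And>x. norm (f x) = norm (g x)) \<Longrightarrow> supn f = supn g"
  by (simp add: supn_def)

lemma supn_fmult:
  assumes "m \<in> schwartz" "f \<in> bdm"
  shows "supn (fmult m f) \<le> ennreal (ker_norm m) * supn f"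
proof -
  have "supn (fmult m f) \<le> ennreal (ker_norm m * enn2real (supn f))"
    by (intro supn_least fmult_bound assms norm_le_supn)
  also have "\<dots> = ennreal (ker_norm m) * supn f"
    using supn_eq_ennreal[OF assms(2)] by (simp add: ennreal_mult ker_norm_nonneg)
  finally show ?thesis .
qed

lemma supn_sum: "finite I \<Longrightarrow> supn (\<lambda>x. \<Sum>i\<in>I. f i x) \<le> (\<Sum>i\<in>I. supn (f i))"
proof (induction I rule: finite_induct)
  case (insert i I)
  then have "supn (\<lambda>x. \<Sum>i\<in>insert i I. f i x) = supn (\<lambda>x. f i x + (\<Sum>i\<in>I. f i x))" by simp
  also have "\<dots> \<le> supn (f i) + supn (\<lambda>x. \<Sum>i\<in>I. f i x)" by (rule supn_add)
  also have "\<dots> \<le> supn (f i) + (\<Sum>i\<in>I. supn (f i))" by (intro add_left_mono insert.IH)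
  finally show ?case using insert by simp
qed simp

lemma sum_le_infsum_ennreal:
  fixes f :: "'a \<Rightarrow> ennreal"
  assumes "finite F" "F \<subseteq> A" shows "sum f F \<le> infsum f A"
  using assms by (subst nonneg_infsum_complete) (auto intro!: SUP_upper)

lemma infsum_ennreal_le:
  fixes f :: "'a \<Rightarrow> ennreal"
  assumes "\<And>F. finite F \<Longrightarrow> F \<subseteq> A \<Longrightarrow> sum f F \<le> B" shows "infsum f A \<le> B"
  using assms by (subst nonneg_infsum_complete) (auto intro!: SUP_least)

lemma summable_on_ennreal:
  fixes c :: "'a \<Rightarrow> real"
  assumes "(\<Sum>\<^sub>\<infinity>k\<in>A. ennreal (c k)) < \<infinity>" "\<And>k. 0 \<le> c k"
  shows "c summable_on A" "(\<Sum>\<^sub>\<infinity>k\<in>A. ennreal (c k)) = ennreal (infsum c A)"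
proof -
  have le: "sum c F \<le> enn2real (\<Sum>\<^sub>\<infinity>k\<in>A. ennreal (c k))" if "finite F" "F \<subseteq> A" for F
  proof -
    have "ennreal (sum c F) \<le> (\<Sum>\<^sub>\<infinity>k\<in>A. ennreal (c k))"
      using sum_le_infsum_ennreal[OF that, of "\<lambda>k. ennreal (c k)"] assms(2) by (simp add: sum_ennreal)
    then show ?thesis using assms enn2real_mono by (fastforce simp: sum_nonneg)
  qed
  show s: "c summable_on A"
    by (rule nonneg_bdd_above_summable_on) (use le assms(2) in \<open>auto intro!: bdd_aboveI\<close>)
  show "(\<Sum>\<^sub>\<infinity>k\<in>A. ennreal (c k)) = ennreal (infsum c A)"
  proof (rule antisym)
    show "(\<Sum>\<^sub>\<infinity>k\<in>A. ennreal (c k)) \<le> ennreal (infsum c A)"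
    proof (rule infsum_ennreal_le)
      fix F assume "finite F" "F \<subseteq> A"
      then show "(\<Sum>k\<in>F. ennreal (c k)) \<le> ennreal (infsum c A)"
        using finite_sum_le_infsum[OF s, of F] assms(2) by (simp add: sum_ennreal ennreal_leI)
    qed
    have "infsum c A \<le> enn2real (\<Sum>\<^sub>\<infinity>k\<in>A. ennreal (c k))"
      by (rule infsum_le_finite_sums[OF s]) (use le in auto)
    then show "ennreal (infsum c A) \<le> (\<Sum>\<^sub>\<infinity>k\<in>A. ennreal (c k))"
      using assms(1) by (metis ennreal_enn2real ennreal_leI infinity_ennreal_def)
  qed
qed

text \<open>Unordered sums over the integers become limits of sequences, to which dominated
  convergence and uniform limits apply.\<close>

lemma filterlim_symmetric_intervals:
  "filterlim (\<lambda>n. {- int n..int n}) (finite_subsets_at_top UNIV) sequentially"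
  unfolding filterlim_finite_subsets_at_top
proof (intro allI impI)
  fix X :: "int set" assume "finite X \<and> X \<subseteq> UNIV"
  then obtain N where N: "\<And>k. k \<in> X \<Longrightarrow> nat \<bar>k\<bar> \<le> N"
    by (metis (no_types) finite_imageI image_eqI finite_nat_set_iff_bounded_le)
  have "X \<subseteq> {- int n..int n}" if "n \<ge> N" for n
    using N that by fastforce
  then show "\<forall>\<^sub>F y in sequentially. finite {- int y..int y} \<and> X \<subseteq> {- int y..int y} \<and> {- int y..int y} \<subseteq> UNIV"
    by (auto simp: eventually_sequentially)
qed

section \<open>Tempered distributions and their continuity\<close>

lemma schwartz_seminorm_upper:
  assumes "\<phi> \<in> schwartz"
  shows "\<bar>x\<bar> ^ j * norm (nth_vderiv k \<phi> x) \<le> schwartz_seminorm j k \<phi>"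
proof -
  obtain C where "\<And>x. \<bar>x\<bar> ^ j * norm (nth_vderiv k \<phi> x) \<le> C"
    using rapidE[OF schwartz_rapid[OF schwartz_nth_vderiv[OF assms, of k]], of j] by blast
  then show ?thesis unfolding schwartz_seminorm_def
    by (intro cSUP_upper) (auto intro!: bdd_aboveI)
qed

lemma schwartz_seminorm_nonneg: "\<phi> \<in> schwartz \<Longrightarrow> 0 \<le> schwartz_seminorm j k \<phi>"
  using schwartz_seminorm_upper[of \<phi> 0 j k] by (rule order.trans[rotated]) auto

lemma bdm_mult_schwartz_integrable:
  "f \<in> bdm \<Longrightarrow> \<phi> \<in> schwartz \<Longrightarrow> integrable lborel (\<lambda>x. f x * \<phi> x)"
  using bdmE[of f] integrable_mult_bounded[OF schwartz_integrable, of \<phi> f]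
  by (metis (no_types, lifting) bdm_borel mult.commute Bochner_Integration.integrable_cong)

lemma reg_dist_tempered:
  assumes f: "f \<in> bdm" shows "reg_dist f \<in> tempered"
proof -
  obtain M where M: "\<And>x. norm (f x) \<le> M" "M \<ge> 0" using bdmE[OF f] by blast
  define P where "P = (LINT x::real|lborel. 1 / (1 + x\<^sup>2))"
  have P: "P \<ge> 0" unfolding P_def by (intro integral_nonneg_AE) auto
  have "norm (reg_dist f \<phi>) \<le> (M * P) * (\<Sum>j\<le>2. \<Sum>k\<le>2. schwartz_seminorm j k \<phi>)" if \<phi>: "\<phi> \<in> schwartz" for \<phi>
  proof -
    \<comment> \<open>These two seminorms already bound \<open>\<phi>\<close> by an integrable
      function; order 2 in the weight is the reason for \<open>N = 2\<close>.\<close>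
    let ?s = "schwartz_seminorm 0 0 \<phi> + schwartz_seminorm 2 0 \<phi>"
    have s: "norm (\<phi> x) \<le> ?s / (1 + x\<^sup>2)" for x
    proof -
      have "norm (\<phi> x) * (1 + x\<^sup>2) \<le> ?s"
        using schwartz_seminorm_upper[OF \<phi>, of x 0 0] schwartz_seminorm_upper[OF \<phi>, of x 2 0]
        by (simp add: algebra_simps)
      then show ?thesis by (simp add: pos_le_divide_eq add_pos_nonneg)
    qed
    have "norm (reg_dist f \<phi>) \<le> (LINT x|lborel. norm (f x * \<phi> x))"
      using \<phi> by (simp add: reg_dist_def)
    also have "\<dots> \<le> (LINT x|lborel. M * (?s / (1 + x\<^sup>2)))"
      by (intro integral_mono integrable_norm bdm_mult_schwartz_integrable f \<phi> integrable_mult_right decay_integrable)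
         (use M mult_mono[OF M(1) s M(2) norm_ge_zero] in \<open>auto simp: norm_mult\<close>)
    also have "\<dots> = M * P * ?s"
    proof -
      have *: "M * (?s / (1 + x\<^sup>2)) = (M * ?s) * (1 / (1 + x\<^sup>2))" for x :: real by simp
      show ?thesis unfolding * integral_mult_right_zero P_def by (simp only: mult_ac)
    qed
    also have "?s \<le> (\<Sum>j\<le>2. \<Sum>k\<le>2. schwartz_seminorm j k \<phi>)"
      by (simp add: numeral_2_eq_2 schwartz_seminorm_nonneg[OF \<phi>] add_nonneg_nonneg algebra_simps)
    finally show ?thesis using M P by (simp add: mult_left_mono)
  qed
  then have "\<exists>C N. \<forall>\<phi>\<in>schwartz. norm (reg_dist f \<phi>) \<le> C * (\<Sum>j\<le>N. \<Sum>k\<le>N. schwartz_seminorm j k \<phi>)"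
    by blast
  then show ?thesis
    using bdm_mult_schwartz_integrable[OF f]
    by (auto simp: tempered_def reg_dist_def schwartz_add schwartz_cmult distrib_left mult.left_commute)
qed

lemma reg_dist_diff: "f \<in> bdm \<Longrightarrow> g \<in> bdm \<Longrightarrow> reg_dist f - reg_dist g = reg_dist (\<lambda>x. f x - g x)"
  by (rule ext) (simp add: reg_dist_def left_diff_distrib bdm_mult_schwartz_integrable)

lemma reg_dist_cmult: "c * reg_dist f \<phi> = reg_dist (\<lambda>x. c * f x) \<phi>"
  by (simp add: reg_dist_def mult.assoc)

lemma reg_dist_sum:
  "(\<And>i. i \<in> I \<Longrightarrow> f i \<in> bdm) \<Longrightarrow> (\<Sum>i\<in>I. reg_dist (f i) \<phi>) = reg_dist (\<lambda>x. \<Sum>i\<in>I. f i x) \<phi>"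
  by (simp add: reg_dist_def sum_distrib_right bdm_mult_schwartz_integrable)

lemma tempered_linear:
  assumes "S \<in> tempered"
  shows "\<phi> \<in> schwartz \<Longrightarrow> \<psi> \<in> schwartz \<Longrightarrow> S (\<lambda>x. \<phi> x + \<psi> x) = S \<phi> + S \<psi>"
    and "\<phi> \<in> schwartz \<Longrightarrow> S (\<lambda>x. c * \<phi> x) = c * S \<phi>"
    and "\<phi> \<in> schwartz \<Longrightarrow> \<psi> \<in> schwartz \<Longrightarrow> S (\<lambda>x. \<phi> x - \<psi> x) = S \<phi> - S \<psi>"
proof -
  show add: "\<phi> \<in> schwartz \<Longrightarrow> \<psi> \<in> schwartz \<Longrightarrow> S (\<lambda>x. \<phi> x + \<psi> x) = S \<phi> + S \<psi>" for \<phi> \<psi>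
    using assms by (simp add: tempered_def)
  show c: "\<phi> \<in> schwartz \<Longrightarrow> S (\<lambda>x. c * \<phi> x) = c * S \<phi>" for \<phi> c
    using assms by (simp add: tempered_def)
  show "S (\<lambda>x. \<phi> x - \<psi> x) = S \<phi> - S \<psi>" if "\<phi> \<in> schwartz" "\<psi> \<in> schwartz"
    using add[OF that(1) schwartz_cmult[OF that(2), of "-1"]] c[OF that(2), of "-1"] by simp
qed

lemma tempered_sum:
  assumes "S \<in> tempered" "\<And>i. i \<in> I \<Longrightarrow> \<phi> i \<in> schwartz"
  shows "S (\<lambda>x. \<Sum>i\<in>I. \<phi> i x) = (\<Sum>i\<in>I. S (\<phi> i))"
  using assms(2)
proof (induction I rule: infinite_finite_induct)
  case (insert i I)
  then show ?case using tempered_linear(1)[OF assms(1), of "\<phi> i" "\<lambda>x. \<Sum>i\<in>I. \<phi> i x"] schwartz_sum[of I \<phi>] by simp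
qed (use tempered_linear(2)[OF assms(1) schwartz_zero, of 0] in auto)

lemma tempered_continuous:
  assumes S: "S \<in> tempered" and \<psi>: "\<And>n. \<psi> n \<in> schwartz"
    and lim: "\<And>j k. (\<lambda>n. schwartz_seminorm j k (\<psi> n)) \<longlonglongrightarrow> 0"
  shows "(\<lambda>n. S (\<psi> n)) \<longlonglongrightarrow> 0"
proof -
  from S have "\<exists>C N. \<forall>\<phi>\<in>schwartz. norm (S \<phi>) \<le> C * (\<Sum>j\<le>N. \<Sum>k\<le>N. schwartz_seminorm j k \<phi>)"
    unfolding tempered_def mem_Collect_eq by (elim conjE)
  then obtain C N where b: "\<And>\<phi>. \<phi> \<in> schwartz \<Longrightarrow> norm (S \<phi>) \<le> C * (\<Sum>j\<le>N. \<Sum>k\<le>N. schwartz_seminorm j k \<phi>)"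
    by blast
  have "(\<lambda>n. C * (\<Sum>j\<le>N. \<Sum>k\<le>N. schwartz_seminorm j k (\<psi> n))) \<longlonglongrightarrow> C * (\<Sum>j\<le>N. \<Sum>k\<le>N. 0)"
    by (intro tendsto_intros lim)
  then have lim0: "(\<lambda>n. C * (\<Sum>j\<le>N. \<Sum>k\<le>N. schwartz_seminorm j k (\<psi> n))) \<longlonglongrightarrow> 0" by simp
  have le: "norm (S (\<psi> n)) \<le> norm (C * (\<Sum>j\<le>N. \<Sum>k\<le>N. schwartz_seminorm j k (\<psi> n))) * 1" for n
    using order.trans[OF b[OF \<psi>[of n]] abs_ge_self] by simp
  show ?thesis by (rule tendsto_0_le[OF lim0 always_eventually[OF allI[OF le]]])
qed

lemma cutoff_family_bound:
  assumes "\<And>n. smooth (B n)"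
    and "\<And>m. \<exists>C. \<forall>n x. norm (nth_vderiv m (B n) x :: complex) \<le> C"
    and "G \<in> schwartz"
  shows "\<exists>C. \<forall>n x. norm (nth_vderiv j (\<lambda>x. B n x * G x) x) \<le> C / (1 + x\<^sup>2)"
  using assms
proof (induction j arbitrary: B G)
  case 0
  obtain C where C: "\<And>n x. norm (B n x) \<le> C" using 0(2)[of 0] by auto
  obtain D where D: "D > 0" "\<And>x. norm (G x) \<le> D / (1 + x\<^sup>2)" using schwartz_decay[OF 0(3)] by blast
  have "norm (B n x * G x) \<le> C * D / (1 + x\<^sup>2)" for n x
  proof -
    have "C \<ge> 0" using order.trans[OF norm_ge_zero C] .
    then have "norm (B n x) * norm (G x) \<le> C * (D / (1 + x\<^sup>2))" by (intro mult_mono C D) auto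
    then show ?thesis by (simp add: norm_mult)
  qed
  then show ?case by auto
next
  case (Suc j)
  let ?B' = "\<lambda>n. nth_vderiv (Suc 0) (B n)" and ?G' = "nth_vderiv (Suc 0) G"
  have G': "?G' \<in> schwartz" using Suc.prems schwartz_nth_vderiv by blast
  have sB: "smooth (?B' n)" for n using Suc.prems(1)[of n] unfolding smooth_def by (simp flip: nth_vderiv_add_index)
  have bB: "\<exists>C. \<forall>n x. norm (nth_vderiv m (?B' n) x) \<le> C" for m
    using Suc.prems(2)[of "m + 1"] by (simp flip: nth_vderiv_add_index)
  from Suc.IH[OF sB bB Suc.prems(3)] obtain C1 where
    C1: "\<And>n x. norm (nth_vderiv j (\<lambda>x. ?B' n x * G x) x) \<le> C1 / (1 + x\<^sup>2)" by blast
  from Suc.IH[OF Suc.prems(1,2) G'] obtain C2 where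
    C2: "\<And>n x. norm (nth_vderiv j (\<lambda>x. B n x * ?G' x) x) \<le> C2 / (1 + x\<^sup>2)" by blast
  have "norm (nth_vderiv (Suc j) (\<lambda>x. B n x * G x) x) \<le> (C1 + C2) / (1 + x\<^sup>2)" for n x
  proof -
    have "nth_vderiv (Suc 0) (\<lambda>x. B n x * G x) = (\<lambda>x. B n x * ?G' x + ?B' n x * G x)"
      using smooth_has_vderiv[OF Suc.prems(1), of 0 n] smooth_has_vderiv[OF schwartz_smooth[OF Suc.prems(3)], of 0]
      by (intro nth_vderiv_Suc0_eq has_vector_derivative_mult) auto
    then have "nth_vderiv (Suc j) (\<lambda>x. B n x * G x) = nth_vderiv j (\<lambda>x. B n x * ?G' x + ?B' n x * G x)"
      by (simp only: nth_vderiv_Suc'[of j])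
    also have "\<dots> = (\<lambda>x. nth_vderiv j (\<lambda>x. B n x * ?G' x) x + nth_vderiv j (\<lambda>x. ?B' n x * G x) x)"
      by (intro smooth_add(2) smooth_mult Suc.prems sB schwartz_smooth G')
    finally show ?thesis
      using norm_triangle_le[OF add_mono[OF C2[of n x] C1[of n x]]] by (simp add: add_divide_distrib add.commute)
  qed
  then show ?case by blast
qed

text \<open>A seminorm of the transform is bounded by an \<open>L^1\<close> norm of a derivative of
  the cut-off function. That derivative vanishes for \<open>\<bar>x\<bar> < n\<close> and has a
  majorant independent of \<open>n\<close>, so the norm tends to zero.\<close>

lemma fourier_cutoff_seminorm:
  assumes B: "\<And>n. smooth (B n)"
    and bB: "\<And>m. \<exists>C. \<forall>n x. norm (nth_vderiv m (B n) x :: complex) \<le> C"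
    and zero: "\<And>n x. \<bar>x\<bar> < real n \<Longrightarrow> B n x = 0"
    and g: "g \<in> schwartz"
  shows "(\<lambda>x. B n x * g x) \<in> schwartz"
    "(\<lambda>n. schwartz_seminorm j k (fourier (\<lambda>x. B n x * g x))) \<longlonglongrightarrow> 0"
proof -
  show Bg: "(\<lambda>x. B n x * g x) \<in> schwartz" for n
  proof (rule schwartz_mult_Cb[OF _ g])
    have "bounded (range (nth_vderiv m (B n)))" for m using bB[of m] by (auto simp: bounded_iff)
    then show "B n \<in> Cb_infinity" using B by (simp add: Cb_infinity_def)
  qed
  define G where "G = (\<lambda>x. (\<i> * of_real (-1) * of_real x) ^ k * g x)"
  have G: "G \<in> schwartz" unfolding G_def by (rule schwartz_power_mult[OF g])
  obtain C where C: "\<And>n x. norm (nth_vderiv j (\<lambda>x. B n x * G x) x) \<le> C / (1 + x\<^sup>2)"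
    using cutoff_family_bound[OF B bB G, of j] by blast
  have sBG: "smooth (\<lambda>x. B n x * G x)" for n by (intro smooth_mult B schwartz_smooth G)
  have cont: "(\<lambda>x. norm (nth_vderiv j (\<lambda>x. B n x * G x) x)) \<in> borel_measurable borel" for n
    using borel_measurable_continuous_onI[OF smooth_continuous[OF sBG[of n]]] by measurable
  have lim: "(\<lambda>n. LINT x|lborel. norm (nth_vderiv j (\<lambda>x. B n x * G x) x)) \<longlonglongrightarrow> (LINT x::real|lborel. 0)"
  proof (rule integral_dominated_convergence[where w="\<lambda>x. C / (1 + x\<^sup>2)"])
    show "AE x in lborel. (\<lambda>n. norm (nth_vderiv j (\<lambda>x. B n x * G x) x)) \<longlonglongrightarrow> 0"
    proof (intro AE_I2 tendsto_eventually)
      fix x :: real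
      obtain N :: nat where N: "\<bar>x\<bar> < real N" using reals_Archimedean2 by blast
      have "nth_vderiv j (\<lambda>x. B n x * G x) x = 0" if "n \<ge> N" for n
        using N that zero
        by (intro nth_vderiv_zero_open[OF sBG, of "{x. \<bar>x\<bar> < real n}"])
           (auto intro!: open_Collect_less continuous_intros)
      then show "\<forall>\<^sub>F n in sequentially. norm (nth_vderiv j (\<lambda>x. B n x * G x) x) = 0"
        by (auto simp: eventually_sequentially)
    qed
  qed (use C cont decay_integrable in auto)
  have le: "norm (schwartz_seminorm j k (fourier (\<lambda>x. B n x * g x))) \<le>
      norm (LINT x|lborel. norm (nth_vderiv j (\<lambda>x. B n x * G x) x)) * 1" for n
  proof -
    have "schwartz_seminorm j k (fourier (\<lambda>x. B n x * g x)) \<le> (LINT x|lborel. norm (nth_vderiv j (\<lambda>x. B n x * G x) x))"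
      unfolding schwartz_seminorm_def
    proof (rule cSUP_least)
      fix x
      have "(\<lambda>x. (\<i> * of_real (-1) * of_real x) ^ k * (B n x * g x)) = (\<lambda>x. B n x * G x)"
        by (auto simp: G_def)
      then show "\<bar>x\<bar> ^ j * norm (nth_vderiv k (fourier (\<lambda>x. B n x * g x)) x) \<le> (LINT x|lborel. norm (nth_vderiv j (\<lambda>x. B n x * G x) x))"
        using osc_int_seminorm_bound[OF Bg[of n], of "-1" x j k] unfolding fourier_osc by simp
    qed auto
    then show ?thesis using schwartz_seminorm_nonneg[OF fourier_schwartz[OF Bg], of j k n] by auto
  qed
  from lim have "(\<lambda>n. LINT x|lborel. norm (nth_vderiv j (\<lambda>x. B n x * G x) x)) \<longlonglongrightarrow> 0" by simp
  then show "(\<lambda>n. schwartz_seminorm j k (fourier (\<lambda>x. B n x * g x))) \<longlonglongrightarrow> 0"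
    by (rule tendsto_0_le[OF _ always_eventually[OF allI[OF le]]])
qed

locale window =
  fixes \<eta> :: "real \<Rightarrow> real"
  assumes win: "freq_window \<eta>"
begin

definition eta :: "int \<Rightarrow> real \<Rightarrow> complex" where
  "eta k \<xi> = of_real (\<eta> (\<xi> - of_int k))"

abbreviation blk :: "int \<Rightarrow> (real \<Rightarrow> complex) \<Rightarrow> real \<Rightarrow> complex" where
  "blk k \<equiv> fmult (eta k)"

text \<open>The norm on functions instead of distributions, with suprema over all points. Since
  blocks are continuous, these agree with the infima over representatives, see
  \<open>X_norm_reg_dist\<close>.\<close>

definition Xn :: "real \<Rightarrow> (real \<Rightarrow> complex) \<Rightarrow> ennreal" where
  "Xn s f = (\<Sum>\<^sub>\<infinity>k\<in>(UNIV :: int set). ennreal (japanese_bracket k powr s) * supn (blk k f))"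

section \<open>The partition of unity in frequency\<close>

lemma eta_smooth: "smooth \<eta>" and eta_even: "\<eta> (- x) = \<eta> x"
  and eta_sum: "((\<lambda>k::int. \<eta> (\<xi> - of_int k)) has_sum 1) UNIV"
  using win by (auto simp: freq_window_def)

lemma eta_zero: "\<bar>x\<bar> \<ge> 1 \<Longrightarrow> \<eta> x = 0"
  using win closure_subset[of "{\<xi>. \<eta> \<xi> \<noteq> 0}"] unfolding freq_window_def by fastforce

lemma eta_support: "eta k \<xi> \<noteq> 0 \<Longrightarrow> \<bar>\<xi> - of_int k\<bar> < 1"
  using eta_zero[of "\<xi> - of_int k"] by (force simp: eta_def)

lemma eta_shift_smooth: "smooth (\<lambda>\<xi>. eta k (\<xi> + \<zeta>))"
  "nth_vderiv m (\<lambda>\<xi>. eta k (\<xi> + \<zeta>)) = (\<lambda>\<xi>. of_real (nth_vderiv m \<eta> (\<xi> + (\<zeta> - of_int k))))"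
proof -
  have *: "(\<lambda>\<xi>. eta k (\<xi> + \<zeta>)) = (\<lambda>\<xi>. complex_of_real (\<eta> (1 * \<xi> + (\<zeta> - of_int k))))"
    by (auto simp: eta_def algebra_simps)
  show "smooth (\<lambda>\<xi>. eta k (\<xi> + \<zeta>))" unfolding * by (intro smooth_of_real smooth_affine eta_smooth)
  show "nth_vderiv m (\<lambda>\<xi>. eta k (\<xi> + \<zeta>)) = (\<lambda>\<xi>. of_real (nth_vderiv m \<eta> (\<xi> + (\<zeta> - of_int k))))"
    unfolding * smooth_of_real(2)[OF smooth_affine(1)[OF eta_smooth]] smooth_affine(2)[OF eta_smooth] by simp
qed

lemma eta_shift_schwartz: "(\<lambda>\<xi>. eta k (\<xi> + \<zeta>)) \<in> schwartz"
proof (rule smooth_compact_schwartz[OF eta_shift_smooth(1)])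
  fix \<xi> assume "\<bar>\<xi>\<bar> > 1 + \<bar>\<zeta>\<bar> + \<bar>of_int k\<bar>"
  then show "eta k (\<xi> + \<zeta>) = 0" using eta_support[of k "\<xi> + \<zeta>"] by argo
qed

lemma eta_schwartz: "eta k \<in> schwartz"
  using eta_shift_schwartz[of k 0] by simp

lemma eta_partition:
  assumes "finite I" "\<And>k. \<bar>\<xi> - of_int k\<bar> < 1 \<Longrightarrow> k \<in> I"
  shows "(\<Sum>k\<in>I. eta k \<xi>) = 1"
proof -
  have "((\<lambda>k::int. \<eta> (\<xi> - of_int k)) has_sum 1) I"
    by (rule has_sum_cong_neutral[THEN iffD1, OF _ _ _ eta_sum[of \<xi>]])
       (use assms eta_zero in force)+
  then have "(\<Sum>k\<in>I. \<eta> (\<xi> - of_int k)) = 1"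
    using assms(1) by (simp add: has_sum_finite_iff)
  then show ?thesis unfolding eta_def by (metis of_real_1 of_real_sum)
qed

definition low :: "nat \<Rightarrow> real \<Rightarrow> complex" where
  "low n \<xi> = (\<Sum>k\<in>{- int n..int n}. eta k \<xi>)"

lemma low_schwartz: "low n \<in> schwartz"
  unfolding low_def[abs_def] by (intro schwartz_sum eta_schwartz)

text \<open>A window seen at \<open>\<xi>\<close> satisfies \<open>\<bar>k\<bar> < n + 1\<close>,
  hence \<open>\<bar>k\<bar> \<le> n\<close>, so none is missing even at the endpoints.\<close>

lemma low_eq_1: "\<bar>\<xi>\<bar> \<le> real n \<Longrightarrow> low n \<xi> = 1"
  unfolding low_def by (rule eta_partition) auto

text \<open>Bounded overlap. The distance condition is not strict because it is applied to
  derivatives of the window, for which \<open>nth_vderiv_eta_support\<close> gives the closed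
  interval; 4 counts a range of integers that contains all relevant indices.\<close>

lemma sum_local_bound:
  fixes \<xi> C :: real
  assumes "finite I" "\<And>k::int. 0 \<le> F k" "\<And>k. F k \<le> C" "\<And>k. F k \<noteq> 0 \<Longrightarrow> \<bar>\<xi> - of_int k\<bar> \<le> 1"
  shows "(\<Sum>k\<in>I. F k) \<le> 4 * C"
proof -
  let ?J = "{\<lfloor>\<xi>\<rfloor> - 1..\<lfloor>\<xi>\<rfloor> + 2}"
  have "(\<Sum>k\<in>I. F k) = (\<Sum>k\<in>I \<inter> ?J. F k)"
  proof (rule sum.mono_neutral_right[OF assms(1)])
    show "\<forall>i\<in>I - I \<inter> ?J. F i = 0"
    proof
      fix i assume i: "i \<in> I - I \<inter> ?J"
      show "F i = 0"
      proof (rule ccontr)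
        assume "F i \<noteq> 0"
        then have "\<bar>\<xi> - of_int i\<bar> \<le> 1" by (rule assms)
        then have "i \<in> ?J" by (auto; linarith)
        with i show False by auto
      qed
    qed
  qed auto
  also have "\<dots> \<le> (\<Sum>k\<in>?J. F k)" by (intro sum_mono2) (auto simp: assms)
  also have "\<dots> \<le> of_nat (card ?J) * C" by (intro sum_bounded_above assms)
  finally show ?thesis by simp
qed

lemma nth_vderiv_eta_support: "nth_vderiv m \<eta> x \<noteq> 0 \<Longrightarrow> \<bar>x\<bar> \<le> 1"
proof (rule ccontr)
  assume a: "nth_vderiv m \<eta> x \<noteq> 0" "\<not> \<bar>x\<bar> \<le> 1"
  have "nth_vderiv m \<eta> x = 0"
  proof (rule nth_vderiv_zero_open[OF eta_smooth, of "{x. \<bar>x\<bar> > 1}"])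
    show "open {x::real. \<bar>x\<bar> > 1}" by (intro open_Collect_less continuous_intros)
  qed (use a eta_zero in auto)
  with a show False by simp
qed

text \<open>Bounded overlap makes the derivatives of the cut-off bounded uniformly in
  \<open>n\<close>, the form required by \<open>fourier_cutoff_seminorm\<close>.\<close>

lemma high_family:
  "smooth (\<lambda>\<xi>. 1 - low n \<xi>)"
  "\<exists>C. \<forall>n x. norm (nth_vderiv m (\<lambda>\<xi>. 1 - low n \<xi>) x) \<le> C"
proof -
  have sm: "smooth (low n)" for n by (rule schwartz_smooth[OF low_schwartz])
  have eq: "(\<lambda>\<xi>. 1 - low n \<xi>) = (\<lambda>\<xi>. 1 + - 1 * low n \<xi>)" for n by auto
  show "smooth (\<lambda>\<xi>. 1 - low n \<xi>)" unfolding eq by (intro smooth_add smooth_mult smooth_const sm)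
  have der: "nth_vderiv m (low n) = (\<lambda>x. \<Sum>k\<in>{- int n..int n}. of_real (nth_vderiv m \<eta> (x - of_int k)))" for n
    using smooth_sum[of "{- int n..int n}" eta] schwartz_smooth[OF eta_schwartz] eta_shift_smooth(2)[of m _ 0]
    by (simp add: low_def[abs_def])
  obtain C where C: "\<And>x. norm (nth_vderiv m (eta 0) x) \<le> C" "C \<ge> 0"
    using rapidE[OF schwartz_rapid[OF schwartz_nth_vderiv[OF eta_schwartz]], of 0] by auto
  then have C': "\<bar>nth_vderiv m \<eta> x\<bar> \<le> C" for x using eta_shift_smooth(2)[of m 0 0] by (simp add: fun_eq_iff)
  have "norm (nth_vderiv m (\<lambda>\<xi>. 1 - low n \<xi>) x) \<le> 1 + 4 * C" for n x
  proof -
    have sm1: "smooth (\<lambda>\<xi>. - 1 * low n \<xi>)" by (intro smooth_mult smooth_const sm)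
    have nn: "nth_vderiv m (\<lambda>\<xi>. - 1 * low n \<xi>) x = - nth_vderiv m (low n) x"
    proof -
      let ?D = "\<lambda>k x. - 1 * nth_vderiv k (low n) x"
      have D: "(?D k has_vector_derivative ?D (Suc k) x) (at x)" for k x
        by (intro has_vector_derivative_mult_right smooth_has_vderiv sm)
      from nth_vderiv_unique[of ?D, OF D] show ?thesis by simp
    qed
    have "norm (nth_vderiv m (low n) x) \<le> (\<Sum>k\<in>{- int n..int n}. \<bar>nth_vderiv m \<eta> (x - of_int k)\<bar>)"
      unfolding der by (rule order.trans[OF norm_sum]) simp
    also have "\<dots> \<le> 4 * C"
      by (rule sum_local_bound[where \<xi>=x]) (use C' nth_vderiv_eta_support in auto)
    finally have 1: "norm (nth_vderiv m (low n) x) \<le> 4 * C" .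
    have "nth_vderiv m (\<lambda>\<xi>. 1 - low n \<xi>) x = (if m = 0 then 1 else 0) + - nth_vderiv m (low n) x"
      unfolding eq smooth_add(2)[OF smooth_const sm1] nn nth_vderiv_const by simp
    also have "norm \<dots> \<le> 1 + 4 * C" by (rule norm_triangle_le) (use 1 in auto)
    finally show ?thesis .
  qed
  then show "\<exists>C. \<forall>n x. norm (nth_vderiv m (\<lambda>\<xi>. 1 - low n \<xi>) x) \<le> C" by blast
qed

lemma freq_block_eq:
  "freq_block \<eta> k S \<phi> = (if \<phi> \<in> schwartz then S (fourier (\<lambda>\<xi>. eta k \<xi> * inv_fourier \<phi> \<xi>)) else 0)"
  using schwartz_mult[OF eta_schwartz inv_fourier_schwartz, of \<phi> k] inv_fourier_schwartz[of \<phi>]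
  by (auto simp: freq_block_def dist_inv_fourier_def dist_mult_def dist_fourier_def eta_def)

lemma freq_block_reg_dist: "f \<in> bdm \<Longrightarrow> freq_block \<eta> k (reg_dist f) = reg_dist (blk k f)"
  using fourier_mult_pairing[OF eta_schwartz, of _ f k]
  by (rule_tac ext) (auto simp: freq_block_eq reg_dist_def
      intro!: fourier_schwartz schwartz_mult eta_schwartz inv_fourier_schwartz)

text \<open>The remainder is \<open>S\<close> tested against the transform of
  \<open>1 - low n\<close> times the inverse transform of \<open>\<phi>\<close>. These test
  functions tend to zero in every seminorm, and \<open>S\<close> is continuous.\<close>

lemma freq_blocks_sum:
  assumes S: "S \<in> tempered" and \<phi>: "\<phi> \<in> schwartz"
  shows "(\<lambda>n. \<Sum>k\<in>{- int n..int n}. freq_block \<eta> k S \<phi>) \<longlonglongrightarrow> S \<phi>"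
proof -
  let ?g = "inv_fourier \<phi>"
  have g: "?g \<in> schwartz" by (rule inv_fourier_schwartz[OF \<phi>])
  have eg: "(\<lambda>\<xi>. eta k \<xi> * ?g \<xi>) \<in> schwartz" for k by (intro schwartz_mult eta_schwartz g)
  have zero: "1 - low n x = 0" if "\<bar>x\<bar> < real n" for n x using low_eq_1[of x n] that by simp
  let ?\<psi> = "\<lambda>n. fourier (\<lambda>x. (1 - low n x) * ?g x)"
  note cut = fourier_cutoff_seminorm[OF high_family zero g]
  have \<psi>: "?\<psi> n \<in> schwartz" for n by (rule fourier_schwartz[OF cut(1)])
  have "(\<lambda>n. S (?\<psi> n)) \<longlonglongrightarrow> 0"
    by (rule tempered_continuous[OF S \<psi> cut(2)])
  moreover have "S (?\<psi> n) = S \<phi> - (\<Sum>k\<in>{- int n..int n}. freq_block \<eta> k S \<phi>)" for n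
  proof -
    have "?\<psi> n x = \<phi> x - (\<Sum>k\<in>{- int n..int n}. fourier (\<lambda>\<xi>. eta k \<xi> * ?g \<xi>) x)" for x
    proof -
      have "?\<psi> n x = (LINT y|lborel. cis (-1 * y * x) * ?g y - (\<Sum>k\<in>{- int n..int n}. cis (-1 * y * x) * (eta k y * ?g y)))"
        unfolding fourier_osc osc_int_def
        by (intro Bochner_Integration.integral_cong refl)
           (simp add: low_def left_diff_distrib right_diff_distrib sum_distrib_left sum_distrib_right mult_ac)
      also have "\<dots> = fourier ?g x - (\<Sum>k\<in>{- int n..int n}. fourier (\<lambda>\<xi>. eta k \<xi> * ?g \<xi>) x)"
        unfolding fourier_osc osc_int_def
        using cis_mult_integrable[OF schwartz_integrable[OF g], of "-1" x] cis_mult_integrable[OF schwartz_integrable[OF eg], of "-1" x]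
        by (subst Bochner_Integration.integral_diff)
           (auto intro!: Bochner_Integration.integrable_sum simp: Bochner_Integration.integral_sum)
      finally show ?thesis by (simp add: fourier_inv_fourier[OF \<phi>])
    qed
    then have "?\<psi> n = (\<lambda>x. \<phi> x - (\<Sum>k\<in>{- int n..int n}. fourier (\<lambda>\<xi>. eta k \<xi> * ?g \<xi>) x))" by blast
    then have "S (?\<psi> n) = S \<phi> - S (\<lambda>x. \<Sum>k\<in>{- int n..int n}. fourier (\<lambda>\<xi>. eta k \<xi> * ?g \<xi>) x)"
      by (simp add: tempered_linear(3)[OF S \<phi>] schwartz_sum fourier_schwartz[OF eg])
    also have "S (\<lambda>x. \<Sum>k\<in>{- int n..int n}. fourier (\<lambda>\<xi>. eta k \<xi> * ?g \<xi>) x) =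
        (\<Sum>k\<in>{- int n..int n}. S (fourier (\<lambda>\<xi>. eta k \<xi> * ?g \<xi>)))"
      by (intro tempered_sum S fourier_schwartz eg)
    finally show ?thesis using \<phi> by (simp add: freq_block_eq)
  qed
  ultimately have "(\<lambda>n. S \<phi> - (\<Sum>k\<in>{- int n..int n}. freq_block \<eta> k S \<phi>)) \<longlonglongrightarrow> 0" by simp
  from tendsto_diff[OF tendsto_const[of "S \<phi>"] this] show ?thesis by simp
qed

end

section \<open>Continuous representatives\<close>

lemma bracket_ge_1: "japanese_bracket k \<ge> 1"
  by (simp add: japanese_bracket_def)

lemma bracket_powr_ge_1: "s \<ge> 0 \<Longrightarrow> japanese_bracket k powr s \<ge> 1"
  using bracket_ge_1[of k] by (simp add: ge_one_powr_ge_zero)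

lemma infsum_mono_ennreal':
  fixes f g :: "'a \<Rightarrow> ennreal"
  assumes "\<And>k. k \<in> A \<Longrightarrow> f k \<le> g k" shows "infsum f A \<le> infsum g A"
  by (rule infsum_ennreal_le)
     (meson assms order.trans sum_le_infsum_ennreal sum_mono subsetD)

lemma series_uniform:
  fixes f :: "int \<Rightarrow> real \<Rightarrow> complex"
  assumes f: "\<And>k. f k \<in> bdm" and le: "\<And>k x. norm (f k x) \<le> c k" and c: "c summable_on UNIV"
  defines "F \<equiv> \<lambda>x. \<Sum>\<^sub>\<infinity>k. f k x"
  shows "uniform_limit UNIV (\<lambda>n x. \<Sum>k\<in>{- int n..int n}. f k x) F sequentially"
    and "norm (\<Sum>k\<in>I. f k x) \<le> infsum c UNIV"
    and "norm (F x) \<le> infsum c UNIV"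
    and "F \<in> bdm"
    and "(\<And>k. continuous_on UNIV (f k)) \<Longrightarrow> continuous_on UNIV F"
proof -
  have c0: "0 \<le> c k" for k using le[of k 0] norm_ge_zero order.trans by blast
  have "uniform_limit UNIV (\<lambda>X x. \<Sum>k\<in>X. f k x) F (finite_subsets_at_top UNIV)"
    unfolding F_def by (rule Weierstrass_m_test_general[OF le c])
  then show U: "uniform_limit UNIV (\<lambda>n x. \<Sum>k\<in>{- int n..int n}. f k x) F sequentially"
    using filterlim_compose[OF _ filterlim_symmetric_intervals] by blast
  show S: "norm (\<Sum>k\<in>I. f k x) \<le> infsum c UNIV" for I x
  proof (cases "finite I")
    case True
    have "norm (\<Sum>k\<in>I. f k x) \<le> (\<Sum>k\<in>I. c k)" by (rule order.trans[OF norm_sum]) (intro sum_mono le)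
    also have "\<dots> \<le> infsum c UNIV" using True c0 by (intro finite_sum_le_infsum c) auto
    finally show ?thesis .
  qed (use c0 in \<open>auto intro: infsum_nonneg\<close>)
  have L: "(\<lambda>n. \<Sum>k\<in>{- int n..int n}. f k x) \<longlonglongrightarrow> F x" for x
    using tendsto_uniform_limitI[OF U] by simp
  show B: "norm (F x) \<le> infsum c UNIV" for x
    by (rule Lim_bounded[OF tendsto_norm[OF L[of x]], of 0]) (use S in auto)
  have "F \<in> borel_measurable borel"
    by (rule borel_measurable_LIMSEQ_metric[OF _ L]) (use f in \<open>auto intro!: borel_measurable_sum bdm_borel\<close>)
  then show "F \<in> bdm" by (rule bdmI[OF _ B])
  show "continuous_on UNIV F" if "\<And>k. continuous_on UNIV (f k)"
    by (rule uniform_limit_theorem[OF _ U]) (use that in \<open>auto intro!: always_eventually continuous_on_sum\<close>)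
qed

context window
begin

text \<open>The window supplies a smooth compactly supported function, but it may change sign. Its
  square is nonnegative, and dividing by the mass \<open>mollc\<close> makes the rescaled squares
  \<open>moll\<close> an approximate identity.\<close>

definition mollc :: real where "mollc = (LINT y|lborel. (\<eta> y)\<^sup>2)"

definition moll :: "nat \<Rightarrow> real \<Rightarrow> real \<Rightarrow> real" where
  "moll n x y = (real (Suc n) / mollc) * (\<eta> (real (Suc n) * (y - x)))\<^sup>2"

lemma eta_sq_integrable: "integrable lborel (\<lambda>y. (\<eta> y)\<^sup>2)"
  using integrable_norm[OF schwartz_integrable[OF schwartz_mult[OF eta_schwartz[of 0] eta_schwartz[of 0]]]]
  by (simp add: eta_def norm_mult power2_eq_square)

text \<open>A window vanishing everywhere could not sum to 1; by continuity its square is bounded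
  below near a point where it does not vanish.\<close>

lemma mollc_pos: "mollc > 0"
proof -
  have "\<exists>x0. \<eta> x0 \<noteq> 0"
  proof (rule ccontr)
    assume "\<not> ?thesis"
    then have "((\<lambda>k::int. \<eta> (0 - of_int k)) has_sum 0) UNIV" by (intro has_sum_0) auto
    with eta_sum[of 0] show False using has_sum_unique by fastforce
  qed
  then obtain x0 where x0: "\<eta> x0 \<noteq> 0" by blast
  have cont: "continuous_on UNIV (\<lambda>y. (\<eta> y)\<^sup>2)"
    using smooth_continuous[OF eta_smooth, of UNIV 0] by (auto intro!: continuous_intros)
  let ?d = "(\<eta> x0)\<^sup>2 / 2"
  have d: "?d > 0" using x0 by simp
  then obtain e where e: "e > 0" "\<And>y. dist y x0 < e \<Longrightarrow> dist ((\<eta> y)\<^sup>2) ((\<eta> x0)\<^sup>2) < ?d"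
    using cont unfolding continuous_on_iff by (metis UNIV_I)
  have "0 < ?d * (2 * e)" using d e by simp
  also have "\<dots> = (LINT y|lborel. ?d * indicator {x0 - e<..<x0 + e} y)"
    using e by simp
  also have "\<dots> \<le> (LINT y|lborel. (\<eta> y)\<^sup>2)"
  proof (rule integral_mono)
    fix y
    show "?d * indicator {x0 - e<..<x0 + e} y \<le> (\<eta> y)\<^sup>2"
    proof (cases "y \<in> {x0 - e<..<x0 + e}")
      case True
      then have "dist y x0 < e" by (auto simp: dist_real_def)
      from e(2)[OF this] have "(\<eta> y)\<^sup>2 \<ge> ?d" unfolding dist_real_def by argo
      then show ?thesis using True by simp
    qed simp
    show "integrable lborel (\<lambda>y. ?d * indicator {x0 - e<..<x0 + e} y)"
      by (intro integrable_mult_right integrable_real_indicator) (use e in auto)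
  qed (rule eta_sq_integrable)
  finally show ?thesis by (simp add: mollc_def)
qed

lemma moll_nonneg: "moll n x y \<ge> 0"
  using mollc_pos by (simp add: moll_def)

lemma moll_support: "moll n x y \<noteq> 0 \<Longrightarrow> \<bar>y - x\<bar> < 1 / real (Suc n)"
proof -
  assume "moll n x y \<noteq> 0"
  then have "\<not> \<bar>real (Suc n) * (y - x)\<bar> \<ge> 1" using eta_zero[of "real (Suc n) * (y - x)"] by (auto simp: moll_def)
  then have "real (Suc n) * \<bar>y - x\<bar> < 1" by (simp only: abs_mult abs_of_nat not_le)
  then show ?thesis by (simp only: less_divide_eq of_nat_0_less_iff zero_less_Suc if_True mult.commute)
qed

lemma moll_schwartz: "(\<lambda>y. complex_of_real (moll n x y)) \<in> schwartz"
proof -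
  have *: "(\<lambda>y. complex_of_real (moll n x y)) =
     (\<lambda>y. complex_of_real (real (Suc n) / mollc) *
       (complex_of_real (\<eta> (real (Suc n) * y + - real (Suc n) * x)) * complex_of_real (\<eta> (real (Suc n) * y + - real (Suc n) * x))))"
    by (rule ext) (simp add: moll_def power2_eq_square algebra_simps)
  have "smooth (\<lambda>y. complex_of_real (moll n x y))"
    unfolding * by (intro smooth_mult smooth_const smooth_of_real smooth_affine eta_smooth)
  then show ?thesis
  proof (rule smooth_compact_schwartz)
    fix y assume y: "\<bar>y\<bar> > \<bar>x\<bar> + 1"
    have "1 / real (Suc n) \<le> 1" by simp
    then have "moll n x y = 0" using moll_support[of n x y] y by linarith
    then show "complex_of_real (moll n x y) = 0" by simp
  qed
qed

lemma moll_integrable: "integrable lborel (moll n x)"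
  using integrable_norm[OF schwartz_integrable[OF moll_schwartz[of n x]]] moll_nonneg[of n x] by simp

lemma moll_integral: "(LINT y|lborel. moll n x y) = 1"
proof -
  have "(LINT y|lborel. moll n x y) = (1 / real (Suc n)) *\<^sub>R (LINT z|lborel. moll n x (x + (1 / real (Suc n)) * z))"
    by (subst lborel_integral_real_affine[of "1 / real (Suc n)" _ x]) auto
  also have "(\<lambda>z. moll n x (x + (1 / real (Suc n)) * z)) = (\<lambda>z. (real (Suc n) / mollc) * (\<eta> z)\<^sup>2)"
    by (simp add: moll_def)
  finally show ?thesis using mollc_pos by (simp add: mollc_def)
qed

lemma moll_limit:
  assumes u: "continuous_on UNIV (u :: real \<Rightarrow> complex)"
  shows "(\<lambda>n. LINT y|lborel. u y * of_real (moll n x y)) \<longlonglongrightarrow> u x"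
proof (rule LIMSEQ_I)
  fix e :: real assume e: "e > 0"
  then obtain d where d: "d > 0" "\<And>y. dist y x < d \<Longrightarrow> dist (u y) (u x) < e / 2"
    using u unfolding continuous_on_iff by (metis UNIV_I half_gt_zero)
  obtain N where N: "1 / real (Suc N) < d" using nat_approx_posE[OF d(1)] by blast
  have int1: "integrable lborel (\<lambda>y. u y * of_real (moll n x y))" for n
  proof -
    \<comment> \<open>The mollifiers live within distance 1 of \<open>x\<close>, so compactness
      replaces a global bound for \<open>u\<close>.\<close>
    have "bounded (u ` {x - 1..x + 1})"
      by (intro compact_imp_bounded compact_continuous_image continuous_on_subset[OF u]) auto
    then obtain M where M: "\<And>y. y \<in> {x - 1..x + 1} \<Longrightarrow> norm (u y) \<le> M" unfolding bounded_iff by blast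
    show ?thesis
    proof (rule Bochner_Integration.integrable_bound[OF integrable_mult_right[OF moll_integrable[of n x], of M]])
      show "(\<lambda>y. u y * complex_of_real (moll n x y)) \<in> borel_measurable lborel"
        using borel_measurable_continuous_onI[OF u] schwartz_borel[OF moll_schwartz[of n x]] by simp
      have "norm (u y * of_real (moll n x y)) \<le> norm (M * moll n x y)" for y
      proof (cases "moll n x y = 0")
        case False
        have "1 / real (Suc n) \<le> 1" by simp
        with moll_support[OF False] have "\<bar>y - x\<bar> \<le> 1" by linarith
        then have "y \<in> {x - 1..x + 1}" by (auto simp: abs_le_iff)
        from M[OF this] show ?thesis using moll_nonneg[of n x y]
          by (auto simp: norm_mult abs_mult intro!: mult_right_mono)
      qed simp
      then show "AE y in lborel. norm (u y * complex_of_real (moll n x y)) \<le> norm (M * moll n x y)" by simp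
    qed
  qed
  have mi: "integrable lborel (\<lambda>y. complex_of_real (moll n x y))" for n by (intro schwartz_integrable moll_schwartz)
  have "norm ((LINT y|lborel. u y * of_real (moll n x y)) - u x) < e" if n: "n \<ge> N" for n
  proof -
    have "(LINT y|lborel. complex_of_real (moll n x y)) = 1"
      using moll_integral[of n x] by simp
    then have "(LINT y|lborel. u y * of_real (moll n x y)) - u x =
        (LINT y|lborel. (u y - u x) * of_real (moll n x y))"
      using int1[of n] mi[of n] by (simp add: left_diff_distrib)
    also have "norm \<dots> \<le> (LINT y|lborel. norm ((u y - u x) * of_real (moll n x y)))" by (rule integral_norm_bound)
    also have "\<dots> \<le> (LINT y|lborel. (e / 2) * moll n x y)"
    proof (rule integral_mono)
      show "integrable lborel (\<lambda>y. norm ((u y - u x) * of_real (moll n x y)))"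
        using int1[of n] mi[of n] by (simp add: left_diff_distrib)
      fix y
      show "norm ((u y - u x) * of_real (moll n x y)) \<le> (e / 2) * moll n x y"
      proof (cases "moll n x y = 0")
        case False
        have "1 / real (Suc n) \<le> 1 / real (Suc N)" using n by (simp add: frac_le)
        with moll_support[OF False] N have "dist y x < d" by (simp add: dist_real_def)
        from d(2)[OF this] have "norm (u y - u x) \<le> e / 2" by (simp add: dist_norm)
        then have "norm (u y - u x) * moll n x y \<le> (e / 2) * moll n x y"
          by (rule mult_right_mono) (rule moll_nonneg)
        then show ?thesis using moll_nonneg[of n x y] by (simp add: norm_mult)
      qed simp
    qed (use moll_integrable in auto)
    also have "\<dots> = e / 2" using moll_integral[of n x] by simp
    finally show ?thesis using e by simp
  qed
  then show "\<exists>N. \<forall>n\<ge>N. norm ((LINT y|lborel. u y * of_real (moll n x y)) - u x) < e" by blast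
qed

lemma reg_dist_moll: "reg_dist f (\<lambda>y. of_real (moll n x y)) = (LINT y|lborel. f y * of_real (moll n x y))"
  by (simp add: reg_dist_def moll_schwartz)

lemma reg_dist_inj:
  assumes "continuous_on UNIV u" "continuous_on UNIV v" "reg_dist u = reg_dist v"
  shows "u = v"
proof (rule ext)
  fix x
  have "(\<lambda>n. LINT y|lborel. u y * of_real (moll n x y)) = (\<lambda>n. LINT y|lborel. v y * of_real (moll n x y))"
    using assms(3) by (simp flip: reg_dist_moll)
  then show "u x = v x" using moll_limit[OF assms(1), of x] moll_limit[OF assms(2), of x] LIMSEQ_unique by metis
qed

text \<open>Every representative \<open>f\<close> has the same averages against the mollifiers as
  \<open>g\<close>; they are at most the supremum of \<open>f\<close>, and they converge to the
  values of \<open>g\<close>. Hence the continuous representative attains the infimum.\<close>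

lemma Linf_norm_reg_dist:
  assumes g: "continuous_on UNIV g" shows "Linf_norm (reg_dist g) = supn g"
proof (rule antisym)
  show "Linf_norm (reg_dist g) \<le> supn g"
    unfolding Linf_norm_def supn_def
    by (rule INF_lower) (simp add: borel_measurable_continuous_onI[OF g])
  show "supn g \<le> Linf_norm (reg_dist g)"
    unfolding Linf_norm_def supn_def[symmetric]
  proof (rule INF_greatest)
    fix f assume f: "f \<in> {f \<in> borel_measurable borel. reg_dist f = reg_dist g}"
    show "supn g \<le> supn f"
    proof (cases "supn f = \<infinity>")
      case False
      define M where "M = enn2real (supn f)"
      have sM: "supn f = ennreal M" using False by (simp add: M_def ennreal_enn2real top.not_eq_extremum)
      have M: "norm (f x) \<le> M" for x
        using enn2real_mono[of "ennreal (norm (f x))" "supn f"] supn_upper[of f x] False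
        by (simp add: M_def top.not_eq_extremum)
      have fb: "f \<in> bdm" using f M by (auto intro!: bdmI)
      have "norm (g x) \<le> M" for x
      proof (rule Lim_bounded[OF tendsto_norm[OF moll_limit[OF g, of x]], of 0], intro allI impI)
        fix n
        have "(LINT y|lborel. g y * of_real (moll n x y)) = (LINT y|lborel. f y * of_real (moll n x y))"
          using f by (simp flip: reg_dist_moll)
        also have "norm \<dots> \<le> (LINT y|lborel. norm (f y * of_real (moll n x y)))" by (rule integral_norm_bound)
        also have "\<dots> \<le> (LINT y|lborel. M * moll n x y)"
          by (intro integral_mono integrable_norm bdm_mult_schwartz_integrable fb moll_schwartz integrable_mult_right moll_integrable)
             (use M moll_nonneg in \<open>simp add: norm_mult mult_right_mono\<close>)
        also have "\<dots> = M" by (simp add: moll_integral)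
        finally show "norm (LINT y|lborel. g y * of_real (moll n x y)) \<le> M" .
      qed
      then show ?thesis unfolding sM by (rule supn_least)
    qed simp
  qed
qed

lemma X_norm_reg_dist: "f \<in> bdm \<Longrightarrow> X_norm \<eta> s (reg_dist f) = Xn s f"
  by (simp add: X_norm_def Xn_def freq_block_reg_dist Linf_norm_reg_dist fmult_continuous eta_schwartz)

text \<open>The block sums converge to \<open>S\<close> as distributions and, by the summable
  bounds, also pointwise under an integrable majorant. Pairing with a test function identifies the
  two limits.\<close>

lemma dist_series:
  assumes S: "S \<in> tempered" and blocks: "\<And>k. freq_block \<eta> k S = reg_dist (f k)"
    and f: "\<And>k. f k \<in> bdm" and le: "\<And>k x. norm (f k x) \<le> c k" and c: "c summable_on UNIV"
  shows "S = reg_dist (\<lambda>x. \<Sum>\<^sub>\<infinity>k. f k x)"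
proof (rule ext)
  fix \<phi>
  let ?F = "\<lambda>x. \<Sum>\<^sub>\<infinity>k. f k x"
  note su = series_uniform[of f c, OF f le c]
  show "S \<phi> = reg_dist ?F \<phi>"
  proof (cases "\<phi> \<in> schwartz")
    case True
    have "(\<lambda>n. LINT x|lborel. (\<Sum>k\<in>{- int n..int n}. f k x) * \<phi> x) \<longlonglongrightarrow> (LINT x|lborel. ?F x * \<phi> x)"
    proof (rule integral_dominated_convergence[where w="\<lambda>x. infsum c UNIV * norm (\<phi> x)"])
      show "integrable lborel (\<lambda>x. infsum c UNIV * norm (\<phi> x))"
        by (intro integrable_mult_right integrable_norm schwartz_integrable True)
      show "AE x in lborel. norm ((\<Sum>k\<in>{- int n..int n}. f k x) * \<phi> x) \<le> infsum c UNIV * norm (\<phi> x)" for n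
        using su(2) by (auto simp: norm_mult intro!: mult_right_mono)
      show "AE x in lborel. (\<lambda>n. (\<Sum>k\<in>{- int n..int n}. f k x) * \<phi> x) \<longlonglongrightarrow> ?F x * \<phi> x"
        by (intro AE_I2 tendsto_mult tendsto_const tendsto_uniform_limitI[OF su(1)] UNIV_I)
      show "(\<lambda>x. ?F x * \<phi> x) \<in> borel_measurable lborel"
        using bdm_borel[OF su(4)] schwartz_borel[OF True] by simp
      show "(\<lambda>x. (\<Sum>k\<in>{- int n..int n}. f k x) * \<phi> x) \<in> borel_measurable lborel" for n
        using bdm_borel[OF f] schwartz_borel[OF True] by simp
    qed
    moreover have "(LINT x|lborel. (\<Sum>k\<in>{- int n..int n}. f k x) * \<phi> x) = (\<Sum>k\<in>{- int n..int n}. freq_block \<eta> k S \<phi>)" for n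
      using True reg_dist_sum[of "{- int n..int n}" f \<phi>] f by (simp add: blocks reg_dist_def)
    ultimately show ?thesis
      using LIMSEQ_unique[OF freq_blocks_sum[OF S True]] True by (simp add: reg_dist_def)
  next
    case False
    then show ?thesis using S by (simp add: tempered_def reg_dist_def)
  qed
qed

section \<open>Block series of functions\<close>

lemma supn_blk_sum_le: "s \<ge> 0 \<Longrightarrow> (\<Sum>\<^sub>\<infinity>k. supn (blk k f)) \<le> Xn s f"
  unfolding Xn_def
proof (rule infsum_mono_ennreal')
  fix k assume "s \<ge> 0"
  have "1 * supn (blk k f) \<le> ennreal (japanese_bracket k powr s) * supn (blk k f)"
    by (intro mult_right_mono) (use bracket_powr_ge_1[OF \<open>s \<ge> 0\<close>] in auto)
  then show "supn (blk k f) \<le> ennreal (japanese_bracket k powr s) * supn (blk k f)" by simp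
qed

lemma blk_bdm: "f \<in> bdm \<Longrightarrow> blk k f \<in> bdm"
  by (intro fmult_bdm eta_schwartz)

lemma blk_summable:
  assumes "f \<in> bdm" "Xn s f < \<infinity>" "s \<ge> 0"
  shows "(\<lambda>k. enn2real (supn (blk k f))) summable_on UNIV"
    "(\<Sum>\<^sub>\<infinity>k. supn (blk k f)) = ennreal (\<Sum>\<^sub>\<infinity>k. enn2real (supn (blk k f)))"
proof -
  have "(\<Sum>\<^sub>\<infinity>k. supn (blk k f)) < \<infinity>" using supn_blk_sum_le[OF assms(3)] assms(2) by (rule le_less_trans)
  moreover have "supn (blk k f) = ennreal (enn2real (supn (blk k f)))" for k
    by (intro supn_eq_ennreal blk_bdm assms)
  ultimately show "(\<lambda>k. enn2real (supn (blk k f))) summable_on UNIV"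
    "(\<Sum>\<^sub>\<infinity>k. supn (blk k f)) = ennreal (\<Sum>\<^sub>\<infinity>k. enn2real (supn (blk k f)))"
    using summable_on_ennreal[of "\<lambda>k. enn2real (supn (blk k f))" UNIV] by auto
qed

text \<open>The sum of the blocks is continuous and defines the same distribution as
  \<open>f\<close>, so \<open>reg_dist_inj\<close> turns this into equality at every point.\<close>

lemma blk_series:
  assumes f: "f \<in> bdm" "continuous_on UNIV f" and X: "Xn s f < \<infinity>" "s \<ge> 0"
  shows "uniform_limit UNIV (\<lambda>n x. \<Sum>k\<in>{- int n..int n}. blk k f x) f sequentially"
    and "supn f \<le> Xn s f"
proof -
  let ?c = "\<lambda>k. enn2real (supn (blk k f))"
  have le: "norm (blk k f x) \<le> ?c k" for k x by (intro norm_le_supn blk_bdm f)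
  note c = blk_summable[OF f(1) X]
  note su = series_uniform[of "\<lambda>k. blk k f" ?c, OF blk_bdm[OF f(1)] le c(1)]
  have "reg_dist f = reg_dist (\<lambda>x. \<Sum>\<^sub>\<infinity>k. blk k f x)"
    by (rule dist_series[OF reg_dist_tempered[OF f(1)] freq_block_reg_dist[OF f(1)] blk_bdm[OF f(1)] le c(1)])
  then have eq: "(\<lambda>x. \<Sum>\<^sub>\<infinity>k. blk k f x) = f"
    by (intro reg_dist_inj[symmetric] f su(5) fmult_continuous eta_schwartz) auto
  show "uniform_limit UNIV (\<lambda>n x. \<Sum>k\<in>{- int n..int n}. blk k f x) f sequentially"
    using su(1) unfolding eq .
  have "supn f \<le> ennreal (infsum ?c UNIV)" using su(3) unfolding fun_cong[OF eq] by (rule supn_least)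
  also have "\<dots> \<le> Xn s f" using supn_blk_sum_le[OF X(2), of f] c(2) by simp
  finally show "supn f \<le> Xn s f" .
qed

lemma summable_int_encode: "(\<lambda>k. (1 / 2 :: real) ^ int_encode k) summable_on UNIV"
proof -
  have "(\<lambda>n. (1 / 2 :: real) ^ n) summable_on UNIV"
    by (subst summable_on_UNIV_nonneg_real_iff) (auto intro: summable_geometric)
  then show ?thesis using summable_on_reindex_bij_betw[OF bij_int_encode, of "\<lambda>n. (1 / 2 :: real) ^ n"] by simp
qed

lemma X_space_rep:
  assumes S: "S \<in> X_space \<eta> s" and s: "s \<ge> 0"
  obtains f where "f \<in> bdm" "continuous_on UNIV f" "S = reg_dist f" "Xn s f = X_norm \<eta> s S" "Xn s f < \<infinity>"
proof -
  have T: "S \<in> tempered" and X: "X_norm \<eta> s S < \<infinity>" using S by (auto simp: X_space_def)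
  define L where "L = (\<lambda>k. Linf_norm (freq_block \<eta> k S))"
  have "(\<Sum>\<^sub>\<infinity>k. L k) \<le> X_norm \<eta> s S"
    unfolding X_norm_def
  proof (rule infsum_mono_ennreal')
    fix k
    have "1 * L k \<le> ennreal (japanese_bracket k powr s) * L k"
      by (intro mult_right_mono) (use bracket_powr_ge_1[OF s] in auto)
    then show "L k \<le> ennreal (japanese_bracket k powr s) * Linf_norm (freq_block \<eta> k S)" by (simp add: L_def)
  qed
  then have sumL: "(\<Sum>\<^sub>\<infinity>k. L k) < \<infinity>" using X by (rule le_less_trans)
  have Lfin: "L k < \<infinity>" for k
    using sum_le_infsum_ennreal[of "{k}" UNIV L] sumL by (simp add: le_less_trans)
  define l where "l = (\<lambda>k. enn2real (L k))"
  have l: "L k = ennreal (l k)" "l k \<ge> 0" for k using Lfin[of k] by (auto simp: l_def ennreal_enn2real)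
  have lsum: "l summable_on UNIV" using summable_on_ennreal(1)[of l UNIV] sumL l by simp
  txt \<open>The infimum in \<open>Linf_norm\<close> need not be attained, hence the summable slack.\<close>
  define c where "c = (\<lambda>k. l k + (1 / 2) ^ int_encode k)"
  have c: "c summable_on UNIV" unfolding c_def by (intro summable_on_add lsum summable_int_encode)
  have "\<exists>f\<in>bdm. freq_block \<eta> k S = reg_dist f \<and> (\<forall>x. norm (f x) \<le> c k)" for k
  proof -
    have "L k < ennreal (c k)" unfolding l c_def using l(2)[of k] by (simp add: ennreal_lessI)
    then obtain f where f: "f \<in> borel_measurable borel" "reg_dist f = freq_block \<eta> k S" "supn f < ennreal (c k)"
      unfolding L_def Linf_norm_def supn_def[symmetric] by (auto simp: INF_less_iff)
    have "c k \<ge> 0" unfolding c_def using l(2)[of k] by (intro add_nonneg_nonneg) auto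
    then have "norm (f x) \<le> c k" for x
      using order.trans[OF supn_upper[of f x] less_imp_le[OF f(3)]] by simp
    with f show ?thesis by (metis bdmI)
  qed
  then obtain f where f: "\<And>k. f k \<in> bdm" "\<And>k. freq_block \<eta> k S = reg_dist (f k)" "\<And>k x. norm (f k x) \<le> c k"
    by metis
  define F where "F = (\<lambda>x. \<Sum>\<^sub>\<infinity>k. f k x)"
  have F: "F \<in> bdm" unfolding F_def by (rule series_uniform(4)[OF f(1,3) c])
  have SF: "S = reg_dist F" unfolding F_def by (rule dist_series[OF T f(2,1,3) c])
  have XF: "Xn s F = X_norm \<eta> s S" unfolding SF by (rule X_norm_reg_dist[OF F, symmetric])
  then have XF': "Xn s F < \<infinity>" using X by simp
  txt \<open>The representatives \<open>f k\<close> were only measurable; the blocks of \<open>F\<close> are continuous.\<close>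
  have le: "norm (blk k F x) \<le> enn2real (supn (blk k F))" for k x by (intro norm_le_supn blk_bdm F)
  note su = series_uniform[of "\<lambda>k. blk k F", OF blk_bdm[OF F] le blk_summable(1)[OF F XF' s]]
  let ?G = "\<lambda>x. \<Sum>\<^sub>\<infinity>k. blk k F x"
  have SG: "S = reg_dist ?G"
    using dist_series[OF reg_dist_tempered[OF F] freq_block_reg_dist[OF F] blk_bdm[OF F] le blk_summable(1)[OF F XF' s]] SF by simp
  have "continuous_on UNIV ?G" by (rule su(5)) (intro fmult_continuous eta_schwartz F)
  moreover have "Xn s ?G = X_norm \<eta> s S" unfolding SG by (rule X_norm_reg_dist[OF su(4), symmetric])
  ultimately show thesis using that[OF su(4) _ SG] X by simp
qed

text \<open>Meant for classical solutions, which come without a bound: a continuous function has to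
  coincide with the bounded continuous representative of its own distribution.\<close>

lemma X_space_continuous_rep:
  assumes "reg_dist u \<in> X_space \<eta> s" "s \<ge> 0" "continuous_on UNIV u"
  shows "u \<in> bdm" "Xn s u = X_norm \<eta> s (reg_dist u)" "Xn s u < \<infinity>"
proof -
  obtain f where f: "f \<in> bdm" "continuous_on UNIV f" "reg_dist u = reg_dist f" "Xn s f = X_norm \<eta> s (reg_dist u)" "Xn s f < \<infinity>"
    using X_space_rep[OF assms(1,2)] by metis
  then have "u = f" by (intro reg_dist_inj assms)
  with f show "u \<in> bdm" "Xn s u = X_norm \<eta> s (reg_dist u)" "Xn s u < \<infinity>" by auto
qed

end

section \<open>Products and truncations\<close>

lemma fmult_tendsto:
  assumes m: "m \<in> schwartz" and h: "\<And>n. h n \<in> bdm" "\<And>n x. norm (h n x) \<le> M"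
    and lim: "\<And>x. (\<lambda>n. h n x) \<longlonglongrightarrow> g x"
  shows "(\<lambda>n. fmult m (h n) x) \<longlonglongrightarrow> fmult m g x"
proof -
  have [measurable]: "g \<in> borel_measurable borel"
    by (rule borel_measurable_LIMSEQ_metric[OF _ lim]) (use h in \<open>auto intro!: bdm_borel\<close>)
  note [measurable] = ker_borel[OF m] bdm_borel[OF h(1)]
  show ?thesis unfolding fmult_def
  proof (rule integral_dominated_convergence[where w="\<lambda>y. norm (inv_fourier m (x - y)) * M"])
    show "integrable lborel (\<lambda>y. norm (inv_fourier m (x - y)) * M)"
      by (intro integrable_mult_left integrable_norm translate_integrable(2) ker_integrable m)
    show "AE y in lborel. (\<lambda>n. inv_fourier m (x - y) * h n y) \<longlonglongrightarrow> inv_fourier m (x - y) * g y"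
      by (intro AE_I2 tendsto_mult tendsto_const lim)
    show "AE y in lborel. norm (inv_fourier m (x - y) * h n y) \<le> norm (inv_fourier m (x - y)) * M" for n
      using h(2) by (auto simp: norm_mult intro!: mult_left_mono)
  qed auto
qed

text \<open>With \<open>r = j - k - l\<close> one has
  \<open>(k + l + r)^2 \<le> 3 * (k^2 + l^2 + r^2)\<close> and \<open>r^2 \<le> 4\<close>, so the
  left side squared is at most \<open>13 + 3 * k^2 + 3 * l^2\<close>. The factor 36 is a square
  above 13, whence the constant 6.\<close>

lemma bracket_prod:
  assumes "\<bar>j - k - l\<bar> \<le> 2"
  shows "japanese_bracket j \<le> 6 * (japanese_bracket k * japanese_bracket l)"
proof -
  define r where "r = real_of_int (j - k - l)"
  have "\<bar>r\<bar> \<le> 2" unfolding r_def using assms by (metis of_int_abs of_int_le_iff of_int_numeral)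
  then have r2: "r\<^sup>2 \<le> 4" using abs_le_square_iff[of r 2] by simp
  let ?k = "real_of_int k" and ?l = "real_of_int l"
  have j: "real_of_int j = ?k + ?l + r" by (simp add: r_def)
  have "(?k + ?l + r)\<^sup>2 \<le> 3 * (?k\<^sup>2 + ?l\<^sup>2 + r\<^sup>2)"
    using zero_le_power2[of "?k - ?l"] zero_le_power2[of "?k - r"] zero_le_power2[of "?l - r"]
    by (simp add: power2_eq_square algebra_simps)
  then have "1 + (real_of_int j)\<^sup>2 \<le> 13 + 3 * ?k\<^sup>2 + 3 * ?l\<^sup>2" using r2 unfolding j by simp
  also have "\<dots> \<le> 36 * ((1 + ?k\<^sup>2) * (1 + ?l\<^sup>2))"
    by (simp add: algebra_simps)
  finally have "sqrt (1 + (real_of_int j)\<^sup>2) \<le> sqrt (36 * ((1 + ?k\<^sup>2) * (1 + ?l\<^sup>2)))" by simp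
  also have "\<dots> = 6 * (sqrt (1 + ?k\<^sup>2) * sqrt (1 + ?l\<^sup>2))"
    using real_sqrt_mult[of 36] real_sqrt_mult[of "1 + ?k\<^sup>2"] real_sqrt_pow2[of 6] real_sqrt_abs[of 6] by simp
  finally show ?thesis unfolding japanese_bracket_def .
qed

lemma bracket_powr_prod:
  assumes "\<bar>j - k - l\<bar> \<le> 2" "s \<ge> 0"
  shows "japanese_bracket j powr s \<le> 6 powr s * (japanese_bracket k powr s * japanese_bracket l powr s)"
proof -
  have "japanese_bracket j powr s \<le> (6 * (japanese_bracket k * japanese_bracket l)) powr s"
    using bracket_prod[OF assms(1)] bracket_ge_1[of j] assms(2) by (intro powr_mono2) auto
  then show ?thesis using bracket_ge_1[of k] bracket_ge_1[of l] by (simp add: powr_mult)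
qed

lemma ennreal_ne_top_cases: "(a::ennreal) < \<infinity> \<Longrightarrow> \<exists>r\<ge>0. a = ennreal r"
  by (metis ennreal_cases infinity_ennreal_def less_irrefl)

context window
begin

section \<open>Rules for the norm and the algebra property\<close>

definition eta_ker :: real where "eta_ker = ker_norm (eta 0)"

lemma eta_ker_nonneg: "eta_ker \<ge> 0" by (simp add: eta_ker_def ker_norm_nonneg)

lemma ker_norm_eta: "ker_norm (eta k) = eta_ker"
proof -
  have "eta k = (\<lambda>\<xi>. eta 0 (\<xi> + - of_int k))" by (auto simp: eta_def)
  then show ?thesis using ker_norm_shift[of "eta 0" "- of_int k"] by (simp add: eta_ker_def)
qed

lemma supn_blk: "f \<in> bdm \<Longrightarrow> supn (blk k f) \<le> ennreal eta_ker * supn f"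
  using supn_fmult[OF eta_schwartz, of f k] by (simp add: ker_norm_eta)

lemma Xn_leI:
  assumes "\<And>F. finite F \<Longrightarrow> (\<Sum>k\<in>F. ennreal (japanese_bracket k powr s) * supn (blk k f)) \<le> B"
  shows "Xn s f \<le> B"
  unfolding Xn_def by (rule infsum_ennreal_le) (rule assms)

lemma Xn_ge:
  "finite F \<Longrightarrow> (\<Sum>k\<in>F. ennreal (japanese_bracket k powr s) * supn (blk k f)) \<le> Xn s f"
  unfolding Xn_def by (rule sum_le_infsum_ennreal) auto

lemma Xn_add:
  assumes "f \<in> bdm" "g \<in> bdm"
  shows "Xn s (\<lambda>x. f x + g x) \<le> Xn s f + Xn s g"
proof (rule Xn_leI)
  fix F :: "int set" assume F: "finite F"
  let ?w = "\<lambda>k. ennreal (japanese_bracket k powr s)"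
  have "supn (blk k (\<lambda>x. f x + g x)) \<le> supn (blk k f) + supn (blk k g)" for k
  proof -
    have "blk k (\<lambda>x. f x + g x) = (\<lambda>x. blk k f x + blk k g x)"
      using fmult_add_right[OF eta_schwartz assms] by blast
    then show ?thesis using supn_add[of "blk k f" "blk k g"] by simp
  qed
  then have "(\<Sum>k\<in>F. ?w k * supn (blk k (\<lambda>x. f x + g x))) \<le> (\<Sum>k\<in>F. ?w k * (supn (blk k f) + supn (blk k g)))"
    by (intro sum_mono mult_left_mono) auto
  also have "\<dots> = (\<Sum>k\<in>F. ?w k * supn (blk k f)) + (\<Sum>k\<in>F. ?w k * supn (blk k g))"
    by (simp add: distrib_left sum.distrib)
  also have "\<dots> \<le> Xn s f + Xn s g" by (intro add_mono Xn_ge F)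
  finally show "(\<Sum>k\<in>F. ?w k * supn (blk k (\<lambda>x. f x + g x))) \<le> Xn s f + Xn s g" .
qed

lemma Xn_uminus: "Xn s (\<lambda>x. - f x) = Xn s f"
proof -
  have "supn (blk k (\<lambda>x. - f x)) = supn (blk k f)" for k
    using fmult_cmult_right[of "eta k" "-1" f] by (intro supn_cong_norm) simp
  then show ?thesis by (simp add: Xn_def)
qed

lemma Xn_diff:
  assumes "f \<in> bdm" "g \<in> bdm"
  shows "Xn s (\<lambda>x. f x - g x) \<le> Xn s f + Xn s g"
  using Xn_add[OF assms(1) bdm_diff[OF bdm_const[of 0] assms(2)], of s] Xn_uminus[of s g] by simp

text \<open>Conjugation reflects frequencies. The window is real and even, so the reflected window
  at \<open>k\<close> is the window at \<open>- k\<close>.\<close>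

lemma blk_cnj: "blk k (\<lambda>x. cnj (f x)) x = cnj (blk (- k) f x)"
proof -
  have "(\<lambda>\<xi>. cnj (eta k (- \<xi>))) = eta (- k)"
    using eta_even by (auto simp: eta_def fun_eq_iff) (metis add.commute minus_diff_eq diff_minus_eq_add)
  then show ?thesis by (simp add: fmult_cnj)
qed

lemma Xn_cnj: "Xn s (\<lambda>x. cnj (f x)) = Xn s f"
proof -
  have "supn (blk k (\<lambda>x. cnj (f x))) = supn (blk (- k) f)" for k
    by (rule supn_cong_norm) (simp add: blk_cnj)
  moreover have "japanese_bracket k = japanese_bracket (- k)" for k by (simp add: japanese_bracket_def)
  ultimately have "Xn s (\<lambda>x. cnj (f x)) =
      (\<Sum>\<^sub>\<infinity>k\<in>UNIV. ennreal (japanese_bracket (- k) powr s) * supn (blk (- k) f))"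
    unfolding Xn_def by (intro infsum_cong) metis
  also have "\<dots> = Xn s f"
    unfolding Xn_def
    by (rule infsum_reindex_bij_betw[of uminus UNIV UNIV "\<lambda>k. ennreal (japanese_bracket k powr s) * supn (blk k f)"])
       (simp add: bij_uminus)
  finally show ?thesis .
qed

text \<open>Frequencies of the product lie within distance 2 of \<open>k + l\<close>, and block
  \<open>j\<close> sees only those within distance 1 of \<open>j\<close>. Thus
  \<open>\<bar>j - k - l\<bar> < 3\<close>, which for integers means at most 2.\<close>

lemma blk_product:
  assumes f: "f \<in> bdm" and g: "g \<in> bdm"
  shows "ennreal (norm (blk j (\<lambda>x. blk k f x * blk l g x) x)) \<le>
    (if \<bar>j - k - l\<bar> \<le> 2 then ennreal eta_ker * (supn (blk k f) * supn (blk l g)) else 0)"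
proof (cases "\<bar>j - k - l\<bar> \<le> 2")
  case True
  have "ennreal (norm (blk j (\<lambda>x. blk k f x * blk l g x) x)) \<le> supn (blk j (\<lambda>x. blk k f x * blk l g x))"
    by (rule supn_upper)
  also have "\<dots> \<le> ennreal eta_ker * supn (\<lambda>x. blk k f x * blk l g x)"
    by (intro supn_blk bdm_mult blk_bdm f g)
  also have "\<dots> \<le> ennreal eta_ker * (supn (blk k f) * supn (blk l g))"
    by (intro mult_left_mono supn_mult) auto
  finally show ?thesis using True by simp
next
  case False
  have "blk j (\<lambda>x. blk k f x * blk l g x) x = 0"
  proof (rule fmult_product_disjoint[OF eta_schwartz eta_schwartz eta_schwartz eta_shift_schwartz f g])
    fix \<xi> \<zeta> assume "eta k \<xi> \<noteq> 0" "eta l \<zeta> \<noteq> 0"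
    then have a: "\<bar>\<xi> - of_int k\<bar> < 1" "\<bar>\<zeta> - of_int l\<bar> < 1" by (auto dest: eta_support)
    have "\<bar>real_of_int (j - k - l)\<bar> \<ge> 3" using False by linarith
    then have "\<not> \<bar>\<xi> + \<zeta> - of_int j\<bar> < 1" using a by (simp add: abs_less_iff) linarith
    then show "eta j (\<xi> + \<zeta>) = 0" using eta_support by blast
  qed
  then show ?thesis using False by simp
qed

text \<open>Weighted convolution of the two sequences of block norms. Products are expanded for
  finite block sums only; the passage to \<open>f x * g x\<close> uses bounded pointwise convergence
  inside each block.\<close>

lemma Xn_mult:
  assumes f: "f \<in> bdm" "continuous_on UNIV f" "Xn s f < \<infinity>"
    and g: "g \<in> bdm" "continuous_on UNIV g" "Xn s g < \<infinity>" and s: "s \<ge> 0"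
  shows "Xn s (\<lambda>x. f x * g x) \<le> ennreal (5 * 6 powr s * eta_ker) * (Xn s f * Xn s g)"
proof (rule Xn_leI)
  fix F :: "int set" assume F: "finite F"
  let ?w = "\<lambda>k. ennreal (japanese_bracket k powr s)"
  let ?T = "\<lambda>j (k, l). if \<bar>j - k - l\<bar> \<le> 2 then ennreal eta_ker * (supn (blk k f) * supn (blk l g)) else 0"
  define I where "I = (\<lambda>n. {- int n..int n})"
  define R where "R = (\<lambda>n j. \<Sum>p\<in>I n \<times> I n. ?T j p)"
  define C where "C = ennreal (5 * 6 powr s * eta_ker) * (Xn s f * Xn s g)"
  have finI: "finite (I n)" for n by (simp add: I_def)
  have bound: "ennreal (norm (blk j (\<lambda>x. (\<Sum>k\<in>I n. blk k f x) * (\<Sum>l\<in>I n. blk l g x)) x)) \<le> R n j" for n j x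
  proof -
    have "(\<lambda>x. (\<Sum>k\<in>I n. blk k f x) * (\<Sum>l\<in>I n. blk l g x)) =
        (\<lambda>x. \<Sum>p\<in>I n \<times> I n. blk (fst p) f x * blk (snd p) g x)"
      by (simp add: sum_product sum.cartesian_product case_prod_beta)
    then have "norm (blk j (\<lambda>x. (\<Sum>k\<in>I n. blk k f x) * (\<Sum>l\<in>I n. blk l g x)) x) =
        norm (\<Sum>p\<in>I n \<times> I n. blk j (\<lambda>x. blk (fst p) f x * blk (snd p) g x) x)"
      by (simp add: fmult_sum_right eta_schwartz bdm_mult blk_bdm f g)
    also have "\<dots> \<le> (\<Sum>p\<in>I n \<times> I n. norm (blk j (\<lambda>x. blk (fst p) f x * blk (snd p) g x) x))" by (rule norm_sum)
    finally have "ennreal (norm (blk j (\<lambda>x. (\<Sum>k\<in>I n. blk k f x) * (\<Sum>l\<in>I n. blk l g x)) x)) \<le>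
        (\<Sum>p\<in>I n \<times> I n. ennreal (norm (blk j (\<lambda>x. blk (fst p) f x * blk (snd p) g x) x)))"
      by (simp add: sum_ennreal ennreal_leI)
    also have "\<dots> \<le> R n j" unfolding R_def
      by (intro sum_mono) (use blk_product[OF f(1) g(1), of j _ _ x] in \<open>simp add: case_prod_beta\<close>)
    finally show ?thesis .
  qed
  \<comment> \<open>Monotonicity in \<open>n\<close> turns the limit of the finite bounds into a
    supremum, so the weighted sum over \<open>F\<close> can be bounded before the limit is
    taken.\<close>
  have mono: "incseq (\<lambda>n. R n j)" for j
    unfolding R_def by (intro monoI sum_mono2) (auto simp: finI, auto simp: I_def)
  define c where "c = (\<Sum>\<^sub>\<infinity>k. enn2real (supn (blk k f)))"
  define d where "d = (\<Sum>\<^sub>\<infinity>k. enn2real (supn (blk k g)))"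
  have c: "norm (\<Sum>k\<in>I n. blk k f x) \<le> c" for n x
    unfolding c_def by (rule series_uniform(2)[OF blk_bdm[OF f(1)] norm_le_supn[OF blk_bdm[OF f(1)]] blk_summable(1)[OF f(1,3) s]])
  have d: "norm (\<Sum>k\<in>I n. blk k g x) \<le> d" for n x
    unfolding d_def by (rule series_uniform(2)[OF blk_bdm[OF g(1)] norm_le_supn[OF blk_bdm[OF g(1)]] blk_summable(1)[OF g(1,3) s]])
  have c0: "0 \<le> c" using order.trans[OF norm_ge_zero c] .
  have conv: "(\<lambda>n. blk j (\<lambda>x. (\<Sum>k\<in>I n. blk k f x) * (\<Sum>l\<in>I n. blk l g x)) x) \<longlonglongrightarrow> blk j (\<lambda>x. f x * g x) x" for j x
  proof (rule fmult_tendsto[OF eta_schwartz, where M="c * d"])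
    show "(\<lambda>x. (\<Sum>k\<in>I n. blk k f x) * (\<Sum>l\<in>I n. blk l g x)) \<in> bdm" for n
      by (intro bdm_mult bdm_sum blk_bdm f g)
    show "norm ((\<Sum>k\<in>I n. blk k f x) * (\<Sum>l\<in>I n. blk l g x)) \<le> c * d" for n x
      unfolding norm_mult by (intro mult_mono c d c0) auto
    show "(\<lambda>n. (\<Sum>k\<in>I n. blk k f x) * (\<Sum>l\<in>I n. blk l g x)) \<longlonglongrightarrow> f x * g x" for x
      unfolding I_def
      by (intro tendsto_mult tendsto_uniform_limitI[OF blk_series(1)[OF f s]] tendsto_uniform_limitI[OF blk_series(1)[OF g s]]) auto
  qed
  have "supn (blk j (\<lambda>x. f x * g x)) \<le> (SUP n. R n j)" for j
  proof (rule supn_le)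
    fix x
    have "(\<lambda>n. ennreal (norm (blk j (\<lambda>x. (\<Sum>k\<in>I n. blk k f x) * (\<Sum>l\<in>I n. blk l g x)) x))) \<longlonglongrightarrow> ennreal (norm (blk j (\<lambda>x. f x * g x) x))"
      by (intro tendsto_ennrealI tendsto_norm conv)
    then show "ennreal (norm (blk j (\<lambda>x. f x * g x) x)) \<le> (SUP n. R n j)"
    proof (rule Lim_bounded[of _ _ 0], intro allI impI)
      fix n
      have "R n j \<le> (SUP n. R n j)" by (rule SUP_upper) simp
      with bound[where n=n and j=j and x=x]
      show "ennreal (norm (blk j (\<lambda>x. (\<Sum>k\<in>I n. blk k f x) * (\<Sum>l\<in>I n. blk l g x)) x)) \<le> (SUP n. R n j)"
        by (rule order.trans)
    qed
  qed
  then have "(\<Sum>j\<in>F. ?w j * supn (blk j (\<lambda>x. f x * g x))) \<le> (\<Sum>j\<in>F. ?w j * (SUP n. R n j))"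
    by (intro sum_mono mult_left_mono) auto
  also have "\<dots> \<le> C"
  proof (rule Lim_bounded[of "\<lambda>n. \<Sum>j\<in>F. ?w j * R n j" _ 0])
    show "(\<lambda>n. \<Sum>j\<in>F. ?w j * R n j) \<longlonglongrightarrow> (\<Sum>j\<in>F. ?w j * (SUP n. R n j))"
      by (intro tendsto_sum ennreal_tendsto_cmult LIMSEQ_SUP mono) auto
    show "\<forall>n\<ge>0. (\<Sum>j\<in>F. ?w j * R n j) \<le> C"
    proof (intro allI impI)
      fix n
      \<comment> \<open>A fixed pair \<open>(k, l)\<close> reaches at most the five indices
        \<open>j\<close> from \<open>k + l - 2\<close> to \<open>k + l + 2\<close>, each with a
        weight controlled by \<open>bracket_powr_prod\<close>; this is the origin of
        \<open>5 * 6 powr s\<close>.\<close>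
      have inner: "(\<Sum>j\<in>F. ?w j * ?T j (k, l)) \<le>
          ennreal (5 * 6 powr s * eta_ker) * ((?w k * supn (blk k f)) * (?w l * supn (blk l g)))" for k l
      proof -
        let ?S = "ennreal eta_ker * (supn (blk k f) * supn (blk l g))"
        have "(\<Sum>j\<in>F. ?w j * ?T j (k, l)) = (\<Sum>j\<in>F \<inter> {k + l - 2..k + l + 2}. ?w j * ?S)"
          by (rule sum.mono_neutral_cong_right[OF F]) auto
        also have "\<dots> \<le> of_nat (card (F \<inter> {k + l - 2..k + l + 2})) * (ennreal (6 powr s) * (?w k * ?w l) * ?S)"
        proof (rule sum_bounded_above)
          fix j assume "j \<in> F \<inter> {k + l - 2..k + l + 2}"
          then have "\<bar>j - k - l\<bar> \<le> 2" by auto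
          from bracket_powr_prod[OF this s]
          have "?w j \<le> ennreal (6 powr s) * (?w k * ?w l)" by (simp add: ennreal_leI flip: ennreal_mult)
          then show "?w j * ?S \<le> ennreal (6 powr s) * (?w k * ?w l) * ?S" by (rule mult_right_mono) simp
        qed
        also have "\<dots> \<le> ennreal 5 * (ennreal (6 powr s) * (?w k * ?w l) * ?S)"
        proof (rule mult_right_mono)
          have "card (F \<inter> {k + l - 2..k + l + 2}) \<le> card {k + l - 2..k + l + 2}" by (rule card_mono) auto
          then have "real (card (F \<inter> {k + l - 2..k + l + 2})) \<le> 5" by simp
          then show "of_nat (card (F \<inter> {k + l - 2..k + l + 2})) \<le> ennreal 5"
            by (metis ennreal_leI ennreal_of_nat_eq_real_of_nat)
        qed simp
        also have "\<dots> = ennreal (5 * 6 powr s * eta_ker) * ((?w k * supn (blk k f)) * (?w l * supn (blk l g)))"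
          using eta_ker_nonneg by (simp add: ennreal_mult mult_ac)
        finally show ?thesis .
      qed
      have "(\<Sum>j\<in>F. ?w j * R n j) = (\<Sum>p\<in>I n \<times> I n. \<Sum>j\<in>F. ?w j * ?T j p)"
        unfolding R_def sum_distrib_left by (rule sum.swap)
      also have "\<dots> \<le> (\<Sum>(k, l)\<in>I n \<times> I n. ennreal (5 * 6 powr s * eta_ker) * ((?w k * supn (blk k f)) * (?w l * supn (blk l g))))"
        by (intro sum_mono) (use inner in auto)
      also have "\<dots> = ennreal (5 * 6 powr s * eta_ker) * ((\<Sum>k\<in>I n. ?w k * supn (blk k f)) * (\<Sum>l\<in>I n. ?w l * supn (blk l g)))"
        unfolding sum_product sum_distrib_left[of "ennreal (5 * 6 powr s * eta_ker)"] sum.cartesian_product by (simp add: case_prod_beta)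
      also have "\<dots> \<le> C" unfolding C_def
        by (intro mult_left_mono mult_mono Xn_ge finI) auto
      finally show "(\<Sum>j\<in>F. ?w j * R n j) \<le> C" .
    qed
  qed
  finally show "(\<Sum>j\<in>F. ?w j * supn (blk j (\<lambda>x. f x * g x))) \<le> ennreal (5 * 6 powr s * eta_ker) * (Xn s f * Xn s g)"
    unfolding C_def .
qed

section \<open>Truncation to low frequencies\<close>

lemma block_regularization_eq:
  assumes "f \<in> bdm"
  shows "block_regularization \<eta> n (reg_dist f) = reg_dist (fmult (low n) f)"
proof (rule ext)
  fix \<phi>
  have "fmult (low n) f = (\<lambda>x. \<Sum>k\<in>{- int n..int n}. blk k f x)"
    using fmult_sum_left[of "{- int n..int n}" eta f] eta_schwartz assms by (simp add: low_def[abs_def] fun_eq_iff)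
  then show "block_regularization \<eta> n (reg_dist f) \<phi> = reg_dist (fmult (low n) f) \<phi>"
    unfolding block_regularization_def
    by (simp add: freq_block_reg_dist[OF assms] reg_dist_sum blk_bdm[OF assms])
qed

lemma eta_disjoint: "\<bar>k - j\<bar> \<ge> 2 \<Longrightarrow> eta j \<xi> * eta k \<xi> = 0"
  using eta_support[of k \<xi>] eta_support[of j \<xi>] by (cases "eta j \<xi> * eta k \<xi> = 0") auto

text \<open>For \<open>\<bar>j\<bar> < n\<close> the cut-off equals 1 on the whole window
  \<open>j\<close>, and the difference has no such block. Otherwise at most the three neighbouring
  windows \<open>j - 1\<close>, \<open>j\<close>, \<open>j + 1\<close> meet the window
  \<open>j\<close>, each costing a factor \<open>eta_ker\<close>; the summand 1 accounts for the
  block of \<open>f\<close> itself.\<close>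

lemma blk_low_diff:
  assumes f: "f \<in> bdm"
  shows "supn (blk j (\<lambda>x. fmult (low n) f x - f x)) \<le>
    (if \<bar>j\<bar> < int n then 0 else ennreal (1 + 3 * eta_ker) * supn (blk j f))"
proof -
  have low: "fmult (low n) f \<in> bdm" by (intro fmult_bdm low_schwartz f)
  have split: "blk j (\<lambda>x. fmult (low n) f x - f x) x = fmult (\<lambda>\<xi>. eta j \<xi> * low n \<xi>) f x - blk j f x" for x
    by (simp add: fmult_diff_right eta_schwartz low f fmult_fmult low_schwartz)
  show ?thesis
  proof (cases "\<bar>j\<bar> < int n")
    case True
    have "(\<lambda>\<xi>. eta j \<xi> * low n \<xi>) = eta j"
    proof (rule ext)
      fix \<xi>
      show "eta j \<xi> * low n \<xi> = eta j \<xi>"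
      proof (cases "eta j \<xi> = 0")
        case False
        from eta_support[OF this] True have "\<bar>\<xi>\<bar> \<le> real n" by linarith
        then show ?thesis by (simp add: low_eq_1)
      qed simp
    qed
    then have "blk j (\<lambda>x. fmult (low n) f x - f x) = (\<lambda>x. 0)" using split by auto
    then show ?thesis using True by simp
  next
    case False
    let ?I = "{- int n..int n}" and ?J = "{j - 1..j + 1}"
    have "(\<lambda>\<xi>. eta j \<xi> * low n \<xi>) = (\<lambda>\<xi>. \<Sum>k\<in>?I \<inter> ?J. eta k \<xi> * eta j \<xi>)"
    proof (rule ext)
      fix \<xi>
      have "eta j \<xi> * low n \<xi> = (\<Sum>k\<in>?I. eta k \<xi> * eta j \<xi>)"
        by (simp add: low_def sum_distrib_left mult.commute)
      also have "\<dots> = (\<Sum>k\<in>?I \<inter> ?J. eta k \<xi> * eta j \<xi>)"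
      proof (rule sum.mono_neutral_right)
        show "\<forall>k\<in>?I - ?I \<inter> ?J. eta k \<xi> * eta j \<xi> = 0"
          using eta_disjoint[of _ j \<xi>] by (auto simp: mult.commute)
      qed auto
      finally show "eta j \<xi> * low n \<xi> = (\<Sum>k\<in>?I \<inter> ?J. eta k \<xi> * eta j \<xi>)" .
    qed
    then have "fmult (\<lambda>\<xi>. eta j \<xi> * low n \<xi>) f x = (\<Sum>k\<in>?I \<inter> ?J. blk k (blk j f) x)" for x
      by (simp add: fmult_sum_left schwartz_mult eta_schwartz f fmult_fmult)
    then have eq: "blk j (\<lambda>x. fmult (low n) f x - f x) = (\<lambda>x. (\<Sum>k\<in>?I \<inter> ?J. blk k (blk j f) x) + - blk j f x)"
      using split by auto
    have "supn (blk j (\<lambda>x. fmult (low n) f x - f x)) \<le>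
       supn (\<lambda>x. \<Sum>k\<in>?I \<inter> ?J. blk k (blk j f) x) + supn (\<lambda>x. - blk j f x)"
      unfolding eq by (rule supn_add)
    also have "supn (\<lambda>x. - blk j f x) = supn (blk j f)" by (rule supn_cong_norm) simp
    also have "supn (\<lambda>x. \<Sum>k\<in>?I \<inter> ?J. blk k (blk j f) x) \<le> (\<Sum>k\<in>?I \<inter> ?J. supn (blk k (blk j f)))"
      by (rule supn_sum) simp
    also have "\<dots> \<le> (\<Sum>k\<in>?J. ennreal eta_ker * supn (blk j f))"
      by (rule order.trans[OF sum_mono[OF supn_blk[OF blk_bdm[OF f]]] sum_mono2]) auto
    also have "\<dots> = 3 * (ennreal eta_ker * supn (blk j f))" by simp
    finally have "supn (blk j (\<lambda>x. fmult (low n) f x - f x)) \<le> 3 * (ennreal eta_ker * supn (blk j f)) + supn (blk j f)"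
      by (simp add: add_right_mono)
    also have "\<dots> = ennreal (1 + 3 * eta_ker) * supn (blk j f)"
      using eta_ker_nonneg by (simp add: ennreal_plus ennreal_mult distrib_right mult.assoc add.commute)
    finally show ?thesis using False by simp
  qed
qed

lemma Xn_low_tendsto:
  assumes f: "f \<in> bdm" and X: "Xn s f < \<infinity>"
  shows "(\<lambda>n. Xn s (\<lambda>x. fmult (low n) f x - f x)) \<longlonglongrightarrow> 0"
proof -
  let ?w = "\<lambda>k. japanese_bracket k powr s"
  define c where "c = (\<lambda>k. ?w k * enn2real (supn (blk k f)))"
  have c0: "c k \<ge> 0" for k by (simp add: c_def)
  have ec: "ennreal (c k) = ennreal (?w k) * supn (blk k f)" for k
    unfolding c_def using supn_eq_ennreal[OF blk_bdm[OF f], of k] by (simp add: ennreal_mult)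
  have cs: "c summable_on UNIV"
    by (rule summable_on_ennreal(1)) (use X c0 in \<open>auto simp: ec Xn_def\<close>)
  define t where "t = (\<lambda>n. infsum c UNIV - (\<Sum>k\<in>{- int n..int n}. c k))"
  have "(\<lambda>n. \<Sum>k\<in>{- int n..int n}. c k) \<longlonglongrightarrow> infsum c UNIV"
    using has_sum_infsum[OF cs] unfolding has_sum_def
    by (rule filterlim_compose[OF _ filterlim_symmetric_intervals])
  from tendsto_diff[OF tendsto_const[of "infsum c UNIV"] this] have t: "t \<longlonglongrightarrow> 0" by (simp add: t_def)
  \<comment> \<open>With the cut-off at \<open>Suc n\<close> the blocks
    \<open>\<bar>k\<bar> \<le> n\<close> cancel, which are those subtracted in
    \<open>t n\<close>.\<close>
  have le: "Xn s (\<lambda>x. fmult (low (Suc n)) f x - f x) \<le> ennreal ((1 + 3 * eta_ker) * t n)" for n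
  proof (rule Xn_leI)
    fix F :: "int set" assume F: "finite F"
    let ?G = "F - {- int n..int n}"
    have "(\<Sum>k\<in>F. ennreal (?w k) * supn (blk k (\<lambda>x. fmult (low (Suc n)) f x - f x))) \<le>
        (\<Sum>k\<in>F. if k \<in> {- int n..int n} then 0 else ennreal (1 + 3 * eta_ker) * ennreal (c k))"
    proof (rule sum_mono)
      fix k
      show "ennreal (?w k) * supn (blk k (\<lambda>x. fmult (low (Suc n)) f x - f x)) \<le>
        (if k \<in> {- int n..int n} then 0 else ennreal (1 + 3 * eta_ker) * ennreal (c k))"
        using mult_left_mono[OF blk_low_diff[OF f, of k "Suc n"], of "ennreal (?w k)"]
        by (auto simp: ec mult_ac split: if_splits)
    qed
    also have "\<dots> = (\<Sum>k\<in>?G. ennreal (1 + 3 * eta_ker) * ennreal (c k))"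
      by (rule sum.mono_neutral_cong_right) (use F in auto)
    also have "\<dots> = ennreal ((1 + 3 * eta_ker) * (\<Sum>k\<in>?G. c k))"
      using eta_ker_nonneg c0 by (simp add: sum_ennreal ennreal_mult sum_nonneg flip: sum_distrib_left)
    also have "\<dots> \<le> ennreal ((1 + 3 * eta_ker) * t n)"
    proof (intro ennreal_leI mult_left_mono)
      have "(\<Sum>k\<in>?G. c k) + (\<Sum>k\<in>{- int n..int n}. c k) = (\<Sum>k\<in>?G \<union> {- int n..int n}. c k)"
        by (rule sum.union_disjoint[symmetric]) (use F in auto)
      also have "\<dots> \<le> infsum c UNIV" by (rule finite_sum_le_infsum[OF cs]) (use F c0 in auto)
      finally show "(\<Sum>k\<in>?G. c k) \<le> t n" by (simp add: t_def)
    qed (use eta_ker_nonneg in auto)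
    finally show "(\<Sum>k\<in>F. ennreal (?w k) * supn (blk k (\<lambda>x. fmult (low (Suc n)) f x - f x))) \<le> ennreal ((1 + 3 * eta_ker) * t n)" .
  qed
  have "(\<lambda>n. ennreal ((1 + 3 * eta_ker) * t n)) \<longlonglongrightarrow> ennreal ((1 + 3 * eta_ker) * 0)"
    by (intro tendsto_ennrealI tendsto_mult tendsto_const t)
  then have "(\<lambda>n. ennreal ((1 + 3 * eta_ker) * t n)) \<longlonglongrightarrow> 0" by simp
  then have "(\<lambda>n. Xn s (\<lambda>x. fmult (low (Suc n)) f x - f x)) \<longlonglongrightarrow> 0"
    by (rule tendsto_sandwich[OF _ _ tendsto_const, rotated 2]) (use le in auto)
  then show ?thesis by (rule LIMSEQ_imp_Suc)
qed

text \<open>A truncated function has no block beyond \<open>n + 1\<close>, so at a fixed cut-off the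
  weighted norm is controlled by the supremum alone, with a constant depending on \<open>n\<close>.
  This lets uniform approximations enter the weighted norm.\<close>

lemma Xn_low_le: "\<exists>C. \<forall>h\<in>bdm. Xn s (fmult (low n) h) \<le> ennreal C * supn h"
proof -
  let ?w = "\<lambda>k. japanese_bracket k powr s" and ?J = "{- int n - 1..int n + 1}"
  define C where "C = (\<Sum>j\<in>?J. ?w j * (eta_ker * ker_norm (low n)))"
  have "Xn s (fmult (low n) h) \<le> ennreal C * supn h" if h: "h \<in> bdm" for h
  proof (rule Xn_leI)
    fix F :: "int set" assume F: "finite F"
    have low: "fmult (low n) h \<in> bdm" by (intro fmult_bdm low_schwartz h)
    have 0: "supn (blk j (fmult (low n) h)) = 0" if "j \<notin> ?J" for j
    proof -
      have "eta j \<xi> * low n \<xi> = 0" for \<xi>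
        unfolding low_def sum_distrib_left
        by (rule sum.neutral) (use that eta_disjoint[of _ j \<xi>] in auto)
      then have "(\<lambda>\<xi>. eta j \<xi> * low n \<xi>) = (\<lambda>\<xi>. 0)" by blast
      then have "fmult (\<lambda>\<xi>. eta j \<xi> * low n \<xi>) h = (\<lambda>x. 0)"
        using fmult_zero_left by presburger
      then have "blk j (fmult (low n) h) = (\<lambda>x. 0)"
        by (simp only: fmult_fmult eta_schwartz low_schwartz h)
      then show ?thesis by simp
    qed
    have 1: "supn (blk j (fmult (low n) h)) \<le> ennreal (eta_ker * ker_norm (low n)) * supn h" for j
    proof -
      have "supn (blk j (fmult (low n) h)) \<le> ennreal eta_ker * supn (fmult (low n) h)" by (rule supn_blk[OF low])
      also have "\<dots> \<le> ennreal eta_ker * (ennreal (ker_norm (low n)) * supn h)"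
        by (intro mult_left_mono supn_fmult low_schwartz h) auto
      finally show ?thesis using eta_ker_nonneg ker_norm_nonneg by (simp add: ennreal_mult mult.assoc)
    qed
    have "(\<Sum>k\<in>F. ennreal (?w k) * supn (blk k (fmult (low n) h))) = (\<Sum>k\<in>F \<inter> ?J. ennreal (?w k) * supn (blk k (fmult (low n) h)))"
      by (rule sum.mono_neutral_right) (use F 0 in auto)
    also have "\<dots> \<le> (\<Sum>k\<in>?J. ennreal (?w k) * supn (blk k (fmult (low n) h)))" by (rule sum_mono2) auto
    also have "\<dots> \<le> (\<Sum>k\<in>?J. ennreal (?w k * (eta_ker * ker_norm (low n))) * supn h)"
    proof (rule sum_mono)
      fix k
      have "ennreal (?w k * (eta_ker * ker_norm (low n))) = ennreal (?w k) * ennreal (eta_ker * ker_norm (low n))"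
        by (intro ennreal_mult) (use eta_ker_nonneg ker_norm_nonneg in auto)
      then show "ennreal (?w k) * supn (blk k (fmult (low n) h)) \<le> ennreal (?w k * (eta_ker * ker_norm (low n))) * supn h"
        using mult_left_mono[OF 1, of "ennreal (?w k)" k] by (simp add: mult.assoc)
    qed
    also have "\<dots> = ennreal C * supn h"
    proof -
      have "(\<Sum>k\<in>?J. ennreal (?w k * (eta_ker * ker_norm (low n)))) = ennreal C"
        unfolding C_def using eta_ker_nonneg ker_norm_nonneg by (intro sum_ennreal) auto
      then show ?thesis by (simp only: sum_distrib_right[symmetric])
    qed
    finally show "(\<Sum>k\<in>F. ennreal (?w k) * supn (blk k (fmult (low n) h))) \<le> ennreal C * supn h" .
  qed
  then show ?thesis by blast
qed

lemma X_space_reg_dist: "f \<in> bdm \<Longrightarrow> Xn s f < \<infinity> \<Longrightarrow> reg_dist f \<in> X_space \<eta> s"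
  by (simp add: X_space_def reg_dist_tempered X_norm_reg_dist)

lemma X_converges_reg_dist:
  assumes f: "f \<in> bdm" "Xn s f < \<infinity>" and g: "\<And>n. g n \<in> bdm" "\<And>n. Xn s (g n) < \<infinity>"
    and lim: "(\<lambda>n. Xn s (\<lambda>x. g n x - f x)) \<longlonglongrightarrow> 0"
  shows "X_converges \<eta> s (\<lambda>n. reg_dist (g n)) (reg_dist f)"
proof -
  have "X_norm \<eta> s (reg_dist (g n) - reg_dist f) = Xn s (\<lambda>x. g n x - f x)" for n
    by (simp add: reg_dist_diff f g X_norm_reg_dist bdm_diff)
  then show ?thesis
    using lim X_space_reg_dist[OF f] X_space_reg_dist[OF g] by (simp add: X_converges_def)
qed

lemma Xn_low_finite:
  assumes "h \<in> bdm" shows "Xn s (fmult (low n) h) < \<infinity>"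
proof -
  obtain C where "Xn s (fmult (low n) h) \<le> ennreal C * supn h" using Xn_low_le[of s n] assms by blast
  also have "\<dots> < \<infinity>" using supn_finite[OF assms] by (simp add: ennreal_mult_less_top)
  finally show ?thesis .
qed

lemma block_regularization_converges:
  assumes f: "f \<in> bdm" "Xn s f < \<infinity>"
  shows "X_converges \<eta> s (\<lambda>n. block_regularization \<eta> n (reg_dist f)) (reg_dist f)"
  unfolding block_regularization_eq[OF f(1)]
  by (intro X_converges_reg_dist f fmult_bdm low_schwartz Xn_low_finite Xn_low_tendsto)

end

section \<open>Stability of the flow\<close>

text \<open>The coordinates of \<open>y\<close> vary independently, so a bound for all choices of
  points bounds the sum of suprema. The summand \<open>c\<close> carries the terms not yet maximised
  through the induction.\<close>

lemma sum_SUP_le_ennreal: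
  fixes g :: "'a \<Rightarrow> 'b \<Rightarrow> ennreal"
  assumes "finite K" "\<And>y. (\<Sum>k\<in>K. g k (y k)) + c \<le> R"
  shows "(\<Sum>k\<in>K. SUP x. g k x) + c \<le> R"
  using assms
proof (induction K arbitrary: c rule: finite_induct)
  case (insert k K)
  have *: "g k x + ((\<Sum>k\<in>K. SUP x. g k x) + c) \<le> R" for x
  proof -
    have "(\<Sum>i\<in>K. g i (y i)) + (g k x + c) \<le> R" for y
    proof -
      have "(\<Sum>i\<in>K. g i ((y(k := x)) i)) = (\<Sum>i\<in>K. g i (y i))"
        using insert.hyps by (intro sum.cong) auto
      then show ?thesis using insert.prems[of "y(k := x)"] insert.hyps by (simp add: add_ac)
    qed
    from insert.IH[OF this] show ?thesis by (simp add: add_ac)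
  qed
  have "(SUP x. g k x) + ((\<Sum>k\<in>K. SUP x. g k x) + c) = (SUP x. g k x + ((\<Sum>k\<in>K. SUP x. g k x) + c))"
    by (rule ennreal_SUP_add_left[symmetric]) simp
  also have "\<dots> \<le> R" by (rule SUP_least) (rule *)
  finally show ?case using insert.hyps by (simp add: add_ac)
qed simp

lemma shift_mult_schwartz:
  assumes "g \<in> schwartz" shows "(\<lambda>\<xi>. (of_real \<xi> - c) * g \<xi>) \<in> schwartz"
  using schwartz_diff[OF schwartz_ident_mult[OF assms] schwartz_cmult[OF assms, of c]] by (simp add: left_diff_distrib)

text \<open>
  In the frame moving with speed \<open>k\<close> and after removing the phase, the free evolution of the block at
  frequency \<open>k\<close> is generated by the multiplier \<open>(\<xi> - k)\<^sup>2\<close>, which is bounded on that block.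
\<close>

lemma moving_frame_derivative:
  fixes w wt :: "real \<Rightarrow> real \<Rightarrow> complex" and k x t :: real
  assumes m: "m \<in> schwartz" and e: "e > 0"
    and w: "\<And>r. r \<in> ball t e \<Longrightarrow> w r \<in> bdm" and wt: "wt t \<in> bdm"
    and bound: "\<And>r y. r \<in> ball t e \<Longrightarrow> norm (w r y) \<le> B" "\<And>r y. r \<in> ball t e \<Longrightarrow> norm (wt r y) \<le> B"
    and der: "\<And>r y. r \<in> ball t e \<Longrightarrow> ((\<lambda>r. w r y) has_vector_derivative wt r y) (at r)"
    and wx: "wx \<in> bdm" "\<And>y. (w t has_vector_derivative wx y) (at y)"
    and wxx: "wxx \<in> bdm" "\<And>y. (wx has_vector_derivative wxx y) (at y)"
    and h: "h \<in> bdm" and eq: "\<And>y. wt t y = (\<i> / 2) * wxx y - \<i> * h y"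
  shows "((\<lambda>r. cis (- (k\<^sup>2 / 2) * r) * fmult m (w r) (x + k * r)) has_vector_derivative
    cis (- (k\<^sup>2 / 2) * t) * (- (\<i> / 2) * fmult (\<lambda>\<xi>. (of_real \<xi> - of_real k)\<^sup>2 * m \<xi>) (w t) (x + k * t)
      - \<i> * fmult m h (x + k * t))) (at t)"
proof -
  have t: "t \<in> ball t e" using e by simp
  note wt0 = w[OF t]
  let ?m1 = "\<lambda>\<xi>. (\<i> * of_real \<xi>) * m \<xi>"
  let ?m2 = "\<lambda>\<xi>. (\<i> * of_real \<xi>) * ?m1 \<xi>"
  have m1: "?m1 \<in> schwartz" by (rule ixi_schwartz[OF m])
  have m2: "?m2 \<in> schwartz" by (rule ixi_schwartz[OF m1])
  let ?K = "inv_fourier m" and ?K1 = "inv_fourier ?m1"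
  let ?X = "x + k * t"
  note [measurable] = bdm_borel[OF wt0] bdm_borel[OF wt] ker_borel[OF m] ker_borel[OF m1]
  obtain C where C: "C > 0" "\<And>z. norm (?K z) \<le> C / (1 + z\<^sup>2)" using schwartz_decay[OF inv_fourier_schwartz[OF m]] by blast
  obtain C1 where C1: "C1 > 0" "\<And>z. norm (?K1 z) \<le> C1 / (1 + z\<^sup>2)" using schwartz_decay[OF inv_fourier_schwartz[OF m1]] by blast
  have B: "B \<ge> 0" using order.trans[OF norm_ge_zero bound(1)[OF t]] .
  let ?R = "2 * (1 + (\<bar>k\<bar> * e)\<^sup>2)"
  \<comment> \<open>During the time \<open>e\<close> the moving point travels at most
    \<open>\<bar>k\<bar> * e\<close>, so its kernel keeps one majorant centred at
    \<open>?X\<close>.\<close>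
  have sh: "c / (1 + (x + k * r - y)\<^sup>2) \<le> ?R * c / (1 + (?X - y)\<^sup>2)" if "r \<in> ball t e" "c > 0" for r y c
  proof -
    have "\<bar>k * (r - t)\<bar> \<le> \<bar>k\<bar> * e"
      unfolding abs_mult using that by (intro mult_left_mono) (auto simp: dist_real_def)
    moreover have eq: "x + k * r - y = (?X - y) + k * (r - t)" by (simp add: algebra_simps)
    ultimately show ?thesis
      using decay_shift[of c "k * (r - t)" "\<bar>k\<bar> * e" "?X - y"] that(2) unfolding eq by linarith
  qed
  let ?D = "\<lambda>r y. ?K (x + k * r - y) * wt r y + (of_real k * ?K1 (x + k * r - y)) * w r y"
  have der1: "((\<lambda>r. fmult m (w r) (x + k * r)) has_vector_derivative (LINT y|lborel. ?D t y)) (at t)"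
    unfolding fmult_def
  proof (rule has_vector_derivative_integral[OF e, where w="\<lambda>y. (?R * (C + \<bar>k\<bar> * C1) / (1 + (?X - y)\<^sup>2)) * B"])
    show "integrable lborel (\<lambda>y. ?K (x + k * r - y) * w r y)" if "r \<in> ball t e" for r
      by (rule fmult_integrable[OF m w[OF that]])
    show "((\<lambda>r. ?K (x + k * r - y) * w r y) has_vector_derivative ?D r y) (at r)" if "r \<in> ball t e" for r y
    proof -
      have "((\<lambda>r. x + k * r - y) has_vector_derivative k) (at r)"
        by (auto intro!: derivative_eq_intros simp flip: has_real_derivative_iff_has_vector_derivative)
      from vector_diff_chain_at[OF this, of ?K] ker_deriv[OF m, of "x + k * r - y"]
      have "((\<lambda>r. ?K (x + k * r - y)) has_vector_derivative of_real k * ?K1 (x + k * r - y)) (at r)"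
        by (simp add: o_def scaleR_conv_of_real)
      from has_vector_derivative_mult[OF this der[OF that]] show ?thesis .
    qed
    show "norm (?D r y) \<le> (?R * (C + \<bar>k\<bar> * C1) / (1 + (?X - y)\<^sup>2)) * B" if r: "r \<in> ball t e" for r y
    proof -
      have 1: "norm (?K (x + k * r - y)) \<le> ?R * C / (1 + (?X - y)\<^sup>2)"
        by (rule order.trans[OF C(2) sh[OF r C(1)]])
      have 2: "norm (?K1 (x + k * r - y)) \<le> ?R * C1 / (1 + (?X - y)\<^sup>2)"
        by (rule order.trans[OF C1(2) sh[OF r C1(1)]])
      have "norm (?D r y) \<le> norm (?K (x + k * r - y)) * norm (wt r y) + (\<bar>k\<bar> * norm (?K1 (x + k * r - y))) * norm (w r y)"
        by (rule order.trans[OF norm_triangle_ineq]) (simp add: norm_mult)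
      also have "\<dots> \<le> (?R * C / (1 + (?X - y)\<^sup>2)) * B + (\<bar>k\<bar> * (?R * C1 / (1 + (?X - y)\<^sup>2))) * B"
        by (intro add_mono mult_mono mult_left_mono 1 2 bound r)
           (use B C(1) C1(1) in \<open>auto intro!: mult_nonneg_nonneg divide_nonneg_nonneg\<close>)
      also have "\<dots> = (?R * (C + \<bar>k\<bar> * C1) / (1 + (?X - y)\<^sup>2)) * B"
        by (simp add: add_divide_distrib algebra_simps)
      finally show ?thesis .
    qed
    show "integrable lborel (\<lambda>y. (?R * (C + \<bar>k\<bar> * C1) / (1 + (?X - y)\<^sup>2)) * B)"
      by (intro integrable_mult_left translate_integrable(2)[OF decay_integrable[of "?R * (C + \<bar>k\<bar> * C1)"]])
    show "?D t \<in> borel_measurable borel" by measurable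
  qed
  have wt_eq: "wt t = (\<lambda>y. (\<i> / 2) * wxx y - \<i> * h y)" using eq by blast
  have c_bdm: "(\<lambda>y. c * f y) \<in> bdm" if "f \<in> bdm" for c f by (rule bdm_mult[OF bdm_const that])
  have "(LINT y|lborel. ?D t y) = fmult m (wt t) ?X + of_real k * fmult ?m1 (w t) ?X"
  proof -
    have "(LINT y|lborel. ?D t y) = fmult m (wt t) ?X + (LINT y|lborel. of_real k * (?K1 (?X - y) * w t y))"
      unfolding fmult_def mult.assoc[of "complex_of_real k"]
      by (rule Bochner_Integration.integral_add[OF fmult_integrable[OF m wt] integrable_mult_right[OF fmult_integrable[OF m1 wt0]]])
    then show ?thesis by (simp add: fmult_def)
  qed
  also have "fmult m (wt t) ?X = (\<i> / 2) * fmult m wxx ?X - \<i> * fmult m h ?X"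
    unfolding wt_eq by (simp only: fmult_diff_right m c_bdm wxx h fmult_cmult_right)
  also have "fmult m wxx ?X = fmult ?m2 (w t) ?X"
    using fmult_of_deriv[OF m wx(1) wxx] fmult_of_deriv[OF m1 wt0 wx] by simp
  finally have int: "(LINT y|lborel. ?D t y) =
      (\<i> / 2) * fmult ?m2 (w t) ?X - \<i> * fmult m h ?X + of_real k * fmult ?m1 (w t) ?X" .
  \<comment> \<open>Completing the square: the motion of the frame supplies the part linear in
    \<open>\<xi>\<close>, the derivative of the phase supplies the constant part.\<close>
  have "(\<lambda>\<xi>. (of_real \<xi> - of_real k)\<^sup>2 * m \<xi>) = (\<lambda>\<xi>. (- 1) * ?m2 \<xi> + ((2 * \<i> * of_real k) * ?m1 \<xi> + (of_real k)\<^sup>2 * m \<xi>))"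
    by (rule ext) (simp add: power2_eq_square algebra_simps)
  moreover have "(\<lambda>\<xi>. (- 1) * ?m2 \<xi>) \<in> schwartz" "(\<lambda>\<xi>. (2 * \<i> * of_real k) * ?m1 \<xi>) \<in> schwartz" "(\<lambda>\<xi>. (of_real k)\<^sup>2 * m \<xi>) \<in> schwartz"
    by (rule schwartz_cmult[OF m2], rule schwartz_cmult[OF m1], rule schwartz_cmult[OF m])
  ultimately have sq: "fmult (\<lambda>\<xi>. (of_real \<xi> - of_real k)\<^sup>2 * m \<xi>) (w t) ?X =
      - fmult ?m2 (w t) ?X + ((2 * \<i> * of_real k) * fmult ?m1 (w t) ?X + (of_real k)\<^sup>2 * fmult m (w t) ?X)"
    by (simp only: fmult_add_left schwartz_add wt0 fmult_cmult_left) simp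
  have cisd: "((\<lambda>r. cis (- (k\<^sup>2 / 2) * r)) has_vector_derivative (\<i> * of_real (- (k\<^sup>2 / 2)) * cis (- (k\<^sup>2 / 2) * t))) (at t)"
    by (rule cis_deriv) (auto intro!: derivative_eq_intros)
  have "cis (- (k\<^sup>2 / 2) * t) * (LINT y|lborel. ?D t y) + (\<i> * of_real (- (k\<^sup>2 / 2)) * cis (- (k\<^sup>2 / 2) * t)) * fmult m (w t) ?X =
      cis (- (k\<^sup>2 / 2) * t) * (- (\<i> / 2) * fmult (\<lambda>\<xi>. (of_real \<xi> - of_real k)\<^sup>2 * m \<xi>) (w t) ?X - \<i> * fmult m h ?X)"
    unfolding int sq by (simp add: power2_eq_square algebra_simps)
  then show ?thesis using has_vector_derivative_mult[OF cisd der1] by simp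
qed

context window
begin

section \<open>From the given flow to solutions with bounds\<close>

lemma supn_le_Xn: "f \<in> bdm \<Longrightarrow> continuous_on UNIV f \<Longrightarrow> s \<ge> 0 \<Longrightarrow> supn f \<le> Xn s f"
  by (cases "Xn s f < \<infinity>") (auto intro: blk_series(2) simp: not_less top_unique)

text \<open>The square alone is unbounded. The three windows around \<open>k\<close> sum to 1 on the
  support of \<open>eta k\<close>, so the factor changes nothing on that block, and it makes the
  symbol a Schwartz function. All these symbols are translates of \<open>square_mult 0\<close>, so
  they share the kernel norm \<open>square_ker\<close>.\<close>

definition square_mult :: "int \<Rightarrow> real \<Rightarrow> complex" where
  "square_mult k \<xi> = (of_real \<xi> - of_int k)\<^sup>2 * (eta (k - 1) \<xi> + (eta k \<xi> + eta (k + 1) \<xi>))"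

definition square_ker :: real where "square_ker = ker_norm (square_mult 0)"

lemma square_mult_schwartz: "square_mult k \<in> schwartz"
  unfolding square_mult_def[abs_def] power2_eq_square mult.assoc
  by (intro shift_mult_schwartz schwartz_add eta_schwartz)

lemma square_ker_nonneg: "square_ker \<ge> 0" by (simp add: square_ker_def ker_norm_nonneg)

lemma supn_square_block:
  assumes w: "w \<in> bdm"
  shows "supn (fmult (\<lambda>\<xi>. (of_real \<xi> - of_real (of_int k))\<^sup>2 * eta k \<xi>) w) \<le> ennreal square_ker * supn (blk k w)"
proof -
  have "(\<lambda>\<xi>. (of_real \<xi> - of_real (of_int k))\<^sup>2 * eta k \<xi>) = (\<lambda>\<xi>. square_mult k \<xi> * eta k \<xi>)"
  proof (rule ext)
    fix \<xi>
    show "(of_real \<xi> - of_real (of_int k))\<^sup>2 * eta k \<xi> = square_mult k \<xi> * eta k \<xi>"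
    proof (cases "eta k \<xi> = 0")
      case False
      from eta_support[OF this] have a: "\<bar>\<xi> - of_int k\<bar> < 1" .
      have "(\<Sum>l\<in>{k - 1, k, k + 1}. eta l \<xi>) = 1"
      proof (rule eta_partition)
        fix l :: int assume "\<bar>\<xi> - of_int l\<bar> < 1"
        with a have "\<bar>real_of_int (l - k)\<bar> < 2" by auto
        then have "\<bar>l - k\<bar> < 2" by linarith
        then show "l \<in> {k - 1, k, k + 1}" by auto
      qed simp
      then show ?thesis by (simp add: square_mult_def)
    qed simp
  qed
  then have "fmult (\<lambda>\<xi>. (of_real \<xi> - of_real (of_int k))\<^sup>2 * eta k \<xi>) w = fmult (square_mult k) (blk k w)"
    by (simp add: fmult_fmult square_mult_schwartz eta_schwartz w)
  moreover have "ker_norm (square_mult k) = square_ker"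
  proof -
    have "square_mult k = (\<lambda>\<xi>. square_mult 0 (\<xi> + - of_int k))"
      by (rule ext) (simp add: square_mult_def eta_def algebra_simps)
    then show ?thesis using ker_norm_shift[of "square_mult 0" "- of_int k"] by (simp add: square_ker_def)
  qed
  ultimately show ?thesis using supn_fmult[OF square_mult_schwartz blk_bdm[OF w], of k k] by simp
qed

lemma Xn_continuous:
  fixes w :: "real \<Rightarrow> real \<Rightarrow> complex"
  assumes w: "\<And>t. w t \<in> bdm" "\<And>t. Xn s (w t) < \<infinity>"
    and lim: "\<And>t. ((\<lambda>r. Xn s (\<lambda>x. w r x - w t x)) \<longlongrightarrow> 0) (at t)"
  shows "continuous_on A (\<lambda>t. enn2real (Xn s (w t)))"
proof -
  have "isCont (\<lambda>t. enn2real (Xn s (w t))) t" for t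
    unfolding isCont_def
  proof (rule tendstoI)
    fix e :: real assume e: "e > 0"
    have "\<forall>\<^sub>F r in at t. Xn s (\<lambda>x. w r x - w t x) < ennreal e"
      using order_tendstoD(2)[OF lim[of t], of "ennreal e"] e by simp
    then show "\<forall>\<^sub>F r in at t. dist (enn2real (Xn s (w r))) (enn2real (Xn s (w t))) < e"
    proof eventually_elim
      case (elim r)
      let ?d = "Xn s (\<lambda>x. w r x - w t x)"
      have 1: "Xn s (w r) \<le> ?d + Xn s (w t)"
        using Xn_add[OF bdm_diff[OF w(1)[of r] w(1)[of t]] w(1)[of t], of s] by simp
      have "?d = Xn s (\<lambda>x. w t x - w r x)" using Xn_uminus[of s "\<lambda>x. w r x - w t x"] by simp
      then have 2: "Xn s (w t) \<le> ?d + Xn s (w r)"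
        using Xn_add[OF bdm_diff[OF w(1)[of t] w(1)[of r]] w(1)[of r], of s] by simp
      obtain d a b where d: "?d = ennreal d" "d \<ge> 0" "Xn s (w r) = ennreal a" "a \<ge> 0" "Xn s (w t) = ennreal b" "b \<ge> 0"
        using ennreal_ne_top_cases[OF less_trans[OF elim]] ennreal_ne_top_cases[OF w(2)[of r]] ennreal_ne_top_cases[OF w(2)[of t]]
        by (metis ennreal_less_top infinity_ennreal_def)
      have "a \<le> d + b" "b \<le> d + a" "d < e"
        using 1 2 elim unfolding d by (auto simp: ennreal_less_iff d simp flip: ennreal_plus)
      then show ?case using d by (simp add: dist_real_def abs_less_iff)
    qed
  qed
  then show ?thesis by (simp add: continuous_at_imp_continuous_on)
qed

text \<open>The nonlinearity is a product of \<open>u\<close> and its conjugate, ready for the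
  algebra property. The last clause is what differentiation under a convolution integral in time
  asks for: bounds uniform in space on a neighbourhood of each time.\<close>

definition regular_solution ::
    "real \<Rightarrow> (real \<Rightarrow> real \<Rightarrow> complex) \<Rightarrow> (real \<Rightarrow> real \<Rightarrow> complex) \<Rightarrow>
     (real \<Rightarrow> real \<Rightarrow> complex) \<Rightarrow> (real \<Rightarrow> real \<Rightarrow> complex) \<Rightarrow> bool" where
  "regular_solution \<kappa> u ut ux uxx \<longleftrightarrow>
    (\<forall>t. u t \<in> bdm \<and> ut t \<in> bdm \<and> ux t \<in> bdm \<and> uxx t \<in> bdm \<and> continuous_on UNIV (u t) \<and> Xn 5 (u t) < \<infinity>) \<and>
    (\<forall>t x. ((\<lambda>r. u r x) has_vector_derivative ut t x) (at t) \<and>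
       (u t has_vector_derivative ux t x) (at x) \<and> (ux t has_vector_derivative uxx t x) (at x) \<and>
       ut t x = (\<i> / 2) * uxx t x - \<i> * (of_real \<kappa> * (u t x * cnj (u t x) * u t x))) \<and>
    (\<forall>t. ((\<lambda>r. Xn 5 (\<lambda>x. u r x - u t x)) \<longlongrightarrow> 0) (at t)) \<and>
    (\<forall>t. \<exists>e>0. \<exists>B. \<forall>r\<in>ball t e. \<forall>y. norm (u r y) \<le> B \<and> norm (ut r y) \<le> B)"

lemma local_bound_of_Xn_limit:
  assumes g: "\<And>t. g t \<in> bdm" "\<And>t. continuous_on UNIV (g t)" and s: "s \<ge> 0"
    and lim: "((\<lambda>r. Xn s (\<lambda>x. g r x - g t x)) \<longlongrightarrow> 0) (at t)"
  shows "\<exists>e>0. \<exists>B. \<forall>r\<in>ball t e. \<forall>y. norm (g r y) \<le> B"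
proof -
  obtain M where M: "\<And>x. norm (g t x) \<le> M" "M \<ge> 0" using bdmE[OF g(1)] by blast
  from order_tendstoD(2)[OF lim, of "1"] have "\<forall>\<^sub>F r in at t. Xn s (\<lambda>x. g r x - g t x) < 1" by simp
  then obtain e where e: "e > 0" "\<And>r. r \<noteq> t \<Longrightarrow> dist r t < e \<Longrightarrow> Xn s (\<lambda>x. g r x - g t x) < 1"
    by (auto simp: eventually_at)
  have "norm (g r y) \<le> M + 1" if "r \<in> ball t e" for r y
  proof (cases "r = t")
    case True
    then show ?thesis using M(1)[of y] by simp
  next
    case False
    have "ennreal (norm (g r y - g t y)) \<le> supn (\<lambda>x. g r x - g t x)" by (rule supn_upper)
    also have "\<dots> \<le> Xn s (\<lambda>x. g r x - g t x)"
      by (intro supn_le_Xn bdm_diff g continuous_on_diff s)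
    also have "\<dots> \<le> 1" using e(2)[OF False] that by (simp add: dist_commute less_imp_le)
    finally have "norm (g r y - g t y) \<le> 1" by simp
    then show ?thesis using M(1)[of y] norm_triangle_sub[of "g r y" "g t y"] by linarith
  qed
  then show ?thesis using e(1) by blast
qed

text \<open>A bound of Landau-Kolmogorov type: over a step of length 1, \<open>ux x\<close> differs
  from \<open>u (x + 1) - u x\<close> by at most the bound for \<open>uxx\<close>.\<close>

lemma vderiv_bdm:
  assumes u: "u \<in> bdm" "\<And>x. (u has_vector_derivative ux x) (at x)"
    and uxx: "uxx \<in> bdm" "\<And>x. (ux has_vector_derivative uxx x) (at x)"
  shows "ux \<in> bdm"
proof -
  obtain M where M: "\<And>x. norm (u x) \<le> M" using bdmE[OF u(1)] by blast
  obtain L where L: "\<And>x. norm (uxx x) \<le> L" "L \<ge> 0" using bdmE[OF uxx(1)] by blast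
  have lip: "norm (ux a - ux b) \<le> L * norm (a - b)" for a b
    by (rule differentiable_bound[of UNIV ux "\<lambda>x h. h *\<^sub>R uxx x"])
       (use uxx(2) L in \<open>auto simp: has_vector_derivative_def mult.commute[of L] intro!: onorm_bound mult_left_mono\<close>)
  have "norm (ux x) \<le> 2 * M + L" for x
  proof -
    have "norm (u (x + 1) - u x - (x + 1 - x) *\<^sub>R ux x) \<le> norm (x + 1 - x) * L"
    proof (rule vector_differentiable_bound_linearization[where S="{x..x+1}" and f'=ux])
      show "norm (ux z - ux x) \<le> L" if "z \<in> {x..x+1}" for z
        using lip[of z x] mult_left_mono[of "norm (z - x)" 1 L] L(2) that by auto
    qed (auto intro: has_vector_derivative_at_within u(2) simp: closed_segment_eq_real_ivl)
    then have "norm (u (x + 1) - u x - ux x) \<le> L" by simp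
    then show ?thesis
      using norm_triangle_sub[of "ux x" "u (x + 1) - u x"] norm_triangle_ineq4[of "u (x + 1)" "u x"] M[of x] M[of "x + 1"]
      by (simp add: norm_minus_commute)
  qed
  moreover have "continuous_on UNIV ux"
    using uxx(2) by (auto intro!: continuous_at_imp_continuous_on has_vector_derivative_continuous)
  ultimately show ?thesis by (auto intro: bdmI borel_measurable_continuous_onI)
qed

text \<open>
  A classical solution comes without bounds. The derivative in \<open>X\<^sub>3\<close> bounds \<open>ut\<close>, then the equation bounds
  \<open>uxx\<close>, and the mean value theorem bounds \<open>ux\<close>.
\<close>

lemma flow_solution:
  assumes flow: "nls_flow \<eta> \<kappa> \<Phi>" and q: "q \<in> X_space \<eta> 5"
  obtains u ut ux uxx where "\<And>t. \<Phi> t q = reg_dist (u t)" "regular_solution \<kappa> u ut ux uxx" "\<Phi> 0 q = q"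
proof -
  from flow q have "\<exists>u. classical_solution \<kappa> u \<and> (\<forall>t. \<Phi> t q = reg_dist (u t))" and q0: "\<Phi> 0 q = q"
    and c5: "X_continuous \<eta> 5 (\<lambda>t. \<Phi> t q)" and c1: "X_C1 \<eta> 3 (\<lambda>t. \<Phi> t q)"
    unfolding nls_flow_def by auto
  then obtain u where cl: "classical_solution \<kappa> u" and rep: "\<And>t. \<Phi> t q = reg_dist (u t)" by blast
  from cl obtain ut ux uxx where
    cont: "continuous_on UNIV (\<lambda>(t, x). u t x)" "continuous_on UNIV (\<lambda>(t, x). ut t x)" and
    der: "\<And>t x. ((\<lambda>r. u r x) has_vector_derivative ut t x) (at t)"
      "\<And>t x. (u t has_vector_derivative ux t x) (at x)" "\<And>t x. (ux t has_vector_derivative uxx t x) (at x)" and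
    eq: "\<And>t x. \<i> * ut t x = - (1 / 2) * uxx t x + of_real (\<kappa> * (norm (u t x))\<^sup>2) * u t x"
    unfolding classical_solution_def by blast
  have cu: "continuous_on UNIV (u t)" for t
    using der(2) by (auto intro!: continuous_at_imp_continuous_on has_vector_derivative_continuous)
  have cut: "continuous_on UNIV (ut t)" for t
  proof -
    have "continuous_on UNIV ((\<lambda>(t, x). ut t x) \<circ> (\<lambda>x. (t, x)))"
      by (rule continuous_on_compose) (auto intro!: continuous_intros continuous_on_subset[OF cont(2)])
    then show ?thesis by (simp add: o_def)
  qed
  from c5 have X5: "reg_dist (u t) \<in> X_space \<eta> 5" for t by (simp add: X_continuous_def rep)
  note u = X_space_continuous_rep[OF X5 _ cu]
  have ub: "u t \<in> bdm" "Xn 5 (u t) < \<infinity>" for t using u by auto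
  have lim5: "((\<lambda>r. Xn 5 (\<lambda>x. u r x - u t x)) \<longlongrightarrow> 0) (at t)" for t
    using c5 by (simp add: X_continuous_def rep reg_dist_diff ub X_norm_reg_dist bdm_diff)
  from c1 obtain Q' where Q': "X_continuous \<eta> 3 Q'"
    and Qd: "\<And>t. ((\<lambda>h. X_norm \<eta> 3 (\<lambda>\<phi>. (reg_dist (u (t + h)) \<phi> - reg_dist (u t) \<phi>) / of_real h - Q' t \<phi>)) \<longlongrightarrow> 0) (at 0)"
    unfolding X_C1_def rep by blast
  have "\<exists>g. g \<in> bdm \<and> continuous_on UNIV g \<and> Q' t = reg_dist g" for t
    using X_space_rep[of "Q' t" 3] Q' unfolding X_continuous_def by (metis zero_le_numeral)
  then obtain g where g: "\<And>t. g t \<in> bdm" "\<And>t. continuous_on UNIV (g t)" "\<And>t. Q' t = reg_dist (g t)" by metis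
  \<comment> \<open>Convergence of the quotients in the weighted norm implies uniform, hence
    pointwise convergence, and the pointwise time derivative is unique.\<close>
  have utg: "ut t x = g t x" for t x
  proof -
    let ?d = "\<lambda>h x. of_real (1 / h) * (u (t + h) x - u t x) - g t x"
    have db: "?d h \<in> bdm" for h by (intro bdm_diff bdm_mult bdm_const ub g)
    have dc: "continuous_on UNIV (?d h)" for h by (intro continuous_intros cu g)
    have "(\<lambda>\<phi>. (reg_dist (u (t + h)) \<phi> - reg_dist (u t) \<phi>) / of_real h - Q' t \<phi>) = reg_dist (?d h)" for h
    proof (rule ext)
      fix \<phi>
      have 1: "reg_dist (u (t + h)) \<phi> - reg_dist (u t) \<phi> = reg_dist (\<lambda>x. u (t + h) x - u t x) \<phi>"
        using fun_cong[OF reg_dist_diff[OF ub(1)[of "t + h"] ub(1)[of t]], of \<phi>] by simp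
      have "(reg_dist (u (t + h)) \<phi> - reg_dist (u t) \<phi>) / of_real h = of_real (1 / h) * reg_dist (\<lambda>x. u (t + h) x - u t x) \<phi>"
        unfolding 1 by simp
      also have "\<dots> = reg_dist (\<lambda>x. of_real (1 / h) * (u (t + h) x - u t x)) \<phi>" by (rule reg_dist_cmult)
      finally show "(reg_dist (u (t + h)) \<phi> - reg_dist (u t) \<phi>) / of_real h - Q' t \<phi> = reg_dist (?d h) \<phi>"
        using fun_cong[OF reg_dist_diff[OF bdm_mult[OF bdm_const bdm_diff[OF ub(1)[of "t + h"] ub(1)[of t]]] g(1)[of t]], of "of_real (1 / h)" \<phi>]
        by (simp add: g(3))
    qed
    then have "((\<lambda>h. Xn 3 (?d h)) \<longlongrightarrow> 0) (at 0)" using Qd[of t] by (simp only: X_norm_reg_dist[OF db])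
    then have "((\<lambda>h. ennreal (norm (?d h x))) \<longlongrightarrow> 0) (at 0)"
      by (rule tendsto_sandwich[OF _ _ tendsto_const, rotated 2])
         (use order.trans[OF supn_upper supn_le_Xn[OF db dc]] in \<open>auto intro!: always_eventually\<close>)
    then have "((\<lambda>h. norm (?d h x)) \<longlongrightarrow> 0) (at 0)"
      using tendsto_ennreal_iff[of "\<lambda>h. norm (?d h x)" "at 0" 0] by (simp add: always_eventually)
    then have "((\<lambda>h. ?d h x) \<longlongrightarrow> 0) (at 0)" by (rule tendsto_norm_zero_cancel)
    then have "((\<lambda>h. of_real (1 / h) * (u (t + h) x - u t x)) \<longlongrightarrow> g t x) (at 0)" by (rule LIM_zero_cancel)
    then have "((\<lambda>r. (u r x - u t x) /\<^sub>R (r - t)) \<longlongrightarrow> g t x) (at t)"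
      using LIM_offset_zero_cancel[of "\<lambda>r. (u r x - u t x) /\<^sub>R (r - t)" t "g t x"]
      by (simp add: scaleR_conv_of_real divide_inverse)
    then have "((\<lambda>r. u r x) has_vector_derivative g t x) (at t)"
      by (simp add: has_vector_derivative_iff_quotient)
    then show ?thesis using der(1) vector_derivative_unique_at by blast
  qed
  have utb: "ut t \<in> bdm" for t using g(1)[of t] utg[of t] by presburger
  have uxx_eq: "uxx t = (\<lambda>x. 2 * (of_real \<kappa> * (u t x * cnj (u t x) * u t x) - \<i> * ut t x))" for t
  proof (rule ext)
    fix x
    have "uxx t x = 2 * (of_real (\<kappa> * (norm (u t x))\<^sup>2) * u t x - \<i> * ut t x)" unfolding eq by simp
    also have "of_real (\<kappa> * (norm (u t x))\<^sup>2) * u t x = of_real \<kappa> * (u t x * cnj (u t x) * u t x)"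
      by (simp add: complex_norm_square[symmetric] mult.assoc)
    finally show "uxx t x = 2 * (of_real \<kappa> * (u t x * cnj (u t x) * u t x) - \<i> * ut t x)" .
  qed
  have uxxb: "uxx t \<in> bdm" for t
    unfolding uxx_eq by (intro bdm_mult bdm_diff bdm_const bdm_cnj ub utb)
  have uxb: "ux t \<in> bdm" for t by (rule vderiv_bdm[OF ub(1) der(2) uxxb der(3)])
  have limg: "((\<lambda>r. Xn 3 (\<lambda>x. g r x - g t x)) \<longlongrightarrow> 0) (at t)" for t
    using Q' by (simp add: X_continuous_def g reg_dist_diff X_norm_reg_dist bdm_diff)
  have loc: "\<exists>e>0. \<exists>B. \<forall>r\<in>ball t e. \<forall>y. norm (u r y) \<le> B \<and> norm (ut r y) \<le> B" for t
  proof -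
    obtain e1 B1 where 1: "e1 > 0" "\<And>r y. r \<in> ball t e1 \<Longrightarrow> norm (u r y) \<le> B1"
      using local_bound_of_Xn_limit[of u 5 t, OF ub(1) cu _ lim5] by force
    obtain e2 B2 where 2: "e2 > 0" "\<And>r y. r \<in> ball t e2 \<Longrightarrow> norm (g r y) \<le> B2"
      using local_bound_of_Xn_limit[of g 3 t, OF g(1,2) _ limg] by force
    have "norm (u r y) \<le> max B1 B2 \<and> norm (ut r y) \<le> max B1 B2" if "r \<in> ball t (min e1 e2)" for r y
      using 1(2)[of r y] 2(2)[of r y] that by (auto simp: utg intro: le_max_iff_disj[THEN iffD2])
    then show ?thesis using 1(1) 2(1) by (intro exI[of _ "min e1 e2"] exI[of _ "max B1 B2"] conjI) auto
  qed
  have ut_eq: "ut t x = (\<i> / 2) * uxx t x - \<i> * (of_real \<kappa> * (u t x * cnj (u t x) * u t x))" for t x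
    unfolding uxx_eq by (simp add: algebra_simps)
  have "regular_solution \<kappa> u ut ux uxx"
    unfolding regular_solution_def using ub utb uxb uxxb cu der ut_eq lim5 loc by auto
  with that rep q0 show thesis by blast
qed

section \<open>The estimate for differences of solutions\<close>

definition alg_const :: real where "alg_const = 5 * 6 powr 5 * eta_ker"

lemma alg_const_nonneg: "alg_const \<ge> 0" by (simp add: alg_const_def eta_ker_nonneg)

lemma Xn_mult_real:
  assumes f: "f \<in> bdm" "continuous_on UNIV f" "Xn 5 f \<le> ennreal a"
    and g: "g \<in> bdm" "continuous_on UNIV g" "Xn 5 g \<le> ennreal b" and ab: "0 \<le> a" "0 \<le> b"
  shows "Xn 5 (\<lambda>x. f x * g x) \<le> ennreal (alg_const * (a * b))"
proof -
  have fin: "Xn 5 f < \<infinity>" "Xn 5 g < \<infinity>"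
    using f(3) g(3) by (auto simp: ennreal_less_top elim!: le_less_trans)
  have "Xn 5 (\<lambda>x. f x * g x) \<le> ennreal alg_const * (Xn 5 f * Xn 5 g)"
    unfolding alg_const_def by (rule Xn_mult[OF f(1,2) fin(1) g(1,2) fin(2)]) simp
  also have "\<dots> \<le> ennreal alg_const * (ennreal a * ennreal b)" by (intro mult_left_mono mult_mono f g) auto
  also have "\<dots> = ennreal (alg_const * (a * b))" using ab alg_const_nonneg by (simp add: ennreal_mult)
  finally show ?thesis .
qed

text \<open>One factor is exchanged at a time: with \<open>w = u - v\<close> the difference is
  \<open>w * cnj u * u + v * cnj w * u + v * cnj v * w\<close>. Three terms with two products each
  give the constant \<open>3 * alg_const^2\<close>.\<close>

lemma Xn_cubic_difference:
  assumes u: "u \<in> bdm" "continuous_on UNIV u" "Xn 5 u \<le> ennreal M"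
    and v: "v \<in> bdm" "continuous_on UNIV v" "Xn 5 v \<le> ennreal M"
    and d: "Xn 5 (\<lambda>x. u x - v x) \<le> ennreal d" "0 \<le> d" and M: "0 \<le> M" and k: "\<bar>\<kappa>\<bar> = 1"
  shows "Xn 5 (\<lambda>x. of_real \<kappa> * (u x * cnj (u x) * u x) - of_real \<kappa> * (v x * cnj (v x) * v x)) \<le>
    ennreal (3 * alg_const\<^sup>2 * M\<^sup>2 * d)"
proof -
  let ?w = "\<lambda>x. u x - v x"
  have w: "?w \<in> bdm" "continuous_on UNIV ?w" by (intro bdm_diff u v, intro continuous_intros u v)
  have prod3: "Xn 5 (\<lambda>x. f x * cnj (g x) * h x) \<le> ennreal (alg_const * ((alg_const * (a * b)) * c))"
    if "f \<in> bdm" "continuous_on UNIV f" "Xn 5 f \<le> ennreal a" "0 \<le> a"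
      "g \<in> bdm" "continuous_on UNIV g" "Xn 5 g \<le> ennreal b" "0 \<le> b"
      "h \<in> bdm" "continuous_on UNIV h" "Xn 5 h \<le> ennreal c" "0 \<le> c" for f g h a b c
    using that alg_const_nonneg
    by (intro Xn_mult_real bdm_mult bdm_cnj continuous_intros) (auto simp: Xn_cnj)
  let ?A = "\<lambda>x. ?w x * cnj (u x) * u x" and ?B = "\<lambda>x. v x * cnj (?w x) * u x" and ?C = "\<lambda>x. v x * cnj (v x) * ?w x"
  have A: "Xn 5 ?A \<le> ennreal (alg_const\<^sup>2 * M\<^sup>2 * d)"
    using prod3[OF w d u M u M] by (simp add: power2_eq_square mult_ac)
  have B: "Xn 5 ?B \<le> ennreal (alg_const\<^sup>2 * M\<^sup>2 * d)"
    using prod3[OF v M w d u M] by (simp add: power2_eq_square mult_ac)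
  have C: "Xn 5 ?C \<le> ennreal (alg_const\<^sup>2 * M\<^sup>2 * d)"
    using prod3[OF v M v M w d] by (simp add: power2_eq_square mult_ac)
  have bd: "?A \<in> bdm" "?B \<in> bdm" "?C \<in> bdm" by (intro bdm_mult bdm_cnj u v w)+
  have eq: "(\<lambda>x. of_real \<kappa> * (u x * cnj (u x) * u x) - of_real \<kappa> * (v x * cnj (v x) * v x)) =
      (\<lambda>x. of_real \<kappa> * (?A x + (?B x + ?C x)))"
    by (rule ext) (simp add: algebra_simps)
  have "Xn 5 (\<lambda>x. of_real \<kappa> * (u x * cnj (u x) * u x) - of_real \<kappa> * (v x * cnj (v x) * v x)) =
      Xn 5 (\<lambda>x. ?A x + (?B x + ?C x))"
  proof -
    from k have "\<kappa> = 1 \<or> \<kappa> = -1" by linarith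
    then show ?thesis unfolding eq using Xn_uminus[of 5 "\<lambda>x. ?A x + (?B x + ?C x)"] by (elim disjE) simp_all
  qed
  also have "\<dots> \<le> Xn 5 ?A + (Xn 5 ?B + Xn 5 ?C)"
    by (rule order.trans[OF Xn_add[OF bd(1) bdm_add[OF bd(2,3)]] add_left_mono[OF Xn_add[OF bd(2,3)]]])
  also have "\<dots> \<le> ennreal (alg_const\<^sup>2 * M\<^sup>2 * d) + (ennreal (alg_const\<^sup>2 * M\<^sup>2 * d) + ennreal (alg_const\<^sup>2 * M\<^sup>2 * d))"
    by (intro add_mono A B C)
  also have "\<dots> = ennreal (3 * alg_const\<^sup>2 * M\<^sup>2 * d)"
    using d(2) by (simp flip: ennreal_plus)
  finally show ?thesis .
qed

text \<open>
  Choosing a point and a phase for each block turns the weighted sum of suprema into the modulus of one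
  scalar function of time, so that suprema never have to be differentiated or integrated.
\<close>

lemma solution_difference_bound:
  assumes S1: "regular_solution \<kappa> u ut ux uxx" and S2: "regular_solution \<kappa> v vt vx vxx"
    and k: "\<bar>\<kappa>\<bar> = 1" and \<sigma>: "\<bar>\<sigma>\<bar> = 1" and s0: "s0 > 0"
    and d0: "Xn 5 (\<lambda>x. u 0 x - v 0 x) \<le> ennreal d0" "0 \<le> d0"
    and E: "\<And>s. 0 < s \<Longrightarrow> s < s0 \<Longrightarrow> Xn 5 (\<lambda>x. u (\<sigma> * s) x - v (\<sigma> * s) x) \<le> ennreal (d * exp (L * s))"
    and M: "\<And>s. 0 < s \<Longrightarrow> s < s0 \<Longrightarrow> Xn 5 (u (\<sigma> * s)) \<le> ennreal M"
           "\<And>s. 0 < s \<Longrightarrow> s < s0 \<Longrightarrow> Xn 5 (v (\<sigma> * s)) \<le> ennreal M" "0 \<le> M"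
    and L: "L = square_ker / 2 + 3 * alg_const\<^sup>2 * M\<^sup>2" and d: "0 \<le> d"
  shows "Xn 5 (\<lambda>x. u (\<sigma> * s0) x - v (\<sigma> * s0) x) \<le> ennreal (d0 + (d * exp (L * s0) - d))"
proof (rule Xn_leI)
  fix K :: "int set" assume K: "finite K"
  let ?w = "\<lambda>t x. u t x - v t x"
  let ?wt = "\<lambda>t x. ut t x - vt t x"
  let ?h = "\<lambda>t x. of_real \<kappa> * (u t x * cnj (u t x) * u t x) - of_real \<kappa> * (v t x * cnj (v t x) * v t x)"
  let ?c = "\<lambda>k. japanese_bracket k powr 5"
  have c0: "?c k \<ge> 0" for k by simp
  have uB: "u t \<in> bdm" "ut t \<in> bdm" "ux t \<in> bdm" "uxx t \<in> bdm" "continuous_on UNIV (u t)" for t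
    using S1 by (auto simp: regular_solution_def)
  have vB: "v t \<in> bdm" "vt t \<in> bdm" "vx t \<in> bdm" "vxx t \<in> bdm" "continuous_on UNIV (v t)" for t
    using S2 by (auto simp: regular_solution_def)
  have uD: "((\<lambda>r. u r x) has_vector_derivative ut t x) (at t)" "(u t has_vector_derivative ux t x) (at x)"
     "(ux t has_vector_derivative uxx t x) (at x)"
     "ut t x = (\<i> / 2) * uxx t x - \<i> * (of_real \<kappa> * (u t x * cnj (u t x) * u t x))" for t x
    using S1 unfolding regular_solution_def by blast+
  have vD: "((\<lambda>r. v r x) has_vector_derivative vt t x) (at t)" "(v t has_vector_derivative vx t x) (at x)"
     "(vx t has_vector_derivative vxx t x) (at x)"
     "vt t x = (\<i> / 2) * vxx t x - \<i> * (of_real \<kappa> * (v t x * cnj (v t x) * v t x))" for t x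
    using S2 unfolding regular_solution_def by blast+
  have hb: "?h t \<in> bdm" for t by (intro bdm_diff bdm_mult bdm_const bdm_cnj uB vB)
  have wb: "?w t \<in> bdm" for t by (intro bdm_diff uB vB)
  \<comment> \<open>Block \<open>k\<close> of the difference, followed from \<open>x\<close> along
    the moving frame with its phase removed, as in \<open>moving_frame_derivative\<close>.\<close>
  define P where "P = (\<lambda>k x t. cis (- ((real_of_int k)\<^sup>2 / 2) * t) * blk k (?w t) (x + real_of_int k * t))"
  define P' where "P' = (\<lambda>k x t. cis (- ((real_of_int k)\<^sup>2 / 2) * t) *
     (- (\<i> / 2) * fmult (\<lambda>\<xi>. (of_real \<xi> - of_real (of_int k))\<^sup>2 * eta k \<xi>) (?w t) (x + of_int k * t)
      - \<i> * blk k (?h t) (x + of_int k * t)))"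
  have derP: "(P k x has_vector_derivative P' k x t) (at t)" for k x t
  proof -
    obtain e1 B1 where 1: "e1 > 0" "\<And>r y. r \<in> ball t e1 \<Longrightarrow> norm (u r y) \<le> B1 \<and> norm (ut r y) \<le> B1"
      using S1 unfolding regular_solution_def by metis
    obtain e2 B2 where 2: "e2 > 0" "\<And>r y. r \<in> ball t e2 \<Longrightarrow> norm (v r y) \<le> B2 \<and> norm (vt r y) \<le> B2"
      using S2 unfolding regular_solution_def by metis
    show ?thesis unfolding P_def P'_def
    proof (rule moving_frame_derivative[OF eta_schwartz, where e="min e1 e2" and B="B1 + B2" and wt="?wt"
          and wx="\<lambda>x. ux t x - vx t x" and wxx="\<lambda>x. uxx t x - vxx t x"])
      show "norm (?w r y) \<le> B1 + B2" "norm (?wt r y) \<le> B1 + B2" if "r \<in> ball t (min e1 e2)" for r y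
        using 1(2)[of r y] 2(2)[of r y] that
        by (auto intro!: order.trans[OF norm_triangle_ineq4] add_mono)
      show "?wt t y = (\<i> / 2) * (uxx t y - vxx t y) - \<i> * ?h t y" for y
        unfolding uD(4) vD(4) by (simp add: algebra_simps)
      show "(?w t has_vector_derivative ux t y - vx t y) (at y)" for y
        by (intro has_vector_derivative_diff uD vD)
      show "((\<lambda>x. ux t x - vx t x) has_vector_derivative uxx t y - vxx t y) (at y)" for y
        by (intro has_vector_derivative_diff uD vD)
      show "((\<lambda>r. ?w r y) has_vector_derivative ?wt r y) (at r)" for r y
        by (intro has_vector_derivative_diff uD vD)
    qed (use 1(1) 2(1) in \<open>auto intro!: bdm_diff uB vB hb\<close>)
  qed
  have lin: "ennreal (c * a + b) = ennreal c * ennreal a + ennreal b" if "0 \<le> c" "0 \<le> a" "0 \<le> b" for a b c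
    using that by (simp add: ennreal_mult)
  have supn_eq: "supn f = (SUP x. ennreal (norm (f x)))" for f by (simp add: supn_def)
  let ?R = "ennreal (d0 + (d * exp (L * s0) - d))"
  have points: "(\<Sum>k\<in>K. ennreal (?c k * norm (blk k (?w (\<sigma> * s0)) (y k)))) + 0 \<le> ?R" for y
  proof -
    \<comment> \<open>The starting points are chosen so that the frame of block \<open>k\<close>
      arrives at \<open>y k\<close> at the final time. The factors \<open>\<theta>\<close> then
      align the blocks there, which makes \<open>F s0\<close> equal to the weighted sum of their
      moduli; at other times they have modulus at most 1.\<close>
    define x where "x = (\<lambda>k. y k - real_of_int k * (\<sigma> * s0))"
    define \<theta> where "\<theta> = (\<lambda>k. cnj (sgn (P k (x k) (\<sigma> * s0))))"
    have \<theta>: "norm (\<theta> k) \<le> 1" for k by (simp add: \<theta>_def norm_sgn)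
    define F where "F = (\<lambda>s. \<Sum>k\<in>K. of_real (?c k) * \<theta> k * P k (x k) (\<sigma> * s))"
    define F' where "F' = (\<lambda>s. \<Sum>k\<in>K. of_real (?c k) * \<theta> k * (of_real \<sigma> * P' k (x k) (\<sigma> * s)))"
    have derF: "(F has_vector_derivative F' s) (at s)" for s
      unfolding F_def F'_def
    proof (intro has_vector_derivative_sum has_vector_derivative_mult_right)
      fix k
      have "((\<lambda>s. \<sigma> * s) has_vector_derivative \<sigma>) (at s)"
        by (auto intro!: derivative_eq_intros simp flip: has_real_derivative_iff_has_vector_derivative)
      from vector_diff_chain_at[OF this derP[of k "x k"]]
      show "((\<lambda>s. P k (x k) (\<sigma> * s)) has_vector_derivative of_real \<sigma> * P' k (x k) (\<sigma> * s)) (at s)"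
        by (simp add: o_def scaleR_conv_of_real)
    qed
    have contF: "continuous_on A F" for A
      using derF by (auto intro!: continuous_at_imp_continuous_on has_vector_derivative_continuous)
    \<comment> \<open>The bound is the derivative of the barrier: \<open>square_ker / 2\<close>
      comes from the linear part, the remainder of \<open>L\<close> from the cubic
      difference.\<close>
    have bnd: "norm (F' s) \<le> d * exp (L * s) * L" if s: "0 < s" "s < s0" for s
    proof -
      let ?t = "\<sigma> * s"
      let ?e = "d * exp (L * s)"
      have e0: "0 \<le> ?e" using d by simp
      have n1: "ennreal (norm (P' k (x k) ?t)) \<le> ennreal (square_ker / 2) * supn (blk k (?w ?t)) + supn (blk k (?h ?t))" for k
      proof -
        let ?z = "x k + of_int k * ?t" and ?q = "fmult (\<lambda>\<xi>. (of_real \<xi> - of_real (of_int k))\<^sup>2 * eta k \<xi>) (?w ?t)"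
        have "norm (P' k (x k) ?t) \<le> (1 / 2) * norm (?q ?z) + norm (blk k (?h ?t) ?z)"
          unfolding P'_def norm_mult norm_cis mult_1
          by (rule order.trans[OF norm_triangle_ineq4]) (simp add: norm_mult norm_divide)
        then have "ennreal (norm (P' k (x k) ?t)) \<le> ennreal ((1 / 2) * norm (?q ?z) + norm (blk k (?h ?t) ?z))"
          by (rule ennreal_leI)
        also have "\<dots> = ennreal (1 / 2) * ennreal (norm (?q ?z)) + ennreal (norm (blk k (?h ?t) ?z))"
          by (rule lin) simp_all
        also have "\<dots> \<le> ennreal (1 / 2) * (ennreal square_ker * supn (blk k (?w ?t))) + supn (blk k (?h ?t))"
          by (intro add_mono mult_left_mono supn_upper order.trans[OF supn_upper supn_square_block[OF wb]]) auto
        also have "\<dots> = ennreal (square_ker / 2) * supn (blk k (?w ?t)) + supn (blk k (?h ?t))"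
          using square_ker_nonneg ennreal_mult'[of "1 / 2" square_ker] by (simp only: mult.assoc[symmetric]) simp
        finally show ?thesis .
      qed
      have "norm (F' s) \<le> (\<Sum>k\<in>K. ?c k * norm (P' k (x k) ?t))"
        unfolding F'_def
      proof (rule order.trans[OF norm_sum], rule sum_mono)
        fix k
        have "norm (\<theta> k) * norm (P' k (x k) ?t) \<le> 1 * norm (P' k (x k) ?t)" by (intro mult_right_mono \<theta>) auto
        then show "norm (of_real (?c k) * \<theta> k * (of_real \<sigma> * P' k (x k) ?t)) \<le> ?c k * norm (P' k (x k) ?t)"
          using \<sigma> by (simp add: norm_mult mult.assoc mult_left_mono)
      qed
      then have "ennreal (norm (F' s)) \<le> (\<Sum>k\<in>K. ennreal (?c k) * ennreal (norm (P' k (x k) ?t)))"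
        by (simp add: ennreal_leI sum_ennreal flip: ennreal_mult)
      also have "\<dots> \<le> (\<Sum>k\<in>K. ennreal (?c k) * (ennreal (square_ker / 2) * supn (blk k (?w ?t)) + supn (blk k (?h ?t))))"
        by (intro sum_mono mult_left_mono n1) auto
      also have "\<dots> = ennreal (square_ker / 2) * (\<Sum>k\<in>K. ennreal (?c k) * supn (blk k (?w ?t))) +
          (\<Sum>k\<in>K. ennreal (?c k) * supn (blk k (?h ?t)))"
        by (simp add: distrib_left sum.distrib sum_distrib_left mult_ac)
      also have "\<dots> \<le> ennreal (square_ker / 2) * Xn 5 (?w ?t) + Xn 5 (?h ?t)"
        by (intro add_mono mult_left_mono Xn_ge K) auto
      also have "\<dots> \<le> ennreal (square_ker / 2) * ennreal ?e + ennreal (3 * alg_const\<^sup>2 * M\<^sup>2 * ?e)"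
        by (intro add_mono mult_left_mono E s Xn_cubic_difference uB vB M e0 k) auto
      also have "\<dots> = ennreal (?e * L)"
      proof -
        have "a * L = square_ker / 2 * a + 3 * alg_const\<^sup>2 * M\<^sup>2 * a" for a unfolding L by (simp add: algebra_simps)
        from this[of ?e] show ?thesis by (simp only:) (rule lin[symmetric], use square_ker_nonneg e0 in auto)
      qed
      finally show ?thesis using e0 square_ker_nonneg by (simp add: L)
    qed
    have "norm (F s0 - F 0) \<le> d * exp (L * s0) - d * exp (L * 0)"
    proof (rule differentiable_bound_general[OF s0, where f'=F' and \<phi>'="\<lambda>s. d * exp (L * s) * L"])
      show "continuous_on {0..s0} F" by (rule contF)
      show "continuous_on {0..s0} (\<lambda>s. d * exp (L * s))" by (intro continuous_intros)
      show "((\<lambda>s. d * exp (L * s)) has_vector_derivative d * exp (L * s) * L) (at s)" for s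
        by (auto intro!: derivative_eq_intros simp flip: has_real_derivative_iff_has_vector_derivative)
    qed (use derF bnd in auto)
    then have diff: "norm (F s0 - F 0) \<le> d * exp (L * s0) - d" by simp
    have F0: "norm (F 0) \<le> d0"
    proof -
      have "norm (F 0) \<le> (\<Sum>k\<in>K. ?c k * norm (blk k (?w 0) (x k)))"
        unfolding F_def
      proof (rule order.trans[OF norm_sum], rule sum_mono)
        fix k
        have "norm (\<theta> k) * norm (blk k (?w 0) (x k)) \<le> 1 * norm (blk k (?w 0) (x k))" by (intro mult_right_mono \<theta>) auto
        then show "norm (of_real (?c k) * \<theta> k * P k (x k) (\<sigma> * 0)) \<le> ?c k * norm (blk k (?w 0) (x k))"
          by (simp add: P_def norm_mult mult.assoc mult_left_mono)
      qed
      then have "ennreal (norm (F 0)) \<le> (\<Sum>k\<in>K. ennreal (?c k) * ennreal (norm (blk k (?w 0) (x k))))"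
        by (simp add: ennreal_leI sum_ennreal flip: ennreal_mult)
      also have "\<dots> \<le> (\<Sum>k\<in>K. ennreal (?c k) * supn (blk k (?w 0)))"
        by (intro sum_mono mult_left_mono supn_upper) auto
      also have "\<dots> \<le> Xn 5 (?w 0)" by (rule Xn_ge[OF K])
      also have "\<dots> \<le> ennreal d0" by (rule d0)
      finally show ?thesis using d0(2) by simp
    qed
    have "F s0 = of_real (\<Sum>k\<in>K. ?c k * norm (blk k (?w (\<sigma> * s0)) (y k)))"
      unfolding F_def of_real_sum
    proof (rule sum.cong[OF refl])
      fix k
      have "\<theta> k * P k (x k) (\<sigma> * s0) = of_real (norm (P k (x k) (\<sigma> * s0)))"
      proof -
        have "cnj (sgn z) * z = of_real (norm z)" for z :: complex
          by (simp add: sgn_eq complex_cnj_divide complex_norm_square[symmetric] power2_eq_square mult.commute)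
        then show ?thesis by (simp add: \<theta>_def)
      qed
      moreover have "norm (P k (x k) (\<sigma> * s0)) = norm (blk k (?w (\<sigma> * s0)) (y k))"
        by (simp add: P_def x_def norm_mult)
      ultimately show "of_real (?c k) * \<theta> k * P k (x k) (\<sigma> * s0) = complex_of_real (?c k * norm (blk k (?w (\<sigma> * s0)) (y k)))"
        by (simp add: mult.assoc)
    qed
    then have "(\<Sum>k\<in>K. ?c k * norm (blk k (?w (\<sigma> * s0)) (y k))) \<le> norm (F s0)"
      by (simp only: norm_of_real abs_ge_self)
    also have "\<dots> \<le> d0 + (d * exp (L * s0) - d)"
      using diff F0 norm_triangle_sub[of "F s0" "F 0"] by linarith
    finally show ?thesis by (simp add: sum_ennreal ennreal_leI)
  qed
  \<comment> \<open>The right side \<open>?R\<close> does not depend on the points, so all of them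
    may now be varied independently.\<close>
  have "ennreal (?c k) * supn (blk k (?w (\<sigma> * s0))) = (SUP x. ennreal (?c k * norm (blk k (?w (\<sigma> * s0)) x)))" for k
    unfolding supn_eq by (simp add: SUP_mult_left_ennreal ennreal_mult)
  then have "(\<Sum>k\<in>K. ennreal (?c k) * supn (blk k (?w (\<sigma> * s0)))) =
     (\<Sum>k\<in>K. SUP x. ennreal (?c k * norm (blk k (?w (\<sigma> * s0)) x))) + 0"
    by (simp only: add_0_right)
  also have "\<dots> \<le> ?R" by (rule sum_SUP_le_ennreal[OF K points])
  finally show "(\<Sum>k\<in>K. ennreal (?c k) * supn (blk k (?w (\<sigma> * s0)))) \<le> ?R" .
qed

text \<open>
  At the first time \<open>s\<^sub>0\<close> at which the norm \<open>D\<close> of the difference reaches the barrier \<open>d * exp (L * s)\<close>, the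
  previous lemma bounds it by \<open>D 0 - d + d * exp (L * s\<^sub>0)\<close>, which is below the barrier.
\<close>

lemma solution_stability:
  assumes S1: "regular_solution \<kappa> u ut ux uxx" and S2: "regular_solution \<kappa> v vt vx vxx"
    and k: "\<bar>\<kappa>\<bar> = 1" and \<sigma>: "\<bar>\<sigma>\<bar> = 1"
    and M: "\<And>t. \<bar>t\<bar> \<le> T \<Longrightarrow> Xn 5 (v t) \<le> ennreal M" "0 \<le> M"
    and L: "L = square_ker / 2 + 3 * alg_const\<^sup>2 * (M + 1)\<^sup>2"
    and d: "Xn 5 (\<lambda>x. u 0 x - v 0 x) < ennreal d" "d > 0" "d * exp (L * T) \<le> 1"
    and s: "0 \<le> s" "s \<le> T"
  shows "Xn 5 (\<lambda>x. u (\<sigma> * s) x - v (\<sigma> * s) x) \<le> ennreal (d * exp (L * s))"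
proof (rule ccontr)
  assume neg: "\<not> ?thesis"
  let ?w = "\<lambda>t x. u t x - v t x"
  have uB: "u t \<in> bdm" "Xn 5 (u t) < \<infinity>" "((\<lambda>r. Xn 5 (\<lambda>x. u r x - u t x)) \<longlongrightarrow> 0) (at t)" for t
    using S1 by (auto simp: regular_solution_def)
  have vB: "v t \<in> bdm" "Xn 5 (v t) < \<infinity>" "((\<lambda>r. Xn 5 (\<lambda>x. v r x - v t x)) \<longlongrightarrow> 0) (at t)" for t
    using S2 by (auto simp: regular_solution_def)
  have wB: "?w t \<in> bdm" "Xn 5 (?w t) < \<infinity>" for t
    using bdm_diff[OF uB(1) vB(1)] le_less_trans[OF Xn_diff[OF uB(1) vB(1)]] uB(2) vB(2)
    by (auto simp: ennreal_add_less_top)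
  have wlim: "((\<lambda>r. Xn 5 (\<lambda>x. ?w r x - ?w t x)) \<longlongrightarrow> 0) (at t)" for t
  proof (rule tendsto_sandwich[OF _ _ tendsto_const])
    show "((\<lambda>r. Xn 5 (\<lambda>x. u r x - u t x) + Xn 5 (\<lambda>x. v r x - v t x)) \<longlongrightarrow> 0) (at t)"
      using tendsto_add[OF uB(3)[of t] vB(3)[of t]] by simp
    have "Xn 5 (\<lambda>x. ?w r x - ?w t x) \<le> Xn 5 (\<lambda>x. u r x - u t x) + Xn 5 (\<lambda>x. v r x - v t x)" for r
    proof -
      have "(\<lambda>x. ?w r x - ?w t x) = (\<lambda>x. (u r x - u t x) - (v r x - v t x))" by auto
      then show ?thesis using Xn_diff[OF bdm_diff[OF uB(1)[of r] uB(1)[of t]] bdm_diff[OF vB(1)[of r] vB(1)[of t]], of 5] by simp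
    qed
    then show "\<forall>\<^sub>F r in at t. Xn 5 (\<lambda>x. ?w r x - ?w t x) \<le> Xn 5 (\<lambda>x. u r x - u t x) + Xn 5 (\<lambda>x. v r x - v t x)"
      by simp
  qed simp
  define D where "D = (\<lambda>t. enn2real (Xn 5 (?w t)))"
  have D: "Xn 5 (?w t) = ennreal (D t)" "D t \<ge> 0" for t
    using wB(2)[of t] by (auto simp: D_def ennreal_enn2real)
  have Dcont: "continuous_on UNIV D" unfolding D_def by (rule Xn_continuous[OF wB wlim])
  have L0: "L \<ge> 0" using L square_ker_nonneg by simp
  \<comment> \<open>The times at which the barrier is reached. The set is closed by continuity of
    the norm, so its infimum is a first such time, and it is positive because
    \<open>D 0 < d\<close>.\<close>
  define A where "A = {r \<in> {0..T}. d * exp (L * r) \<le> D (\<sigma> * r)}"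
  have "s \<in> A" using neg s d(2) D(2) by (auto simp: A_def D ennreal_le_iff)
  have "closed A"
  proof -
    have "closed ({0..T} \<inter> {r. d * exp (L * r) \<le> D (\<sigma> * r)})"
      by (intro closed_Int closed_Collect_le continuous_intros continuous_on_compose2[OF Dcont]) auto
    then show ?thesis by (simp add: A_def Int_def)
  qed
  have "bdd_below A" by (rule bdd_belowI[of _ 0]) (auto simp: A_def)
  define s0 where "s0 = Inf A"
  have s0A: "s0 \<in> A" unfolding s0_def using \<open>s \<in> A\<close> \<open>closed A\<close> \<open>bdd_below A\<close> by (intro closed_contains_Inf) auto
  have D0: "D 0 < d" using d(1,2) D[of 0] by (simp add: ennreal_less_iff)
  have s0: "0 < s0" "s0 \<le> T"
  proof -
    from s0A have "0 \<le> s0" "s0 \<le> T" "d * exp (L * s0) \<le> D (\<sigma> * s0)" by (auto simp: A_def)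
    moreover from this D0 have "s0 \<noteq> 0" by auto
    ultimately show "0 < s0" "s0 \<le> T" by auto
  qed
  have before: "D (\<sigma> * r) < d * exp (L * r)" if "0 < r" "r < s0" for r
  proof (rule ccontr)
    assume "\<not> ?thesis"
    then have "r \<in> A" using that s0 by (auto simp: A_def)
    then have "s0 \<le> r" unfolding s0_def by (rule cInf_lower[OF _ \<open>bdd_below A\<close>])
    then show False using that by simp
  qed
  have at: "\<bar>\<sigma> * r\<bar> \<le> T" if "0 < r" "r < s0" for r using \<sigma> that s0 by (simp add: abs_mult)
  have "Xn 5 (?w (\<sigma> * s0)) \<le> ennreal (D 0 + (d * exp (L * s0) - d))"
  proof (rule solution_difference_bound[OF S1 S2 k \<sigma> s0(1) _ D(2) _ _ _ _ L less_imp_le[OF d(2)]])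
    show "Xn 5 (?w 0) \<le> ennreal (D 0)" by (simp add: D)
    show "Xn 5 (?w (\<sigma> * r)) \<le> ennreal (d * exp (L * r))" if "0 < r" "r < s0" for r
      unfolding D using before[OF that] by (intro ennreal_leI) simp
    show "Xn 5 (v (\<sigma> * r)) \<le> ennreal (M + 1)" if "0 < r" "r < s0" for r
      by (rule order.trans[OF M(1)[OF at[OF that]]]) (simp add: ennreal_leI)
    \<comment> \<open>Before \<open>s0\<close> the difference lies below the barrier, hence below 1
      by the smallness of \<open>d\<close>; this is where the 1 in \<open>M + 1\<close> is
      spent.\<close>
    show "Xn 5 (u (\<sigma> * r)) \<le> ennreal (M + 1)" if r: "0 < r" "r < s0" for r
    proof -
      have "exp (L * r) \<le> exp (L * T)" using r s0 L0 by (simp add: mult_left_mono)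
      then have "d * exp (L * r) \<le> 1" using d(2,3) mult_left_mono[of "exp (L * r)" "exp (L * T)" d] by linarith
      then have "Xn 5 (?w (\<sigma> * r)) \<le> ennreal 1" unfolding D using before[OF r] by (intro ennreal_leI) simp
      then have "Xn 5 (?w (\<sigma> * r)) + Xn 5 (v (\<sigma> * r)) \<le> ennreal 1 + ennreal M"
        by (intro add_mono M(1) at r)
      moreover have "Xn 5 (u (\<sigma> * r)) \<le> Xn 5 (?w (\<sigma> * r)) + Xn 5 (v (\<sigma> * r))"
        using Xn_add[OF wB(1) vB(1), of 5 "\<sigma> * r" "\<sigma> * r"] by simp
      ultimately show ?thesis using M(2) by (simp add: add.commute flip: ennreal_1 ennreal_plus)
    qed
  qed (use M(2) in auto)
  moreover have "D 0 + (d * exp (L * s0) - d) < d * exp (L * s0)" using D0 by simp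
  moreover have "d * exp (L * s0) \<ge> d" using d(2) L0 s0 by simp
  ultimately have "D (\<sigma> * s0) < d * exp (L * s0)"
    unfolding D using D(2)[of 0] by (subst (asm) ennreal_le_iff) auto
  with s0A show False by (simp add: A_def)
qed

lemma flow_converges_of_X_converges:
  assumes flow: "nls_flow \<eta> \<kappa> \<Phi>" and k: "\<kappa> \<in> {1, -1}" and conv: "X_converges \<eta> 5 F q"
  shows "flow_converges \<eta> \<Phi> F q"
  unfolding flow_converges_def
proof (rule allI, rule tendsto_zero_ennreal)
  fix T e :: real assume e: "0 < e"
  have qX: "q \<in> X_space \<eta> 5" and FX: "\<And>n. F n \<in> X_space \<eta> 5" and lim: "(\<lambda>n. X_norm \<eta> 5 (F n - q)) \<longlonglongrightarrow> 0"
    using conv by (auto simp: X_converges_def)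
  have sol: "\<exists>u ut ux uxx. (\<forall>t. \<Phi> t q = reg_dist (u t)) \<and> regular_solution \<kappa> u ut ux uxx \<and> \<Phi> 0 q = q"
    if "q \<in> X_space \<eta> 5" for q
  proof (rule flow_solution[OF flow that])
    fix u ut ux uxx assume "\<And>t. \<Phi> t q = reg_dist (u t)" "regular_solution \<kappa> u ut ux uxx" "\<Phi> 0 q = q"
    then show ?thesis by (intro exI[of _ u] exI[of _ ut] exI[of _ ux] exI[of _ uxx] conjI allI)
  qed
  obtain v vt vx vxx where v: "\<And>t. \<Phi> t q = reg_dist (v t)" and S2: "regular_solution \<kappa> v vt vx vxx" and v0: "\<Phi> 0 q = q"
    using sol[OF qX] by blast
  have vB: "v t \<in> bdm" "Xn 5 (v t) < \<infinity>" "((\<lambda>r. Xn 5 (\<lambda>x. v r x - v t x)) \<longlongrightarrow> 0) (at t)" for t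
    using S2 by (auto simp: regular_solution_def)
  \<comment> \<open>Continuity of the limiting solution in time bounds its norm on the compact
    interval. Only this solution determines \<open>L\<close>, so \<open>L\<close> is independent of
    \<open>n\<close>.\<close>
  have "compact ((\<lambda>t. enn2real (Xn 5 (v t))) ` {-T..T})"
    by (intro compact_continuous_image Xn_continuous vB) auto
  then have "bounded ((\<lambda>t. enn2real (Xn 5 (v t))) ` {-T..T})" by (rule compact_imp_bounded)
  then obtain M1 where M1: "\<forall>x\<in>(\<lambda>t. enn2real (Xn 5 (v t))) ` {-T..T}. norm x \<le> M1"
    unfolding bounded_iff ..
  define M where "M = max M1 0"
  have M: "M \<ge> 0" "enn2real (Xn 5 (v t)) \<le> M" if "\<bar>t\<bar> \<le> T" for t
  proof -
    have "t \<in> {-T..T}" using that by (simp add: abs_le_iff)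
    with M1 have "norm (enn2real (Xn 5 (v t))) \<le> M1" by blast
    then show "enn2real (Xn 5 (v t)) \<le> M" by (simp add: M_def)
  qed (simp add: M_def)
  have M0: "M \<ge> 0" by (simp add: M_def)
  have M': "Xn 5 (v t) \<le> ennreal M" if "\<bar>t\<bar> \<le> T" for t
    using M(2)[OF that] vB(2)[of t] by (metis ennreal_enn2real ennreal_leI infinity_ennreal_def)
  define L where "L = square_ker / 2 + 3 * alg_const\<^sup>2 * (M + 1)\<^sup>2"
  have L0: "L \<ge> 0" unfolding L_def using square_ker_nonneg by simp
  \<comment> \<open>The barrier must stay below 1 for the stability argument and below
    \<open>e / 2\<close> for the conclusion.\<close>
  define d where "d = min (e / 2) 1 * exp (- (L * T))"
  have d: "d > 0" "d * exp (L * T) \<le> 1" "d * exp (L * T) \<le> e / 2"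
    using e by (auto simp: d_def mult.assoc simp flip: exp_add)
  have "\<forall>\<^sub>F n in sequentially. X_norm \<eta> 5 (F n - q) < ennreal d"
    using order_tendstoD(2)[OF lim, of "ennreal d"] d(1) by simp
  then show "\<forall>\<^sub>F n in sequentially. (SUP t\<in>{t. \<bar>t\<bar> \<le> T}. X_norm \<eta> 5 (\<Phi> t (F n) - \<Phi> t q)) < ennreal e"
  proof eventually_elim
    case (elim n)
    obtain u ut ux uxx where u: "\<And>t. \<Phi> t (F n) = reg_dist (u t)" and S1: "regular_solution \<kappa> u ut ux uxx" and u0: "\<Phi> 0 (F n) = F n"
      using sol[OF FX[of n]] by blast
    have uB: "u t \<in> bdm" for t using S1 by (auto simp: regular_solution_def)
    have X: "X_norm \<eta> 5 (\<Phi> t (F n) - \<Phi> t q) = Xn 5 (\<lambda>x. u t x - v t x)" for t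
      by (simp add: u v reg_dist_diff uB vB X_norm_reg_dist bdm_diff)
    have init: "Xn 5 (\<lambda>x. u 0 x - v 0 x) < ennreal d" using elim X[of 0] u0 v0 by simp
    have "(SUP t\<in>{t. \<bar>t\<bar> \<le> T}. X_norm \<eta> 5 (\<Phi> t (F n) - \<Phi> t q)) \<le> ennreal (e / 2)"
    proof (rule SUP_least)
      fix t assume "t \<in> {t. \<bar>t\<bar> \<le> T}"
      then have t: "\<bar>t\<bar> \<le> T" by simp
      \<comment> \<open>Negative times are reached by the same forward estimate, run with reversed
        sign.\<close>
      define \<sigma> :: real where "\<sigma> = (if t \<ge> 0 then 1 else -1)"
      have \<sigma>: "\<bar>\<sigma>\<bar> = 1" "\<sigma> * \<bar>t\<bar> = t" by (auto simp: \<sigma>_def)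
      have "Xn 5 (\<lambda>x. u (\<sigma> * \<bar>t\<bar>) x - v (\<sigma> * \<bar>t\<bar>) x) \<le> ennreal (d * exp (L * \<bar>t\<bar>))"
        by (rule solution_stability[OF S1 S2 _ \<sigma>(1) M' M0 L_def init d(1,2)]) (use k t in auto)
      also have "\<dots> \<le> ennreal (e / 2)"
      proof (rule ennreal_leI)
        have "d * exp (L * \<bar>t\<bar>) \<le> d * exp (L * T)" using t L0 d(1) by (simp add: mult_left_mono)
        then show "d * exp (L * \<bar>t\<bar>) \<le> e / 2" using d(3) by simp
      qed
      finally show "X_norm \<eta> 5 (\<Phi> t (F n) - \<Phi> t q) \<le> ennreal (e / 2)" unfolding X \<sigma>(2) .
    qed
    also have "\<dots> < ennreal e" using e by (simp add: ennreal_lessI)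
    finally show ?case .
  qed
qed

end

section \<open>Almost periodic functions\<close>

text \<open>An almost period moves any point into \<open>[0, L]\<close>, where compactness bounds
  \<open>f\<close>, at the cost of an error 1.\<close>

lemma bohr_bounded:
  assumes f: "bohr_almost_periodic f" shows "bounded (range f)"
proof -
  from f have cont: "continuous_on UNIV f"
    and ap: "\<And>\<epsilon>. \<epsilon> > 0 \<Longrightarrow> \<exists>L>0. \<forall>a. \<exists>\<tau>\<in>{a..a + L}. \<forall>x. norm (f (x + \<tau>) - f x) \<le> \<epsilon>"
    by (auto simp: bohr_almost_periodic_def)
  obtain L where L: "\<And>a. \<exists>\<tau>\<in>{a..a + L}. \<forall>x. norm (f (x + \<tau>) - f x) \<le> 1" using ap[of 1] by auto
  have "bounded (f ` {0..L})"
    by (intro compact_imp_bounded compact_continuous_image continuous_on_subset[OF cont]) auto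
  then obtain M where M: "\<And>y. y \<in> {0..L} \<Longrightarrow> norm (f y) \<le> M" unfolding bounded_iff by blast
  have "norm (f x) \<le> M + 1" for x
  proof -
    obtain \<tau> where \<tau>: "\<tau> \<in> {-x..-x + L}" "norm (f (x + \<tau>) - f x) \<le> 1" using L[of "-x"] by blast
    then have "norm (f (x + \<tau>)) \<le> M" by (intro M) auto
    then show ?thesis using \<tau>(2) norm_triangle_sub[of "f x" "f (x + \<tau>)"] by (simp add: norm_minus_commute)
  qed
  then show ?thesis by (auto intro: boundedI)
qed

lemma bohr_uniformly_continuous:
  assumes f: "bohr_almost_periodic f" and e: "\<epsilon> > 0"
  obtains \<delta> where "\<delta> > 0" "\<And>x y. \<bar>x - y\<bar> \<le> \<delta> \<Longrightarrow> norm (f x - f y) \<le> \<epsilon>"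
proof -
  from f have cont: "continuous_on UNIV f"
    and ap: "\<And>\<epsilon>. \<epsilon> > 0 \<Longrightarrow> \<exists>L>0. \<forall>a. \<exists>\<tau>\<in>{a..a + L}. \<forall>x. norm (f (x + \<tau>) - f x) \<le> \<epsilon>"
    by (auto simp: bohr_almost_periodic_def)
  obtain L where L: "\<And>a. \<exists>\<tau>\<in>{a..a + L}. \<forall>x. norm (f (x + \<tau>) - f x) \<le> \<epsilon> / 3" using ap[of "\<epsilon> / 3"] e by auto
  \<comment> \<open>The almost period brings \<open>x\<close> into \<open>[0, L]\<close>; the margin
    1 leaves room for the companion \<open>y\<close>, whence the cap 1 on the distance
    below.\<close>
  have "uniformly_continuous_on {-1..L + 1} f"
    by (intro compact_uniformly_continuous continuous_on_subset[OF cont]) auto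
  then obtain d where d: "d > 0" "\<And>x y. x \<in> {-1..L + 1} \<Longrightarrow> y \<in> {-1..L + 1} \<Longrightarrow> dist y x < d \<Longrightarrow> dist (f y) (f x) < \<epsilon> / 3"
    unfolding uniformly_continuous_on_def using e by (metis divide_pos_pos zero_less_numeral)
  have "norm (f x - f y) \<le> \<epsilon>" if xy: "\<bar>x - y\<bar> \<le> min (d / 2) 1" for x y
  proof -
    obtain \<tau> where \<tau>: "\<tau> \<in> {-x..-x + L}" "\<And>x. norm (f (x + \<tau>) - f x) \<le> \<epsilon> / 3" using L[of "-x"] by blast
    have "dist (f (x + \<tau>)) (f (y + \<tau>)) < \<epsilon> / 3"
      by (rule d(2)) (use \<tau>(1) xy d(1) in \<open>auto simp: dist_real_def\<close>)
    then have 1: "norm (f (x + \<tau>) - f (y + \<tau>)) \<le> \<epsilon> / 3" by (simp add: dist_norm)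
    have "f x - f y = (f (x + \<tau>) - f (y + \<tau>)) + (f (y + \<tau>) - f y) - (f (x + \<tau>) - f x)" by simp
    also have "norm \<dots> \<le> \<epsilon> / 3 + \<epsilon> / 3 + \<epsilon> / 3"
      by (intro norm_triangle_le_diff add_mono norm_triangle_le 1 \<tau>(2)) 
    finally show ?thesis by simp
  qed
  then show thesis using that[of "min (d / 2) 1"] d(1) by simp
qed

text \<open>Frequencies of a finite cyclic group, shifted by \<open>pi\<close> into the symmetric
  range in which \<open>norm_one_minus_cis\<close> is valid. On integers the shift contributes only
  a common sign.\<close>

definition theta :: "nat \<Rightarrow> nat \<Rightarrow> real" where
  "theta N k = 2 * pi * real k / real N - pi"

lemma theta_bound: "k < N \<Longrightarrow> \<bar>theta N k\<bar> \<le> pi"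
proof -
  assume k: "k < N"
  then have "real k / real N \<le> 1" by simp
  then have "2 * pi * (real k / real N) \<le> 2 * pi * 1" by (intro mult_left_mono) auto
  moreover have "0 \<le> 2 * pi * (real k / real N)" by simp
  ultimately show ?thesis by (simp add: theta_def abs_le_iff)
qed

lemma character_sum:
  fixes d :: int
  assumes "\<bar>d\<bar> < int N"
  shows "(\<Sum>k<N. cis (theta N k * of_int d)) = (if d = 0 then of_nat N else 0)"
proof (cases "d = 0")
  case False
  have N: "N > 0" using assms by (cases N) auto
  let ?z = "cis (2 * pi * of_int d / real N)"
  have z1: "?z \<noteq> 1"
  proof
    assume "?z = 1"
    then have "cos (2 * pi * of_int d / real N) = 1" by (metis cis.simps(1) one_complex.simps(1))
    then obtain m :: int where "2 * pi * of_int d / real N = of_int m * 2 * pi"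
      using cos_one_2pi_int by blast
    then have "of_int d = of_int m * real N" using N by (simp add: field_simps)
    then have d: "d = m * int N" by (metis of_int_eq_iff of_int_mult of_int_of_nat_eq)
    then have "m \<noteq> 0" using False by auto
    then have "\<bar>m\<bar> \<ge> 1" by linarith
    then have "\<bar>d\<bar> \<ge> 1 * int N" unfolding d abs_mult by (intro mult_mono) auto
    then show False using assms by simp
  qed
  have zN: "?z ^ N = 1"
  proof -
    have "?z ^ N = cis (real N * (2 * pi * of_int d / real N))" by (rule Complex.DeMoivre)
    also have "real N * (2 * pi * of_int d / real N) = 2 * pi * of_int d" using N by simp
    finally show ?thesis by (simp add: cis_multiple_2pi)
  qed
  have "cis (theta N k * of_int d) = cis (- pi * of_int d) * ?z ^ k" for k
    unfolding Complex.DeMoivre cis_mult theta_def by (rule arg_cong[where f=cis]) (simp add: algebra_simps)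
  then have "(\<Sum>k<N. cis (theta N k * of_int d)) = cis (- pi * of_int d) * (\<Sum>k<N. ?z ^ k)"
    by (simp add: sum_distrib_left)
  also have "(\<Sum>k<N. ?z ^ k) = 0" using geometric_sum[OF z1, of N] zN by simp
  finally show ?thesis using False by simp
qed simp

text \<open>Indices are not reduced modulo \<open>N\<close>: a finite set with differences below
  \<open>N\<close> embeds into the cyclic group, and orthogonality of characters applies to it
  directly.\<close>

lemma dft_inversion:
  fixes b :: "int \<Rightarrow> complex"
  assumes J: "finite J" "m \<in> J" and diff: "\<And>n. n \<in> J \<Longrightarrow> \<bar>m - n\<bar> < int N"
  shows "(\<Sum>k<N. (\<Sum>n\<in>J. b n * cis (- (theta N k * of_int n))) * cis (theta N k * of_int m)) = of_nat N * b m"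
proof -
  have "(\<Sum>k<N. (\<Sum>n\<in>J. b n * cis (- (theta N k * of_int n))) * cis (theta N k * of_int m)) =
     (\<Sum>k<N. \<Sum>n\<in>J. b n * cis (theta N k * of_int (m - n)))"
    unfolding sum_distrib_right
  proof (intro sum.cong refl)
    fix k n
    have "cis (- (theta N k * of_int n)) * cis (theta N k * of_int m) = cis (theta N k * of_int (m - n))"
      unfolding cis_mult by (rule arg_cong[where f=cis]) (simp add: algebra_simps)
    then show "b n * cis (- (theta N k * of_int n)) * cis (theta N k * of_int m) = b n * cis (theta N k * of_int (m - n))"
      by (simp only: mult.assoc)
  qed
  also have "\<dots> = (\<Sum>n\<in>J. b n * (\<Sum>k<N. cis (theta N k * of_int (m - n))))"
    unfolding sum_distrib_left by (rule sum.swap)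
  also have "\<dots> = (\<Sum>n\<in>J. if n = m then b m * of_nat N else 0)"
  proof (rule sum.cong[OF refl])
    fix n assume "n \<in> J"
    show "b n * (\<Sum>k<N. cis (theta N k * of_int (m - n))) = (if n = m then b m * of_nat N else 0)"
      unfolding character_sum[OF diff[OF \<open>n \<in> J\<close>]] by simp
  qed
  also have "\<dots> = of_nat N * b m" using J by simp
  finally show ?thesis .
qed

lemma dft_parseval:
  fixes b :: "int \<Rightarrow> complex"
  assumes J: "finite J" and diff: "\<And>m n. m \<in> J \<Longrightarrow> n \<in> J \<Longrightarrow> \<bar>m - n\<bar> < int N"
  shows "(\<Sum>k<N. (norm (\<Sum>n\<in>J. b n * cis (- (theta N k * of_int n))))\<^sup>2) = real N * (\<Sum>n\<in>J. (norm (b n))\<^sup>2)"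
proof -
  let ?B = "\<lambda>k. \<Sum>n\<in>J. b n * cis (- (theta N k * of_int n))"
  have "complex_of_real (\<Sum>k<N. (norm (?B k))\<^sup>2) = (\<Sum>k<N. ?B k * cnj (?B k))"
    by (simp only: of_real_sum complex_norm_square)
  also have "\<dots> = (\<Sum>k<N. \<Sum>m\<in>J. cnj (b m) * (?B k * cis (theta N k * of_int m)))"
  proof (intro sum.cong refl)
    fix k
    have "cnj (?B k) = (\<Sum>m\<in>J. cnj (b m) * cis (theta N k * of_int m))" by (simp add: cis_cnj)
    then show "?B k * cnj (?B k) = (\<Sum>m\<in>J. cnj (b m) * (?B k * cis (theta N k * of_int m)))"
      by (simp only: sum_distrib_left mult.left_commute)
  qed
  also have "\<dots> = (\<Sum>m\<in>J. cnj (b m) * (\<Sum>k<N. ?B k * cis (theta N k * of_int m)))"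
    unfolding sum_distrib_left[of "cnj _"] by (rule sum.swap)
  also have "\<dots> = (\<Sum>m\<in>J. cnj (b m) * (of_nat N * b m))"
    by (rule sum.cong[OF refl]) (subst dft_inversion[OF J _ diff], assumption+, rule refl)
  also have "\<dots> = complex_of_real (real N * (\<Sum>n\<in>J. (norm (b n))\<^sup>2))"
    unfolding of_real_mult of_real_sum complex_norm_square sum_distrib_left
    by (intro sum.cong refl) simp
  finally show ?thesis by (simp only: of_real_eq_iff)
qed

text \<open>Up to \<open>pi / 3\<close> the derivative \<open>cos y - 1 / 2\<close> of the
  difference is nonnegative; beyond, \<open>sin x\<close> is at least \<open>sqrt 3 / 2\<close>,
  which exceeds 0.8 and hence \<open>x / 2\<close>.\<close>

lemma sin_ge_half: "0 \<le> x \<Longrightarrow> x \<le> pi / 2 \<Longrightarrow> x / 2 \<le> sin (x::real)"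
proof (cases "x \<le> pi / 3")
  case True
  assume x: "0 \<le> x"
  have "sin 0 - 0 / 2 \<le> sin x - x / 2"
  proof (rule DERIV_nonneg_imp_nondecreasing[OF x])
    fix y assume y: "0 \<le> y" "y \<le> x"
    have "cos (pi / 3) \<le> cos y" using y True by (intro cos_monotone_0_pi_le) auto
    then have "0 \<le> cos y - 1 / 2" by (simp add: cos_60)
    moreover have "((\<lambda>x. sin x - x / 2) has_real_derivative cos y - 1 / 2) (at y)"
      by (auto intro!: derivative_eq_intros)
    ultimately show "\<exists>z. ((\<lambda>x. sin x - x / 2) has_real_derivative z) (at y) \<and> 0 \<le> z" by blast
  qed
  then show ?thesis by simp
next
  case False
  assume x: "x \<le> pi / 2"
  have "sin (pi / 3) \<le> sin x" using False x pi_gt_zero by (intro sin_monotone_2pi_le) auto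
  moreover have "sqrt 3 \<ge> 1.7" by (rule real_le_rsqrt) (simp add: power2_eq_square)
  moreover have "x / 2 \<le> 0.8" using x pi_less_4 pi_half_less_two x pi_approx by simp
  ultimately show ?thesis by (simp add: sin_60)
qed

lemma norm_one_minus_cis: "\<bar>\<theta>\<bar> \<le> pi \<Longrightarrow> \<bar>\<theta>\<bar> / 2 \<le> norm (1 - cis \<theta>)"
proof -
  assume \<theta>: "\<bar>\<theta>\<bar> \<le> pi"
  have "(norm (1 - cis \<theta>))\<^sup>2 = (1 - cos \<theta>)\<^sup>2 + (sin \<theta>)\<^sup>2" by (simp add: cmod_power2)
  also have "\<dots> = 2 - 2 * cos \<theta>" using sin_cos_squared_add[of \<theta>] by (simp add: power2_diff)
  also have "\<dots> = (2 * sin (\<bar>\<theta>\<bar> / 2))\<^sup>2"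
    using cos_double_sin[of "\<bar>\<theta>\<bar> / 2"] by (simp add: power_mult_distrib)
  finally have "norm (1 - cis \<theta>) = \<bar>2 * sin (\<bar>\<theta>\<bar> / 2)\<bar>" by (metis abs_norm_cancel power2_eq_iff_nonneg abs_ge_zero power2_abs norm_ge_zero)
  moreover have "\<bar>\<theta>\<bar> / 2 / 2 \<le> sin (\<bar>\<theta>\<bar> / 2)" using \<theta> by (intro sin_ge_half) auto
  ultimately show ?thesis by linarith
qed

text \<open>The geometric sum is at most \<open>2 / norm (1 - cis \<theta>)\<close>, hence at most
  \<open>4 / \<bar>\<theta>\<bar>\<close>. The product form keeps \<open>\<theta> = 0\<close>
  admissible.\<close>

lemma dirichlet_average_bound:
  assumes "\<bar>\<theta>\<bar> \<le> pi" "n > 0"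
  shows "norm ((\<Sum>s<n. cis (\<theta> * real s)) / of_nat n) \<le> 1"
    and "norm ((\<Sum>s<n. cis (\<theta> * real s)) / of_nat n) * (real n * \<bar>\<theta>\<bar>) \<le> 4"
proof -
  let ?D = "\<Sum>s<n. cis (\<theta> * real s)"
  have "norm ?D \<le> (\<Sum>s<n. norm (cis (\<theta> * real s)))" by (rule norm_sum)
  then show "norm (?D / of_nat n) \<le> 1" using assms(2) by (simp add: norm_divide)
  have "(1 - cis \<theta>) * ?D = 1 - cis \<theta> ^ n"
    unfolding one_diff_power_eq[of "cis \<theta>" n] by (simp add: Complex.DeMoivre mult.commute)
  moreover have "norm (1 - cis \<theta> ^ n) \<le> 2" by (rule order.trans[OF norm_triangle_ineq4]) (simp add: norm_power)
  ultimately have "norm (1 - cis \<theta>) * norm ?D \<le> 2" by (metis norm_mult)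
  then have "(\<bar>\<theta>\<bar> / 2) * norm ?D \<le> 2"
    using mult_right_mono[OF norm_one_minus_cis[OF assms(1)], of "norm ?D"] by simp
  then show "norm (?D / of_nat n) * (real n * \<bar>\<theta>\<bar>) \<le> 4" using assms(2) by (simp add: norm_divide mult.commute)
qed

lemma sum_triple_product:
  fixes u :: "'a \<Rightarrow> complex"
  shows "(\<Sum>(y, z, s)\<in>A \<times> B \<times> C. u y * (v z * w s)) = sum u A * (sum v B * sum w C)"
proof -
  have "(\<Sum>(y, z, s)\<in>A \<times> B \<times> C. u y * (v z * w s)) = (\<Sum>y\<in>A. \<Sum>p\<in>B \<times> C. u y * (v (fst p) * w (snd p)))"
    by (subst sum.cartesian_product) (simp add: case_prod_beta)
  also have "\<dots> = (\<Sum>y\<in>A. u y * (\<Sum>p\<in>B \<times> C. v (fst p) * w (snd p)))"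
    by (simp only: sum_distrib_left)
  also have "\<dots> = sum u A * (\<Sum>p\<in>B \<times> C. v (fst p) * w (snd p))"
    by (rule sum_distrib_right[symmetric])
  also have "(\<Sum>p\<in>B \<times> C. v (fst p) * w (snd p)) = sum v B * sum w C"
    by (simp add: sum_product sum.cartesian_product case_prod_beta)
  finally show ?thesis .
qed

text \<open>
  Averaging \<open>f\<close> over differences of almost periods on a window of length comparable to the period
  multiplies its finite Fourier coefficients by weights whose sum stays bounded, so that only boundedly
  many frequencies matter. The third average, over steps shorter than \<open>\<delta>\<close>, bounds these frequencies.
\<close>

lemma bohr_finite_stage:
  fixes f :: "real \<Rightarrow> complex" and A n :: nat
  assumes M: "\<And>x. norm (f x) \<le> M" "M > 0" and e: "\<epsilon> > 0" and \<delta>: "\<delta> > 0"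
    and uc: "\<And>x y. \<bar>x - y\<bar> \<le> \<delta> \<Longrightarrow> norm (f x - f y) \<le> \<epsilon>"
    and ap: "\<And>a. \<exists>\<tau>\<in>{a..a + L}. \<forall>x. norm (f (x + \<tau>) - f x) \<le> \<epsilon>"
    and A: "L + 2 * \<delta> \<le> real A * \<delta>" "A > 0" and n: "n > 0"
    and \<eta>: "\<eta> = \<epsilon> / (8 * real A)" and \<Lambda>: "\<Lambda> = 4 * M / (\<delta> * \<eta>)"
  shows "\<exists>(B :: nat set) c l. finite B \<and> real (card B) * \<eta>\<^sup>2 \<le> M\<^sup>2 \<and> (\<forall>k\<in>B. norm (c k) \<le> M \<and> \<bar>l k\<bar> \<le> \<Lambda>) \<and>
    (\<forall>x::int. \<bar>x\<bar> \<le> (int n)\<^sup>2 \<longrightarrow>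
      norm (f (\<delta> / real n * of_int x) - (\<Sum>k\<in>B. c k * cis (l k * (\<delta> / real n * of_int x)))) \<le> 6 * \<epsilon>)"
proof -
  \<comment> \<open>Grid spacing with \<open>n\<close> steps making up
    \<open>\<delta>\<close>.\<close>
  define h where "h = \<delta> / real n"
  have h: "h > 0" "h * real n = \<delta>" using \<delta> n by (auto simp: h_def)
  \<comment> \<open>Room for \<open>n\<close> slots of \<open>A * n\<close> grid points. Each slot
    has length \<open>A * \<delta>\<close>, which by the choice of \<open>A\<close> holds an almost
    period with \<open>2 * \<delta>\<close> to spare.\<close>
  define W where "W = A * n * n"
  \<comment> \<open>The combinations \<open>x - y + z + s\<close> formed below stay well inside an
    index range of length \<open>8 * W\<close>, so the finite inversion formula applies to them
    without wrapping around.\<close>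
  define N where "N = 8 * W"
  have W: "W > 0" using A(2) n by (simp add: W_def)
  define I where "I = {- (4 * int W)..<4 * int W}"
  have cardI: "card I = N" "finite I" by (auto simp: I_def N_def)
  have Idiff: "\<bar>m - k\<bar> < int N" if "m \<in> I" "k \<in> I" for m k using that by (auto simp: I_def N_def)
  define a where "a = (\<lambda>m::int. f (h * of_int m))"
  have \<eta>0: "\<eta> > 0" using e A(2) by (simp add: \<eta>)
  \<comment> \<open>The tolerance is doubled because an almost period is rounded to the grid and
    moved by up to \<open>n - 1\<close> further steps, altogether by at most
    \<open>\<delta>\<close>.\<close>
  define G where "G = {y \<in> {0..<int W}. \<forall>x. norm (f (x + h * of_int y) - f x) \<le> 2 * \<epsilon>}"
  have finG: "finite G" by (rule finite_subset[of _ "{0..<int W}"]) (auto simp: G_def)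
  define g where "g = card G"
  have g_ge: "n * n \<le> g"
  proof -
    have "\<exists>\<tau>. \<forall>i::nat. \<tau> i \<in> {real i * (real A * \<delta>)..real i * (real A * \<delta>) + L} \<and> (\<forall>x. norm (f (x + \<tau> i) - f x) \<le> \<epsilon>)"
      by (rule choice) (use ap in blast)
    then obtain \<tau> where \<tau>: "\<And>i::nat. \<tau> i \<in> {real i * (real A * \<delta>)..real i * (real A * \<delta>) + L}"
        "\<And>i x. norm (f (x + \<tau> i) - f x) \<le> \<epsilon>" by blast
    define y0 where "y0 = (\<lambda>i. \<lceil>\<tau> i / h\<rceil>)"
    \<comment> \<open>The spare \<open>2 * \<delta>\<close> appears as the final
      \<open>2 * int n\<close>: adding an offset \<open>s < n\<close> keeps the point in its slot.
      Thus the slots yield \<open>n * n\<close> different elements of \<open>G\<close>.\<close>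
    have y0: "int i * (int A * int n) \<le> y0 i" "y0 i \<le> int i * (int A * int n) + int A * int n - 2 * int n" for i
    proof -
      have "real i * (real A * real n) \<le> \<tau> i / h"
      proof -
        have eq: "real i * (real A * real n) * h = real i * (real A * \<delta>)" unfolding h(2)[symmetric] by simp
        have "real i * (real A * real n) * h \<le> \<tau> i" unfolding eq using \<tau>(1)[of i] by simp
        then show ?thesis by (simp only: pos_le_divide_eq[OF h(1)])
      qed
      then have "real_of_int (int i * (int A * int n)) \<le> of_int (y0 i)"
        unfolding y0_def by (simp add: order.trans[OF _ le_of_int_ceiling])
      then show "int i * (int A * int n) \<le> y0 i" by (simp only: of_int_le_iff)
      have "\<tau> i \<le> real i * (real A * \<delta>) + real A * \<delta> - 2 * \<delta>" using \<tau>(1)[of i] A(1) by simp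
      also have "\<dots> = (real i * (real A * real n) + real A * real n - 2 * real n) * h"
        unfolding h(2)[symmetric] by (simp add: algebra_simps)
      finally have "\<tau> i / h \<le> of_int (int i * (int A * int n) + int A * int n - 2 * int n)"
        using h(1) by (simp add: pos_divide_le_eq)
      then show "y0 i \<le> int i * (int A * int n) + int A * int n - 2 * int n"
        unfolding y0_def by (simp only: ceiling_le_iff)
    qed
    let ?y = "\<lambda>(i, s). y0 i + int s"
    have "?y ` ({..<n} \<times> {..<n}) \<subseteq> G"
    proof safe
      fix i s assume i: "i < n" and s: "s < n"
      have "y0 i + int s < int i * (int A * int n) + int A * int n" using y0(2)[of i] s by linarith
      also have "\<dots> = (int i + 1) * (int A * int n)" by (simp add: distrib_right)
      also have "\<dots> \<le> int n * (int A * int n)" using i by (intro mult_right_mono) auto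
      finally have 1: "y0 i + int s < int W" by (simp add: W_def mult_ac)
      have 2: "0 \<le> y0 i + int s" using y0(1)[of i] by (meson add_nonneg_nonneg of_nat_0_le_iff order.trans zero_le_mult_iff)
      have "norm (f (x + h * of_int (y0 i + int s)) - f x) \<le> 2 * \<epsilon>" for x
      proof -
        have c: "\<tau> i / h \<le> of_int (y0 i)" "of_int (y0 i) < \<tau> i / h + 1"
          unfolding y0_def by linarith+
        have "\<tau> i \<le> h * of_int (y0 i)" "h * of_int (y0 i) \<le> \<tau> i + h"
          using c h(1) by (simp_all add: field_simps)
        moreover have "h * (1 + real s) \<le> \<delta>"
          unfolding h(2)[symmetric] using h(1) s by (intro mult_left_mono) auto
        then have "h + h * real s \<le> \<delta>" by (simp add: distrib_left)
        moreover have "h * real s \<ge> 0" using h(1) by simp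
        ultimately have "\<bar>h * of_int (y0 i) + h * real s - \<tau> i\<bar> \<le> \<delta>"
          using \<delta> by (intro abs_leI) linarith+
        moreover have "(x + h * of_int (y0 i + int s)) - (x + \<tau> i) = h * of_int (y0 i) + h * real s - \<tau> i"
          by (simp add: algebra_simps)
        ultimately have "\<bar>(x + h * of_int (y0 i + int s)) - (x + \<tau> i)\<bar> \<le> \<delta>" by (simp only:)
        from uc[OF this] \<tau>(2)[of x i] show ?thesis
          using norm_triangle_ineq[of "f (x + h * of_int (y0 i + int s)) - f (x + \<tau> i)" "f (x + \<tau> i) - f x"] by simp
      qed
      then show "y0 i + int s \<in> G" using 1 2 by (simp add: G_def)
    qed
    moreover have "inj_on ?y ({..<n} \<times> {..<n})"
    proof (rule inj_onI)
      fix p q assume pq: "p \<in> {..<n} \<times> {..<n}" "q \<in> {..<n} \<times> {..<n}" "?y p = ?y q"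
      obtain i s i' s' where ps: "p = (i, s)" "q = (i', s')" by (metis surj_pair)
      with pq have *: "y0 i + int s = y0 i' + int s'" and lt: "s \<in> {..<n}" "s' \<in> {..<n}" by auto
      have div: "(y0 j + int r) div (int A * int n) = int j" if "r < n" for j r
      proof (rule int_div_pos_eq[where r="y0 j + int r - int A * int n * int j"])
        show "y0 j + int r = int A * int n * int j + (y0 j + int r - int A * int n * int j)" by simp
        show "0 \<le> y0 j + int r - int A * int n * int j" using y0(1)[of j] by (simp add: mult_ac)
        show "y0 j + int r - int A * int n * int j < int A * int n" using y0(2)[of j] that by (simp add: mult_ac)
      qed
      have "int i = int i'" using div[of s i] div[of s' i'] * lt by simp
      then show "p = q" using * ps by simp
    qed
    ultimately have "card ({..<n} \<times> {..<n}) \<le> card G" using finG by (metis card_inj_on_le)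
    then show ?thesis by (simp add: g_def)
  qed
  have g0: "g > 0" using g_ge n by (metis gr0I le_zero_eq nat_0_less_mult_iff)
  have Ng: "real N / real g \<le> 8 * real A"
  proof -
    have "real N = 8 * real A * real (n * n)" by (simp add: N_def W_def)
    also have "\<dots> \<le> 8 * real A * real g"
      by (rule mult_left_mono[OF of_nat_mono[OF g_ge]]) simp
    finally show ?thesis using g0 by (simp add: pos_divide_le_eq)
  qed
  define ah where "ah = (\<lambda>k. (\<Sum>m\<in>I. a m * cis (- (theta N k * of_int m))) / of_nat N)"
  define gh where "gh = (\<lambda>k. \<Sum>y\<in>G. cis (- (theta N k * of_int y)))"
  define D where "D = (\<lambda>k. (\<Sum>s<n. cis (theta N k * real s)) / of_nat n)"
  \<comment> \<open>The weight by which averaging over differences of two elements of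
    \<open>G\<close> multiplies a Fourier coefficient.\<close>
  define om where "om = (\<lambda>k. (norm (gh k))\<^sup>2 / (real g)\<^sup>2)"
  have N0: "N > 0" using W by (simp add: N_def)
  have inv: "a m = (\<Sum>k<N. ah k * cis (theta N k * of_int m))" if "m \<in> I" for m
    using dft_inversion[OF cardI(2) that Idiff[OF that], of a] N0
    by (simp add: ah_def flip: sum_divide_distrib)
  have ah2: "(\<Sum>k<N. (norm (ah k))\<^sup>2) \<le> M\<^sup>2"
  proof -
    have "(\<Sum>k<N. (norm (ah k))\<^sup>2) = (\<Sum>k<N. (norm (\<Sum>m\<in>I. a m * cis (- (theta N k * of_int m))))\<^sup>2) / (real N)\<^sup>2"
      unfolding ah_def norm_divide power_divide norm_of_nat by (rule sum_divide_distrib[symmetric])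
    also have "\<dots> = (\<Sum>m\<in>I. (norm (a m))\<^sup>2) / real N"
      using dft_parseval[OF cardI(2) Idiff, of a] N0 by (simp add: power2_eq_square)
    also have "\<dots> \<le> (of_nat (card I) * M\<^sup>2) / real N"
      by (intro divide_right_mono sum_bounded_above power_mono) (auto simp: a_def M)
    finally show ?thesis using N0 by (simp add: cardI)
  qed
  have ahM: "norm (ah k) \<le> M" for k
  proof -
    have "norm (\<Sum>m\<in>I. a m * cis (- (theta N k * of_int m))) \<le> of_nat (card I) * M"
      by (intro order.trans[OF norm_sum] sum_bounded_above) (simp add: norm_mult a_def M)
    then show ?thesis using N0 by (simp add: ah_def norm_divide cardI divide_le_eq mult.commute)
  qed
  \<comment> \<open>Parseval for the indicator of \<open>G\<close> gives \<open>N / g\<close>, and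
    \<open>G\<close> fills at least the fraction \<open>1 / A\<close> of the window. The bound is
    therefore independent of \<open>n\<close>, and it fixes the threshold
    \<open>\<eta> = \<epsilon> / (8 * A)\<close>.\<close>
  have om_sum: "(\<Sum>k<N. om k) \<le> 8 * real A"
  proof -
    have "(\<Sum>k<N. (norm (gh k))\<^sup>2) = real N * real g"
    proof -
      have "\<bar>m - n\<bar> < int N" if "m \<in> G" "n \<in> G" for m n using that by (auto simp: G_def N_def)
      from dft_parseval[OF finG this, of "\<lambda>_. 1"] show ?thesis by (simp add: gh_def g_def)
    qed
    then have "(\<Sum>k<N. om k) = real N / real g"
      using g0 by (simp add: om_def power2_eq_square flip: sum_divide_distrib)
    then show ?thesis using Ng by simp
  qed
  have om1: "0 \<le> om k" "om k \<le> 1" for k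
  proof -
    have "norm (gh k) \<le> (\<Sum>y\<in>G. norm (cis (- (theta N k * of_int y))))" unfolding gh_def by (rule norm_sum)
    then have "norm (gh k) \<le> real g" by (simp add: g_def)
    then show "om k \<le> 1" using g0 by (simp add: om_def power_mono)
  qed (simp add: om_def)
  \<comment> \<open>The frequencies that are kept: coefficient above the threshold, and size at most
    \<open>\<Lambda>\<close>.\<close>
  define B where "B = {k\<in>{..<N}. norm (ah k) > \<eta> \<and> \<bar>theta N k / h\<bar> \<le> \<Lambda>}"
  \<comment> \<open>A discarded frequency either has a small coefficient or exceeds
    \<open>\<Lambda>\<close>. In the second case the average over steps gives
    \<open>norm (D k) \<le> 4 / (\<delta> * \<Lambda>) = \<eta> / M\<close>, which is how
    \<open>\<Lambda>\<close> is chosen.\<close>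
  have small: "norm (ah k) * norm (D k) \<le> \<eta>" if k: "k < N" "k \<notin> B" for k
  proof (cases "norm (ah k) \<le> \<eta>")
    case True
    have "norm (D k) \<le> 1" unfolding D_def by (rule dirichlet_average_bound(1)[OF theta_bound[OF k(1)] n])
    then have "norm (ah k) * norm (D k) \<le> \<eta> * 1" using True \<eta>0 by (intro mult_mono) auto
    then show ?thesis by simp
  next
    case False
    then have \<Lambda>lt: "\<Lambda> < \<bar>theta N k / h\<bar>" using k by (auto simp: B_def)
    have "real n * \<bar>theta N k\<bar> = \<delta> * \<bar>theta N k / h\<bar>" using h by (simp add: abs_divide field_simps)
    then have "norm (D k) * (\<delta> * \<bar>theta N k / h\<bar>) \<le> 4"
      using dirichlet_average_bound(2)[OF theta_bound[OF k(1)] n] unfolding D_def by simp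
    moreover have "norm (D k) * (\<delta> * \<Lambda>) \<le> norm (D k) * (\<delta> * \<bar>theta N k / h\<bar>)"
      using \<Lambda>lt \<delta> by (intro mult_left_mono) auto
    ultimately have "norm (D k) * (\<delta> * \<Lambda>) \<le> 4" by linarith
    moreover have "\<delta> * \<Lambda> = 4 * M / \<eta>" using \<delta> by (simp add: \<Lambda>)
    ultimately have "norm (D k) * (4 * M / \<eta>) \<le> 4" by simp
    then have "norm (D k) * M \<le> \<eta>" using \<eta>0 by (simp add: field_simps)
    moreover have "norm (ah k) * norm (D k) \<le> M * norm (D k)" by (intro mult_right_mono ahM) auto
    ultimately show ?thesis by (simp add: mult.commute)
  qed
  let ?c = "\<lambda>k. ah k * of_real (om k) * D k" and ?l = "\<lambda>k. theta N k / h"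
  have cM: "norm (?c k) \<le> M" if "k < N" for k
  proof -
    have "norm (D k) \<le> 1" unfolding D_def by (rule dirichlet_average_bound(1)[OF theta_bound[OF that] n])
    then have "norm (ah k) * om k * norm (D k) \<le> M * 1 * 1"
      by (intro mult_mono ahM om1) (use om1 M(2) in auto)
    then show ?thesis using om1(1)[of k] by (simp add: norm_mult)
  qed
  have approx: "norm (f (h * of_int x) - (\<Sum>k\<in>B. ?c k * cis (?l k * (h * of_int x)))) \<le> 6 * \<epsilon>"
    if x: "\<bar>x\<bar> \<le> (int n)\<^sup>2" for x :: int
  proof -
    let ?T = "G \<times> G \<times> {..<n}"
    have cT: "card ?T = g * g * n" by (simp add: g_def card_cartesian_product mult.assoc)
    have finT: "finite ?T" using finG by simp
    \<comment> \<open>The triple average stays within \<open>5 * \<epsilon>\<close> of the sample: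
      twice \<open>2 * \<epsilon>\<close> for the shifts in \<open>G\<close> and
      \<open>\<epsilon>\<close> for the short step. On the Fourier side it multiplies the
      coefficients by \<open>om k * D k\<close>; the sixth \<open>\<epsilon>\<close> is lost by
      restricting to \<open>B\<close>.\<close>
    define F where "F = (\<Sum>(y, z, s)\<in>?T. a (x - y + z + int s)) / of_nat (card ?T)"
    have cT0: "card ?T > 0" using cT g0 n by simp
    have "(int n)\<^sup>2 = 1 * (int n * int n)" by (simp add: power2_eq_square)
    also have "\<dots> \<le> int A * (int n * int n)" using A(2) by (intro mult_right_mono) auto
    finally have xW: "\<bar>x\<bar> \<le> int W" using x by (simp add: W_def mult.assoc)
    have nW: "int n \<le> int W"
    proof -
      have "n * 1 \<le> n * (A * n)" using A(2) n by (intro mult_left_mono) auto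
      then have "n \<le> W" by (simp add: W_def mult_ac)
      then show ?thesis by simp
    qed
    have "norm (F - f (h * of_int x)) \<le> 5 * \<epsilon>"
    proof -
      have "norm (a (x - y + z + int s) - f (h * of_int x)) \<le> 5 * \<epsilon>" if "y \<in> G" "z \<in> G" "s < n" for y z s
      proof -
        let ?p = "h * of_int x - h * of_int y"
        have y: "norm (f (?p + h * of_int y) - f ?p) \<le> 2 * \<epsilon>" using that(1) unfolding G_def by blast
        have z: "norm (f (?p + h * of_int z) - f ?p) \<le> 2 * \<epsilon>" using that(2) unfolding G_def by blast
        have "h * real s \<le> h * real n" using h(1) that(3) by (intro mult_left_mono) auto
        then have "\<bar>(?p + h * of_int z + h * real s) - (?p + h * of_int z)\<bar> \<le> \<delta>" using h by simp
        from uc[OF this] have s: "norm (f (?p + h * of_int z + h * real s) - f (?p + h * of_int z)) \<le> \<epsilon>" .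
        have "a (x - y + z + int s) = f (?p + h * of_int z + h * real s)"
          unfolding a_def by (rule arg_cong[where f=f]) (simp add: algebra_simps)
        then have "a (x - y + z + int s) - f (h * of_int x) =
          (f (?p + h * of_int z + h * real s) - f (?p + h * of_int z)) + (f (?p + h * of_int z) - f ?p) - (f (?p + h * of_int y) - f ?p)"
          by simp
        also have "norm \<dots> \<le> \<epsilon> + 2 * \<epsilon> + 2 * \<epsilon>"
          by (intro order.trans[OF norm_triangle_ineq4] add_mono y order.trans[OF norm_triangle_ineq] s z)
        finally show ?thesis by simp
      qed
      then have "norm (\<Sum>(y, z, s)\<in>?T. a (x - y + z + int s) - f (h * of_int x)) \<le> of_nat (card ?T) * (5 * \<epsilon>)"
        by (intro order.trans[OF norm_sum] sum_bounded_above) auto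
      moreover have "F - f (h * of_int x) = (\<Sum>(y, z, s)\<in>?T. a (x - y + z + int s) - f (h * of_int x)) / of_nat (card ?T)"
        using cT0 by (simp add: F_def case_prod_beta sum_subtractf diff_divide_distrib)
      ultimately show ?thesis using cT0 by (simp add: norm_divide pos_divide_le_eq mult.commute)
    qed
    moreover have "F = (\<Sum>k<N. ?c k * cis (?l k * (h * of_int x)))"
    proof -
      let ?t = "theta N"
      have "(\<Sum>(y, z, s)\<in>?T. a (x - y + z + int s)) =
        (\<Sum>p\<in>?T. \<Sum>k<N. case p of (y, z, s) \<Rightarrow> (ah k * cis (?t k * of_int x)) * (cis (- (?t k * of_int y)) * (cis (?t k * of_int z) * cis (?t k * real s))))"
      proof (rule sum.cong[OF refl], safe)
        fix y z s assume yzs: "y \<in> G" "z \<in> G" "s < n"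
        have "x - y + z + int s \<in> I" using yzs xW nW by (auto simp: I_def G_def)
        from inv[OF this] have "a (x - y + z + int s) = (\<Sum>k<N. ah k * cis (?t k * of_int (x - y + z + int s)))" .
        moreover have "cis (?t k * of_int (x - y + z + int s)) =
            cis (?t k * of_int x) * (cis (- (?t k * of_int y)) * (cis (?t k * of_int z) * cis (?t k * real s)))" for k
          unfolding cis_mult by (rule arg_cong[where f=cis]) (simp add: algebra_simps)
        ultimately show "a (x - y + z + int s) = (\<Sum>k<N. (ah k * cis (?t k * of_int x)) * (cis (- (?t k * of_int y)) * (cis (?t k * of_int z) * cis (?t k * real s))))"
          by (simp only: mult.assoc)
      qed
      also have "\<dots> = (\<Sum>k<N. \<Sum>p\<in>?T. case p of (y, z, s) \<Rightarrow> (ah k * cis (?t k * of_int x)) * (cis (- (?t k * of_int y)) * (cis (?t k * of_int z) * cis (?t k * real s))))"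
        by (rule sum.swap)
      also have "\<dots> = (\<Sum>k<N. (?c k * cis (?l k * (h * of_int x))) * of_nat (card ?T))"
      proof (rule sum.cong[OF refl])
        fix k
        have "(\<Sum>p\<in>?T. case p of (y, z, s) \<Rightarrow> (ah k * cis (?t k * of_int x)) * (cis (- (?t k * of_int y)) * (cis (?t k * of_int z) * cis (?t k * real s)))) =
           (ah k * cis (?t k * of_int x)) * (\<Sum>(y, z, s)\<in>?T. cis (- (?t k * of_int y)) * (cis (?t k * of_int z) * cis (?t k * real s)))"
          by (simp add: sum_distrib_left case_prod_beta)
        also have "(\<Sum>(y, z, s)\<in>?T. cis (- (?t k * of_int y)) * (cis (?t k * of_int z) * cis (?t k * real s))) =
           gh k * ((\<Sum>z\<in>G. cis (?t k * of_int z)) * (\<Sum>s<n. cis (?t k * real s)))"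
          unfolding sum_triple_product gh_def ..
        also have "(\<Sum>z\<in>G. cis (?t k * of_int z)) = cnj (gh k)" by (simp add: gh_def cis_cnj)
        also have "(\<Sum>s<n. cis (?t k * real s)) = D k * of_nat n" using n by (simp add: D_def)
        also have "gh k * (cnj (gh k) * (D k * of_nat n)) = of_real (om k) * D k * of_nat (card ?T)"
        proof -
          have "gh k * cnj (gh k) = of_real (om k * (real g)\<^sup>2)"
            using g0 by (simp only: complex_norm_square[symmetric] om_def) simp
          then have "gh k * (cnj (gh k) * (D k * of_nat n)) = of_real (om k * (real g)\<^sup>2) * (D k * of_nat n)"
            by (simp only: mult.assoc[symmetric])
          then show ?thesis unfolding cT by (simp add: power2_eq_square mult_ac)
        qed
        finally have fin: "(\<Sum>p\<in>?T. case p of (y, z, s) \<Rightarrow> (ah k * cis (?t k * of_int x)) * (cis (- (?t k * of_int y)) * (cis (?t k * of_int z) * cis (?t k * real s)))) =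
          (ah k * cis (?t k * of_int x)) * (of_real (om k) * D k * of_nat (card ?T))" .
        have tx: "?l k * (h * of_int x) = ?t k * of_int x" using h(1) by simp
        show "(\<Sum>p\<in>?T. case p of (y, z, s) \<Rightarrow> (ah k * cis (?t k * of_int x)) * (cis (- (?t k * of_int y)) * (cis (?t k * of_int z) * cis (?t k * real s)))) =
          (?c k * cis (?l k * (h * of_int x))) * of_nat (card ?T)" unfolding fin tx by (simp only: mult_ac)
      qed
      finally show ?thesis unfolding F_def using cT0 by (simp flip: sum_distrib_right)
    qed
    moreover have "norm ((\<Sum>k<N. ?c k * cis (?l k * (h * of_int x))) - (\<Sum>k\<in>B. ?c k * cis (?l k * (h * of_int x)))) \<le> \<epsilon>"
    proof -
      have "(\<Sum>k<N. ?c k * cis (?l k * (h * of_int x))) - (\<Sum>k\<in>B. ?c k * cis (?l k * (h * of_int x))) =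
         (\<Sum>k\<in>{..<N} - B. ?c k * cis (?l k * (h * of_int x)))"
        by (rule sum_diff[symmetric]) (auto simp: B_def)
      also have "norm \<dots> \<le> (\<Sum>k\<in>{..<N} - B. \<eta> * om k)"
      proof (rule order.trans[OF norm_sum], rule sum_mono)
        fix k assume "k \<in> {..<N} - B"
        then have "norm (ah k) * norm (D k) \<le> \<eta>" using small by blast
        from mult_right_mono[OF this om1(1)[of k]] om1(1)[of k]
        show "norm (?c k * cis (?l k * (h * of_int x))) \<le> \<eta> * om k" by (simp add: norm_mult mult_ac)
      qed
      also have "\<dots> \<le> (\<Sum>k<N. \<eta> * om k)" by (rule sum_mono2) (use om1 \<eta>0 in auto)
      also have "\<dots> \<le> \<eta> * (8 * real A)" unfolding sum_distrib_left[symmetric] using om_sum \<eta>0 by (intro mult_left_mono) auto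
      also have "\<dots> = \<epsilon>" using A(2) by (simp add: \<eta>)
      finally show ?thesis .
    qed
    ultimately show ?thesis
      using norm_triangle_ineq4[of "F - (\<Sum>k\<in>B. ?c k * cis (?l k * (h * of_int x)))" "F - f (h * of_int x)"] by simp
  qed
  \<comment> \<open>Parseval again: each kept frequency takes at least \<open>\<eta>^2\<close> out
    of a total of at most \<open>M^2\<close>.\<close>
  have "real (card B) * \<eta>\<^sup>2 \<le> M\<^sup>2"
  proof -
    have "real (card B) * \<eta>\<^sup>2 = (\<Sum>k\<in>B. \<eta>\<^sup>2)" by simp
    also have "\<dots> \<le> (\<Sum>k\<in>B. (norm (ah k))\<^sup>2)" using \<eta>0 by (intro sum_mono power_mono) (auto simp: B_def)
    also have "\<dots> \<le> (\<Sum>k<N. (norm (ah k))\<^sup>2)" by (rule sum_mono2) (auto simp: B_def)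
    finally show ?thesis using ah2 by simp
  qed
  moreover have "finite B" by (simp add: B_def)
  moreover have "\<forall>k\<in>B. norm (?c k) \<le> M \<and> \<bar>?l k\<bar> \<le> \<Lambda>" using cM by (auto simp: B_def)
  ultimately show ?thesis
    unfolding h_def[symmetric]
    by (intro exI[of _ B] exI[of _ ?c] exI[of _ ?l] conjI allI impI approx)
qed

section \<open>Bohr's approximation theorem\<close>

lemma simultaneous_subsequence:
  fixes X :: "nat \<Rightarrow> nat \<Rightarrow> 'a::heine_borel"
  assumes "\<And>l. bounded (range (\<lambda>n. X n l))"
  shows "\<exists>r Y. strict_mono (r :: nat \<Rightarrow> nat) \<and> (\<forall>l<Q. (\<lambda>n. X (r n) l) \<longlonglongrightarrow> Y l)"
proof (induction Q)
  case 0
  show ?case by (intro exI[of _ id]) (auto simp: strict_mono_def)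
next
  case (Suc Q)
  then obtain r :: "nat \<Rightarrow> nat" and Y where r: "strict_mono r" "\<And>l. l < Q \<Longrightarrow> (\<lambda>n. X (r n) l) \<longlonglongrightarrow> Y l" by blast
  have "bounded (range (\<lambda>n. X (r n) Q))" by (rule bounded_subset[OF assms[of Q]]) auto
  from bounded_imp_convergent_subsequence[OF this] obtain s y where
    s: "strict_mono (s :: nat \<Rightarrow> nat)" "((\<lambda>n. X (r n) Q) \<circ> s) \<longlonglongrightarrow> y" by blast
  have "(\<lambda>n. X ((r \<circ> s) n) l) \<longlonglongrightarrow> (Y(Q := y)) l" if "l < Suc Q" for l
  proof (cases "l = Q")
    case False
    then have "((\<lambda>n. X (r n) l) \<circ> s) \<longlonglongrightarrow> Y l" using that by (intro LIMSEQ_subseq_LIMSEQ r s) auto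
    then show ?thesis using False by (simp add: o_def)
  qed (use s in \<open>simp add: o_def\<close>)
  then show ?case using strict_mono_o[OF r(1) s(1)] by blast
qed

lemma trig_polynomialI:
  fixes N :: nat
  shows "trig_polynomial (\<lambda>x. \<Sum>j<N. c j * cis (w j * x))"
  unfolding trig_polynomial_def cis_conv_exp by (intro exI[of _ N] exI[of _ c] exI[of _ w] refl)

lemma trig_polynomialE:
  assumes "trig_polynomial p"
  obtains N :: nat and c w where "p = (\<lambda>x. \<Sum>j<N. c j * cis (w j * x))"
  using assms unfolding trig_polynomial_def cis_conv_exp by (elim exE)

text \<open>The finite stages approximate on grids of spacing \<open>\<delta> / (n + 1)\<close> over
  intervals of half-length \<open>\<delta> * (n + 1)\<close>, with bounds free of \<open>n\<close>.
  A limit of their frequencies and coefficients therefore approximates \<open>f\<close> on the whole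
  line.\<close>

theorem bohr_approximation:
  assumes f: "bohr_almost_periodic f" and eps: "\<epsilon> > 0"
  shows "\<exists>p. trig_polynomial p \<and> (\<forall>x. norm (f x - p x) \<le> \<epsilon>)"
proof -
  define e where "e = \<epsilon> / 6"
  have e: "e > 0" using eps by (simp add: e_def)
  have cont: "continuous_on UNIV f" using f by (simp add: bohr_almost_periodic_def)
  obtain M0 where M0: "\<And>x. norm (f x) \<le> M0" using bohr_bounded[OF f] by (auto simp: bounded_iff)
  define M where "M = max M0 1"
  have M: "\<And>x. norm (f x) \<le> M" "M > 0" using M0 by (auto simp: M_def intro: le_max_iff_disj[THEN iffD2])
  obtain \<delta> where \<delta>: "\<delta> > 0" "\<And>x y. \<bar>x - y\<bar> \<le> \<delta> \<Longrightarrow> norm (f x - f y) \<le> e"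
    using bohr_uniformly_continuous[OF f e] by blast
  obtain L where ap: "\<And>a. \<exists>\<tau>\<in>{a..a + L}. \<forall>x. norm (f (x + \<tau>) - f x) \<le> e"
    using f e unfolding bohr_almost_periodic_def by blast
  obtain A0 :: nat where A0: "(L + 2 * \<delta>) / \<delta> \<le> real A0" using real_arch_simple by blast
  define A where "A = Suc A0"
  have A: "L + 2 * \<delta> \<le> real A * \<delta>" "A > 0"
  proof -
    have "L + 2 * \<delta> \<le> real A0 * \<delta>" using A0 \<delta>(1) by (simp add: pos_divide_le_eq)
    also have "\<dots> \<le> real A * \<delta>" using \<delta>(1) by (intro mult_right_mono) (auto simp: A_def)
    finally show "L + 2 * \<delta> \<le> real A * \<delta>" .
  qed (simp add: A_def)
  define \<eta> where "\<eta> = e / (8 * real A)"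
  define \<Lambda> where "\<Lambda> = 4 * M / (\<delta> * \<eta>)"
  have \<eta>0: "\<eta> > 0" using e A by (simp add: \<eta>_def)
  have \<Lambda>0: "\<Lambda> \<ge> 0" using M \<delta> \<eta>0 by (simp add: \<Lambda>_def)
  obtain Q :: nat where Q: "M\<^sup>2 / \<eta>\<^sup>2 \<le> real Q" using real_arch_simple by blast
  let ?h = "\<lambda>n. \<delta> / real (Suc n)"
  have "\<exists>X :: nat \<Rightarrow> complex \<times> real. (\<forall>l. norm (fst (X l)) \<le> M \<and> \<bar>snd (X l)\<bar> \<le> \<Lambda>) \<and>
     (\<forall>x::int. \<bar>x\<bar> \<le> (int (Suc n))\<^sup>2 \<longrightarrow>
       norm (f (?h n * of_int x) - (\<Sum>l<Q. fst (X l) * cis (snd (X l) * (?h n * of_int x)))) \<le> 6 * e)" for n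
  proof -
    obtain B :: "nat set" and c l where B: "finite B" "real (card B) * \<eta>\<^sup>2 \<le> M\<^sup>2"
      "\<And>k. k \<in> B \<Longrightarrow> norm (c k) \<le> M \<and> \<bar>l k\<bar> \<le> \<Lambda>"
      "\<And>x::int. \<bar>x\<bar> \<le> (int (Suc n))\<^sup>2 \<Longrightarrow> norm (f (?h n * of_int x) - (\<Sum>k\<in>B. c k * cis (l k * (?h n * of_int x)))) \<le> 6 * e"
      using bohr_finite_stage[OF M e \<delta> ap A zero_less_Suc[of n] \<eta>_def \<Lambda>_def] by blast
    obtain b where b: "bij_betw b {..<card B} B"
      using ex_bij_betw_nat_finite[OF B(1)] by (auto simp: atLeast0LessThan)
    have "real (card B) \<le> M\<^sup>2 / \<eta>\<^sup>2" using B(2) \<eta>0 by (simp add: pos_le_divide_eq)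
    then have cQ: "card B \<le> Q" using Q by (metis of_nat_le_iff order.trans)
    \<comment> \<open>Padding by zero coefficients gives every stage exactly \<open>Q\<close> terms,
      so that limits can be taken term by term.\<close>
    define X where "X = (\<lambda>i. if i < card B then (c (b i), l (b i)) else (0, 0))"
    have bB: "b i \<in> B" if "i < card B" for i using b that by (auto simp: bij_betw_def)
    have 1: "norm (fst (X i)) \<le> M \<and> \<bar>snd (X i)\<bar> \<le> \<Lambda>" for i
      using B(3)[OF bB] M(2) \<Lambda>0 by (simp add: X_def)
    have 2: "(\<Sum>i<Q. fst (X i) * cis (snd (X i) * t)) = (\<Sum>k\<in>B. c k * cis (l k * t))" for t
    proof -
      have "(\<Sum>i<Q. fst (X i) * cis (snd (X i) * t)) = (\<Sum>i<card B. c (b i) * cis (l (b i) * t))"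
        by (rule sum.mono_neutral_cong_right) (use cQ in \<open>auto simp: X_def\<close>)
      also have "\<dots> = (\<Sum>k\<in>B. c k * cis (l k * t))"
        by (rule sum.reindex_bij_betw[OF b])
      finally show ?thesis .
    qed
    show ?thesis by (intro exI[of _ X] conjI allI impI) (use 1 in blast, use 1 in blast, unfold 2, erule B(4))
  qed
  then have "\<exists>X :: nat \<Rightarrow> nat \<Rightarrow> complex \<times> real. \<forall>n. (\<forall>l. norm (fst (X n l)) \<le> M \<and> \<bar>snd (X n l)\<bar> \<le> \<Lambda>) \<and>
     (\<forall>x::int. \<bar>x\<bar> \<le> (int (Suc n))\<^sup>2 \<longrightarrow>
       norm (f (?h n * of_int x) - (\<Sum>l<Q. fst (X n l) * cis (snd (X n l) * (?h n * of_int x)))) \<le> 6 * e)"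
    by (intro choice allI)
  then obtain X :: "nat \<Rightarrow> nat \<Rightarrow> complex \<times> real" where
    X: "\<And>n l. norm (fst (X n l)) \<le> M" "\<And>n l. \<bar>snd (X n l)\<bar> \<le> \<Lambda>"
      "\<And>n x. \<bar>x\<bar> \<le> (int (Suc n))\<^sup>2 \<Longrightarrow>
        norm (f (?h n * of_int x) - (\<Sum>l<Q. fst (X n l) * cis (snd (X n l) * (?h n * of_int x)))) \<le> 6 * e"
    by blast
  have "bounded (range (\<lambda>n. X n l))" for l
  proof (rule boundedI)
    fix p assume "p \<in> range (\<lambda>n. X n l)"
    then obtain n where "p = X n l" by blast
    moreover have "norm (X n l) \<le> norm (fst (X n l)) + norm (snd (X n l))"
      using norm_Pair_le[of "fst (X n l)" "snd (X n l)"] by simp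
    ultimately show "norm p \<le> M + \<Lambda>" using X(1)[of n l] X(2)[of n l] by simp
  qed
  from simultaneous_subsequence[of X, OF this, of Q] obtain r Y where
    r: "strict_mono r" and Y: "\<And>l. l < Q \<Longrightarrow> (\<lambda>n. X (r n) l) \<longlonglongrightarrow> Y l" by blast
  define p where "p = (\<lambda>x. \<Sum>l<Q. fst (Y l) * cis (snd (Y l) * x))"
  have "norm (f t - p t) \<le> \<epsilon>" for t
  proof -
    \<comment> \<open>The grid point just below \<open>t\<close>; it converges to \<open>t\<close>
      as the grid is refined.\<close>
    define x where "x = (\<lambda>n. \<lfloor>t * real (Suc n) / \<delta>\<rfloor>)"
    have close: "\<bar>?h n * of_int (x n) - t\<bar> \<le> ?h n" for n
    proof -
      have h: "?h n > 0" using \<delta> by simp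
      have "of_int (x n) \<le> t * real (Suc n) / \<delta>" "t * real (Suc n) / \<delta> < of_int (x n) + 1"
        unfolding x_def by linarith+
      moreover have "t * real (Suc n) / \<delta> = t / ?h n" by simp
      ultimately have "of_int (x n) * ?h n \<le> t" "t < (of_int (x n) + 1) * ?h n"
        using h by (simp_all only: pos_le_divide_eq pos_divide_less_eq)
      then have "of_int (x n) * ?h n \<le> t" "t < of_int (x n) * ?h n + ?h n"
        unfolding distrib_right mult_1 .
      then show ?thesis unfolding mult.commute[of "?h n"] using h by (intro abs_leI) linarith+
    qed
    have h0: "(\<lambda>n. ?h n) \<longlonglongrightarrow> 0" using LIMSEQ_Suc[OF lim_const_over_n[of \<delta>]] by simp
    have "(\<lambda>n. ?h n * of_int (x n) - t) \<longlonglongrightarrow> 0"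
      by (rule Lim_null_comparison[OF always_eventually h0]) (use close in simp)
    then have lim: "(\<lambda>n. ?h n * of_int (x n)) \<longlonglongrightarrow> t" by (rule LIM_zero_cancel)
    have limr: "(\<lambda>n. ?h (r n) * of_int (x (r n))) \<longlonglongrightarrow> t"
      using LIMSEQ_subseq_LIMSEQ[OF lim r] by (simp add: o_def)
    have "(\<lambda>n. f (?h (r n) * of_int (x (r n)))) \<longlonglongrightarrow> f t"
      using cont limr by (auto simp: continuous_on_eq_continuous_at intro: isCont_tendsto_compose)
    moreover have "(\<lambda>n. \<Sum>l<Q. fst (X (r n) l) * cis (snd (X (r n) l) * (?h (r n) * of_int (x (r n))))) \<longlonglongrightarrow> p t"
      unfolding p_def cis_conv_exp by (intro tendsto_intros Y limr) auto
    ultimately have T: "(\<lambda>n. norm (f (?h (r n) * of_int (x (r n))) -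
        (\<Sum>l<Q. fst (X (r n) l) * cis (snd (X (r n) l) * (?h (r n) * of_int (x (r n))))))) \<longlonglongrightarrow> norm (f t - p t)"
      by (intro tendsto_norm tendsto_diff)
    \<comment> \<open>From stage \<open>K\<close> on the grid point lies in the range where the
      finite approximation is valid.\<close>
    obtain K :: nat where K: "(\<bar>t\<bar> + \<delta>) / \<delta> \<le> real K" using real_arch_simple by blast
    have bound: "\<bar>x n\<bar> \<le> (int (Suc n))\<^sup>2" if "n \<ge> K" for n
    proof -
      have "\<bar>?h n * of_int (x n)\<bar> \<le> \<bar>t\<bar> + ?h n" using close[of n] by linarith
      also have "?h n \<le> \<delta>" using \<delta> by (simp add: divide_le_eq)
      also have "\<bar>t\<bar> + \<delta> \<le> real K * \<delta>" using K \<delta> by (simp add: pos_divide_le_eq)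
      also have "\<dots> \<le> real (Suc n) * \<delta>" using that \<delta> by (intro mult_right_mono) auto
      finally have "\<bar>of_int (x n)\<bar> * (\<delta> / real (Suc n)) \<le> real (Suc n) * \<delta>"
        using \<delta> by (simp add: abs_mult mult.commute)
      then have "\<bar>of_int (x n)\<bar> * \<delta> \<le> (real (Suc n) * \<delta>) * real (Suc n)"
        by (simp only: times_divide_eq_right pos_divide_le_eq of_nat_0_less_iff zero_less_Suc)
      then have "\<bar>of_int (x n)\<bar> * \<delta> \<le> (real (Suc n) * real (Suc n)) * \<delta>" by (simp only: mult_ac)
      then have "\<bar>of_int (x n)\<bar> \<le> real (Suc n) * real (Suc n)" using \<delta>(1) by (simp only: mult_le_cancel_right_pos)
      then have "real_of_int \<bar>x n\<bar> \<le> of_int ((int (Suc n))\<^sup>2)" by (simp add: power2_eq_square)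
      then show ?thesis by (simp only: of_int_le_iff)
    qed
    have "norm (f t - p t) \<le> 6 * e"
    proof (rule Lim_bounded[OF T, of K], intro allI impI)
      fix n assume "n \<ge> K"
      then have "r n \<ge> K" using seq_suble[OF r, of n] by simp
      from X(3)[OF bound[OF this]]
      show "norm (f (?h (r n) * of_int (x (r n))) -
        (\<Sum>l<Q. fst (X (r n) l) * cis (snd (X (r n) l) * (?h (r n) * of_int (x (r n)))))) \<le> 6 * e" .
    qed
    then show ?thesis by (simp add: e_def)
  qed
  moreover have "trig_polynomial p" unfolding p_def by (rule trig_polynomialI)
  ultimately show ?thesis by blast
qed

context window
begin

section \<open>Trigonometric approximation in the weighted norm\<close>

lemma trig_polynomial_bdm: "trig_polynomial p \<Longrightarrow> p \<in> bdm"
  by (elim trig_polynomialE) (simp add: bdm_sum bdm_mult bdm_const bdm_cis)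

text \<open>Exponentials are eigenfunctions of every multiplier, so truncation alters only the
  coefficients.\<close>

lemma trig_polynomial_fmult:
  assumes "trig_polynomial p" "m \<in> schwartz"
  shows "trig_polynomial (fmult m p)"
proof -
  obtain N :: nat and c w where p: "p = (\<lambda>x. \<Sum>j<N. c j * cis (w j * x))"
    by (rule trig_polynomialE[OF assms(1)])
  have "fmult m p = (\<lambda>x. \<Sum>j<N. (c j * m (w j)) * cis (w j * x))"
    unfolding p using assms(2)
    by (simp add: fun_eq_iff fmult_sum_right bdm_mult bdm_const bdm_cis fmult_cmult_right fmult_cis mult.assoc)
  then show ?thesis by (simp only: trig_polynomialI)
qed

text \<open>A uniform approximation alone says nothing about the weighted norm. Truncating it at
  level \<open>n\<close> costs a factor \<open>C n\<close>, and what remains is the truncation error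
  of \<open>f\<close> itself.\<close>

lemma bohr_trig_converges:
  assumes f: "f \<in> bdm" "Xn s f < \<infinity>" and ap: "bohr_almost_periodic f"
  shows "\<exists>p. (\<forall>n. trig_polynomial (p n)) \<and> X_converges \<eta> s (\<lambda>n. reg_dist (p n)) (reg_dist f)"
proof -
  obtain C where C: "\<And>n h. h \<in> bdm \<Longrightarrow> Xn s (fmult (low n) h) \<le> ennreal (C n) * supn h"
    using Xn_low_le by metis
  \<comment> \<open>The accuracy beats the constant \<open>C n\<close>, however fast it grows, and
    leaves an error of \<open>1 / (n + 1)\<close>.\<close>
  define d where "d = (\<lambda>n. 1 / (real (Suc n) * (\<bar>C n\<bar> + 1)))"
  have d: "d n > 0" for n unfolding d_def by (intro divide_pos_pos mult_pos_pos) auto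
  obtain P where P: "\<And>n. trig_polynomial (P n)" "\<And>n x. norm (f x - P n x) \<le> d n"
    using bohr_approximation[OF ap d] by metis
  have Pb: "P n \<in> bdm" for n by (rule trig_polynomial_bdm[OF P(1)])
  define g where "g = (\<lambda>n. fmult (low n) (P n))"
  have gb: "g n \<in> bdm" for n unfolding g_def by (intro fmult_bdm low_schwartz Pb)
  have gX: "Xn s (g n) < \<infinity>" for n unfolding g_def by (rule Xn_low_finite[OF Pb])
  have le: "Xn s (\<lambda>x. g n x - f x) \<le> ennreal (1 / real (Suc n)) + Xn s (\<lambda>x. fmult (low n) f x - f x)" for n
  proof -
    have fP: "(\<lambda>x. P n x - f x) \<in> bdm" by (intro bdm_diff Pb f)
    have low: "fmult (low n) (\<lambda>x. P n x - f x) \<in> bdm" "fmult (low n) f \<in> bdm"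
      by (intro fmult_bdm low_schwartz fP, intro fmult_bdm low_schwartz f)
    have eq: "(\<lambda>x. g n x - f x) = (\<lambda>x. fmult (low n) (\<lambda>x. P n x - f x) x + (fmult (low n) f x - f x))"
      by (simp add: g_def fmult_diff_right low_schwartz Pb f)
    have "Xn s (fmult (low n) (\<lambda>x. P n x - f x)) \<le> ennreal (C n) * supn (\<lambda>x. P n x - f x)" by (rule C[OF fP])
    also have "\<dots> \<le> ennreal (\<bar>C n\<bar> + 1) * ennreal (d n)"
      by (intro mult_mono ennreal_leI supn_least) (use P(2) in \<open>auto simp: norm_minus_commute\<close>)
    also have "\<dots> = ennreal ((\<bar>C n\<bar> + 1) * d n)" using d[of n] by (intro ennreal_mult[symmetric]) auto
    also have "(\<bar>C n\<bar> + 1) * d n = 1 / real (Suc n)" unfolding d_def by (simp add: add_nonneg_eq_0_iff)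
    finally have "Xn s (fmult (low n) (\<lambda>x. P n x - f x)) \<le> ennreal (1 / real (Suc n))" .
    then show ?thesis unfolding eq
      by (rule order.trans[OF Xn_add[OF low(1) bdm_diff[OF low(2) f(1)]] add_right_mono])
  qed
  have "(\<lambda>n. ennreal (1 / real (Suc n)) + Xn s (\<lambda>x. fmult (low n) f x - f x)) \<longlonglongrightarrow> ennreal 0 + 0"
    by (intro tendsto_add tendsto_ennrealI Xn_low_tendsto f LIMSEQ_Suc[OF lim_const_over_n])
  then have lim: "(\<lambda>n. ennreal (1 / real (Suc n)) + Xn s (\<lambda>x. fmult (low n) f x - f x)) \<longlonglongrightarrow> 0"
    unfolding ennreal_0 add_0_right .
  have "(\<lambda>n. Xn s (\<lambda>x. g n x - f x)) \<longlonglongrightarrow> 0"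
    by (rule tendsto_sandwich[OF _ always_eventually[OF allI[OF le]] tendsto_const lim]) simp
  then have "X_converges \<eta> s (\<lambda>n. reg_dist (g n)) (reg_dist f)"
    by (intro X_converges_reg_dist f gb gX)
  moreover have "trig_polynomial (g n)" for n unfolding g_def by (intro trig_polynomial_fmult P low_schwartz)
  ultimately show ?thesis by blast
qed

end

theorem corollary44:
  fixes \<eta> :: "real \<Rightarrow> real"
    and \<kappa> :: real
    and \<Phi> :: "real \<Rightarrow> distribution \<Rightarrow> distribution"
    and q\<^sub>0 :: distribution
  assumes "freq_window \<eta>"
    and "\<kappa> \<in> {1, -1}"
    and "nls_flow \<eta> \<kappa> \<Phi>"
    and "q\<^sub>0 \<in> X_space \<eta> 5"
  shows "(\<forall>F. X_converges \<eta> 5 F q\<^sub>0 \<longrightarrow> flow_converges \<eta> \<Phi> F q\<^sub>0) \<and>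
    (\<forall>n. \<exists>f\<in>Cb_infinity. block_regularization \<eta> n q\<^sub>0 = reg_dist f) \<and>
    X_converges \<eta> 5 (\<lambda>n. block_regularization \<eta> n q\<^sub>0) q\<^sub>0 \<and>
    flow_converges \<eta> \<Phi> (\<lambda>n. block_regularization \<eta> n q\<^sub>0) q\<^sub>0 \<and>
    ((\<exists>f. bohr_almost_periodic f \<and> q\<^sub>0 = reg_dist f) \<longrightarrow>
      (\<exists>p. (\<forall>n. trig_polynomial (p n)) \<and> X_converges \<eta> 5 (\<lambda>n. reg_dist (p n)) q\<^sub>0) \<and>
      (\<forall>p. (\<forall>n. trig_polynomial (p n)) \<and> X_converges \<eta> 5 (\<lambda>n. reg_dist (p n)) q\<^sub>0 \<longrightarrow>
        flow_converges \<eta> \<Phi> (\<lambda>n. reg_dist (p n)) q\<^sub>0))"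
proof -
  interpret window \<eta> by unfold_locales (rule assms(1))
  have flow: "flow_converges \<eta> \<Phi> F q\<^sub>0" if "X_converges \<eta> 5 F q\<^sub>0" for F
    by (rule flow_converges_of_X_converges[OF assms(3,2) that])
  obtain f where f: "f \<in> bdm" "q\<^sub>0 = reg_dist f" "Xn 5 f < \<infinity>"
    using X_space_rep[OF assms(4)] by (metis zero_le_numeral)
  have reg: "X_converges \<eta> 5 (\<lambda>n. block_regularization \<eta> n q\<^sub>0) q\<^sub>0"
    unfolding f(2) by (rule block_regularization_converges[OF f(1,3)])
  have smooth: "\<exists>h\<in>Cb_infinity. block_regularization \<eta> n q\<^sub>0 = reg_dist h" for n
    unfolding f(2) block_regularization_eq[OF f(1)] using fmult_Cb[OF low_schwartz f(1)] by blast
  have trig: "\<exists>p. (\<forall>n. trig_polynomial (p n)) \<and> X_converges \<eta> 5 (\<lambda>n. reg_dist (p n)) q\<^sub>0"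
    if h: "bohr_almost_periodic h" "q\<^sub>0 = reg_dist h" for h
  proof -
    have "continuous_on UNIV h" using h(1) by (simp add: bohr_almost_periodic_def)
    then have "h \<in> bdm" by (rule bdm_continuous[OF _ bohr_bounded[OF h(1)]])
    moreover from this have "Xn 5 h < \<infinity>" using assms(4) h(2) X_norm_reg_dist[of h 5] by (simp add: X_space_def)
    ultimately show ?thesis unfolding h(2) using bohr_trig_converges h(1) by blast
  qed
  show ?thesis using flow reg smooth trig by blast
qed

end
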